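(* (i) Let $F : [0,\infty) \to [0,\infty)$ be not identically zero. Then $F \circ K$ is a totally non-negative Lebesgue-measurable Toeplitz kernel on $\mathbb{R} \times \mathbb{R}$ for every totally non-negative Lebesgue-measurable Toeplitz kernel $K$ on $\mathbb{R} \times \mathbb{R}$ if and only if there is a constant $c > 0$ such that $F(x) = c$ for all $x \geq 0$, or $F(x) = cx$ for all $x \geq 0$, or $F(x) = c\,\mathbf{1}_{x>0}$ for all $x \geq 0$. (ii) Let $F : (0,\infty) \to (0,\infty)$. The following are equivalent: (a) $F \circ K$ is a totally positive Toeplitz kernel on $\mathbb{R} \times \mathbb{R}$ for every totally positive Toeplitz kernel $K$ on $\mathbb{R} \times \mathbb{R}$; (b) $F \circ K$ is a totally positive Lebesgue-measurable Toeplitz kernel on $\mathbb{R} \times \mathbb{R}$ for every totally positive Lebesgue-measurable Toeplitz kernel $K$ on $\mathbb{R} \times \mathbb{R}$; (c) there is a constant $c > 0$ such that $F(x) = cx$ for all $x > 0$.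
   Context: A Toeplitz kernel on $\mathbb{R} \times \mathbb{R}$ is a function of the form $K(x,y) = f(x-y)$ with $f : \mathbb{R} \to \mathbb{R}$; it is measurable when it is Lebesgue measurable (equivalently, $f$ is Lebesgue measurable). A kernel $K : \mathbb{R} \times \mathbb{R} \to \mathbb{R}$ is totally non-negative (respectively totally positive) if for every $n \in \mathbb{N}$ and all real $x_1 < \cdots < x_n$ and $y_1 < \cdots < y_n$ the determinant of $(K(x_i,y_j))_{i,j=1}^n$ is $\geq 0$ (respectively $> 0$). The function $\mathbf{1}_{x>0}$ equals $1$ for $x > 0$ and $0$ for $x = 0$. *)

theory Defs
  imports "HOL-Analysis.Lebesgue_Measure" "Jordan_Normal_Form.Determinant"
begin

definition toeplitz :: "(real \<times> real \<Rightarrow> real) \<Rightarrow> bool" where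
  "toeplitz K \<longleftrightarrow> (\<exists>f :: real \<Rightarrow> real. \<forall>x y. K (x, y) = f (x - y))"

text \<open>Points are indexed from 0; for \<open>n = 0\<close> the (empty) determinant is 1, so that
  allowing this case imposes no condition.\<close>

definition totally_nonneg :: "(real \<times> real \<Rightarrow> real) \<Rightarrow> bool" where
  "totally_nonneg K \<longleftrightarrow>
    (\<forall>(n :: nat) (x :: nat \<Rightarrow> real) (y :: nat \<Rightarrow> real).
      strict_mono_on {..<n} x \<longrightarrow> strict_mono_on {..<n} y \<longrightarrow>
      0 \<le> Determinant.det (Matrix.mat n n (\<lambda>(i, j). K (x i, y j))))"

definition totally_pos :: "(real \<times> real \<Rightarrow> real) \<Rightarrow> bool" where
  "totally_pos K \<longleftrightarrow>
    (\<forall>(n :: nat) (x :: nat \<Rightarrow> real) (y :: nat \<Rightarrow> real).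
      strict_mono_on {..<n} x \<longrightarrow> strict_mono_on {..<n} y \<longrightarrow>
      0 < Determinant.det (Matrix.mat n n (\<lambda>(i, j). K (x i, y j))))"

text \<open>Measurability on the plane with respect to the completed Lebesgue sigma-algebra.\<close>

definition lebesgue_measurable_kernel :: "(real \<times> real \<Rightarrow> real) \<Rightarrow> bool" where
  "lebesgue_measurable_kernel K \<longleftrightarrow> K \<in> borel_measurable (lebesgue :: (real \<times> real) measure)"

end

theory Submission
  imports Defs "HOL-Analysis.Starlike" "HOL-Real_Asymp.Real_Asymp"
    "HOL-Computational_Algebra.Fundamental_Theorem_Algebra"
begin

text \<open>
  A transform \<open>F\<close> with \<open>F 0 > 0\<close> is constant by \<open>2 \<times> 2\<close> minors of indicators of a point and a half-line.
  Otherwise Gaussian kernels make \<open>F\<close> nondecreasing with \<open>t \<mapsto> ln (F (exp t))\<close> concave. If a totally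
  nonnegative \<open>f\<close> tends to \<open>a > 0\<close> at infinity, letting one row and one column escape to infinity shows
  that the \<open>n \<times> n\<close> minors of \<open>a - f\<close> inherit the sign of the \<open>(n + 1) \<times> (n + 1)\<close> minors of \<open>f\<close>.
  Iterate this for \<open>F (s * W1 v)\<close> and \<open>F (s * W2 v)\<close>, \<open>v = exp (- x)\<close>, where \<open>W1\<close> and \<open>W2\<close> are two explicit
  totally positive functions whose expansions at \<open>v = 0\<close> lack the term \<open>v\<^sup>2\<close>, respectively \<open>v\<^sup>4\<close>.
  This isolates the sign of the second-order term of \<open>F\<close> at \<open>s\<close>: unless \<open>F\<close> is constant on the positive
  half-line, minors of size three make it convex there and minors of size four make it concave, so it is
  affine, and by positivity and logarithmic concavity it is linear.

  That the indicator of the positive half-line preserves total nonnegativity rests on Schoenberg's theorem that a totally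
  nonnegative Toeplitz function cannot have a bounded nondegenerate support. Sampled on a lattice, such a
  function gives polynomials which by variation diminution have only real roots; their coefficients are
  then distributed like a sum of independent Bernoulli variables, too concentrated for a fixed function
  sampled ever more finely.
\<close>

subsection \<open>Minors\<close>

text \<open>No regularity of \<open>F\<close> is assumed, so no derivative can be taken, although
  the aim is the sign of a second-order term. Two supports replace Taylor's formula: logarithmic
  concavity gives a power function touching \<open>F\<close> from above at each \<open>s\<close>,
  convexity a line touching it from below, and their slopes agree. The argument with minors of size
  four needs both, so convexity has to be available before concavity. The powers missing from
  \<open>W1\<close> and \<open>W2\<close> are those at which the second-order term of
  \<open>F\<close> enters \<open>F (s * W1 v)\<close> and \<open>F (s * W2 v)\<close>; without a
  contribution of \<open>W1\<close> or \<open>W2\<close> itself at that order, nothing masks it. All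
  this uses only continuous totally positive test functions, so that one argument
  (\<open>tp_to_tn\<close>) serves both parts of the theorem. The theorem on bounded supports has a
  second use: a preserver with \<open>F 0 = 0\<close> cannot vanish at a positive point, because it
  would cut a Gaussian down to bounded support.\<close>

definition mdet :: "nat \<Rightarrow> (nat \<Rightarrow> nat \<Rightarrow> real) \<Rightarrow> real" where
  "mdet n A = Determinant.det (Matrix.mat n n (\<lambda>(i, j). A i j))"

lemma mdet_leibniz:
  "mdet n A = (\<Sum>p | p permutes {0..<n}. signof p * (\<Prod>i = 0..<n. A i (p i)))"
proof -
  have "mdet n A = (\<Sum>p | p permutes {0..<n}. signof p *
      (\<Prod>i = 0..<n. Matrix.mat n n (\<lambda>(i, j). A i j) $$ (i, p i)))"
    unfolding mdet_def by (rule det_def') simp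
  also have "\<dots> = (\<Sum>p | p permutes {0..<n}. signof p * (\<Prod>i = 0..<n. A i (p i)))"
    by (intro sum.cong refl arg_cong2[where f = "(*)"] prod.cong)
      (auto simp: permutes_in_image)
  finally show ?thesis .
qed

lemma mdet_cong:
  assumes "\<And>i j. i < n \<Longrightarrow> j < n \<Longrightarrow> A i j = B i j"
  shows "mdet n A = mdet n B"
  unfolding mdet_def using assms by (intro arg_cong[where f = Determinant.det]) auto

lemma mdet_0 [simp]: "mdet 0 A = 1"
  unfolding mdet_def by (rule det_dim_zero) simp

lemma mdet_transpose: "mdet n (\<lambda>i j. A j i) = mdet n A"
proof -
  have "Matrix.mat n n (\<lambda>(i, j). A j i) = transpose_mat (Matrix.mat n n (\<lambda>(i, j). A i j))"
    by auto
  then show ?thesis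
    unfolding mdet_def using det_transpose[of "Matrix.mat n n (\<lambda>(i, j). A i j)" n] by simp
qed

lemma mdet_scale:
  "mdet n (\<lambda>i j. r i * c j * A i j) = (\<Prod>i<n. r i) * (\<Prod>j<n. c j) * mdet n A"
proof -
  have "(\<Prod>i = 0..<n. c (p i)) = (\<Prod>i = 0..<n. c i)" if "p permutes {0..<n}" for p
    using prod.permute[OF that, of c] by (simp add: o_def)
  then show ?thesis
    unfolding mdet_leibniz sum_distrib_left
    by (intro sum.cong) (auto simp: prod.distrib lessThan_atLeast0)
qed

lemma mdet_expand_row:
  assumes "i < Suc n"
  shows "mdet (Suc n) A = (\<Sum>j<Suc n. A i j * ((-1) ^ (i + j) *
    mdet n (\<lambda>i' j'. A (insert_index i i') (insert_index j j'))))"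
proof -
  have "mat_delete (Matrix.mat (Suc n) (Suc n) (\<lambda>(i, j). A i j)) i j =
      Matrix.mat n n (\<lambda>(i', j'). A (insert_index i i') (insert_index j j'))" if "j < Suc n" for j
    using assms that by (auto simp: mat_delete_def insert_index_def)
  then show ?thesis
    unfolding mdet_def using assms
    by (subst laplace_expansion_row[of _ "Suc n" i]) (auto simp: cofactor_def intro!: sum.cong)
qed

lemma mdet_expand_col:
  assumes "j < Suc n"
  shows "mdet (Suc n) A = (\<Sum>i<Suc n. A i j * ((-1) ^ (i + j) *
    mdet n (\<lambda>i' j'. A (insert_index i i') (insert_index j j'))))"
proof -
  have "mdet (Suc n) A = mdet (Suc n) (\<lambda>i j. A j i)"
    by (rule mdet_transpose[symmetric])
  also have "\<dots> = (\<Sum>i<Suc n. A i j * ((-1) ^ (j + i) *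
      mdet n (\<lambda>i' j'. A (insert_index i j') (insert_index j i'))))"
    by (rule mdet_expand_row[OF assms])
  also have "\<dots> = (\<Sum>i<Suc n. A i j * ((-1) ^ (i + j) *
      mdet n (\<lambda>i' j'. A (insert_index i i') (insert_index j j'))))"
    by (intro sum.cong refl arg_cong2[where f = "(*)"])
      (simp add: add.commute, rule mdet_transpose)
  finally show ?thesis .
qed

lemma mdet_1 [simp]: "mdet (Suc 0) A = A 0 0"
  by (subst mdet_expand_row[of 0]) auto

lemma mdet_2: "mdet 2 A = A 0 0 * A 1 1 - A 0 1 * A 1 0"
  unfolding numeral_2_eq_2 by (subst mdet_expand_row[of 0]) (auto simp: insert_index_def)

lemma mdet_3: "mdet 3 A = A 0 0 * (A 1 1 * A 2 2 - A 1 2 * A 2 1)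
    - A 0 1 * (A 1 0 * A 2 2 - A 1 2 * A 2 0) + A 0 2 * (A 1 0 * A 2 1 - A 1 1 * A 2 0)"
proof -
  have *: "(3::nat) = Suc 2" by simp
  have s: "{..<Suc 2} = {0, 1, 2::nat}" by auto
  show ?thesis
    unfolding * by (subst mdet_expand_row[of 0 2])
      (simp_all only: s, simp_all add: mdet_2 insert_index_def algebra_simps,
        simp add: numeral_2_eq_2 algebra_simps)
qed

lemma mdet_upd_row_expand:
  assumes "k < Suc n"
  shows "mdet (Suc n) (A(k := u)) = (\<Sum>j<Suc n. u j * ((-1) ^ (k + j) *
    mdet n (\<lambda>i' j'. A (insert_index k i') (insert_index j j'))))"
proof -
  have "insert_index k i \<noteq> k" for i
    by (simp add: insert_index_def)
  then show ?thesis
    by (subst mdet_expand_row[OF assms]) (simp del: sum.lessThan_Suc insert_index)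
qed

lemma mdet_upd_row_linear:
  assumes "k < n"
  shows "mdet n (A(k := (\<lambda>j. s * u j + t * v j))) = s * mdet n (A(k := u)) + t * mdet n (A(k := v))"
proof -
  obtain m where n: "n = Suc m"
    using assms by (cases n) auto
  show ?thesis
    using assms unfolding n
    by (simp add: mdet_upd_row_expand sum_distrib_left sum.distrib algebra_simps
        del: sum.lessThan_Suc)
qed

lemma mdet_eq_rows:
  assumes "i < n" "k < n" "i \<noteq> k" "\<And>j. j < n \<Longrightarrow> A i j = A k j"
  shows "mdet n A = 0"
  unfolding mdet_def using assms
  by (intro det_identical_rows[of _ n i k]) (auto intro!: eq_vecI)

lemma mdet_eq_cols:
  assumes "i < n" "k < n" "i \<noteq> k" "\<And>j. j < n \<Longrightarrow> A j i = A j k"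
  shows "mdet n A = 0"
  by (subst mdet_transpose[symmetric], rule mdet_eq_rows[of i n k]) (use assms in auto)

lemma mdet_add_row:
  assumes "k < n" "l < n" "k \<noteq> l"
  shows "mdet n (A(k := (\<lambda>j. A k j + t * A l j))) = mdet n A"
proof -
  have "mdet n (A(k := (\<lambda>j. 1 * A k j + t * A l j))) = 1 * mdet n (A(k := A k)) + t * mdet n (A(k := A l))"
    by (rule mdet_upd_row_linear[OF assms(1)])
  moreover have "mdet n (A(k := A l)) = 0"
    by (rule mdet_eq_rows[of k n l]) (use assms in auto)
  ultimately show ?thesis by simp
qed

lemma mdet_upd_col_linear:
  assumes "k < n"
  shows "mdet n (\<lambda>i. (A i)(k := s * u i + t * v i)) =
    s * mdet n (\<lambda>i. (A i)(k := u i)) + t * mdet n (\<lambda>i. (A i)(k := v i))"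
proof -
  have tr: "mdet n (\<lambda>i. (A i)(k := w i)) = mdet n ((\<lambda>i j. A j i)(k := w))" for w
    by (subst mdet_transpose[symmetric], rule mdet_cong) auto
  show ?thesis
    unfolding tr by (rule mdet_upd_row_linear[OF assms])
qed

lemma mdet_zero_imp_kernel:
  assumes "mdet n A = 0"
  obtains g where "\<exists>j<n. g j \<noteq> 0" "\<And>i. i < n \<Longrightarrow> (\<Sum>j<n. A i j * g j) = 0"
proof -
  let ?M = "Matrix.mat n n (\<lambda>(i, j). A i j)"
  have "\<exists>v. v \<in> carrier_vec n \<and> v \<noteq> 0\<^sub>v n \<and> ?M *\<^sub>v v = 0\<^sub>v n"
    using assms det_0_iff_vec_prod_zero[of ?M n] unfolding mdet_def by auto
  then obtain v where v: "v \<in> carrier_vec n" "v \<noteq> 0\<^sub>v n" "?M *\<^sub>v v = 0\<^sub>v n"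
    by blast
  show thesis
  proof (rule that[of "\<lambda>j. vec_index v j"])
    show "\<exists>j<n. vec_index v j \<noteq> 0"
    proof (rule ccontr)
      assume "\<not> ?thesis"
      then have "v = 0\<^sub>v n" using v(1) by (intro eq_vecI) auto
      with v(2) show False by simp
    qed
    show "(\<Sum>j<n. A i j * vec_index v j) = 0" if "i < n" for i
    proof -
      have "vec_index (?M *\<^sub>v v) i = (\<Sum>j<n. A i j * vec_index v j)"
        using v(1) that by (auto simp: scalar_prod_def lessThan_atLeast0 intro!: sum.cong)
      then show ?thesis using v(3) that by simp
    qed
  qed
qed

lemma tendsto_mdet:
  assumes "\<And>i j. i < n \<Longrightarrow> j < n \<Longrightarrow> ((\<lambda>t. A t i j) \<longlongrightarrow> B i j) F"
  shows "((\<lambda>t. mdet n (A t)) \<longlongrightarrow> mdet n B) F"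
  unfolding mdet_leibniz
  by (intro tendsto_sum tendsto_mult tendsto_const tendsto_prod assms)
    (auto simp: permutes_in_image)

subsection \<open>Variation diminution\<close>

lemma mdet_kernel_imp_zero:
  assumes "\<And>i. i < n \<Longrightarrow> (\<Sum>j<n. A i j * g j) = 0" "k < n" "g k \<noteq> 0"
  shows "mdet n A = 0"
proof -
  let ?M = "Matrix.mat n n (\<lambda>(i, j). A i j)" and ?v = "Matrix.vec n g"
  have "?M *\<^sub>v ?v = 0\<^sub>v n"
  proof (rule eq_vecI)
    fix i assume "i < dim_vec (0\<^sub>v n :: real Matrix.vec)"
    then have "i < n" by simp
    then have "vec_index (?M *\<^sub>v ?v) i = (\<Sum>j<n. A i j * g j)"
      by (auto simp: scalar_prod_def lessThan_atLeast0 intro!: sum.cong)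
    with \<open>i < n\<close> show "vec_index (?M *\<^sub>v ?v) i = vec_index (0\<^sub>v n) i"
      using assms(1) by simp
  qed simp
  moreover have "?v \<noteq> 0\<^sub>v n"
  proof
    assume "?v = 0\<^sub>v n"
    then have "vec_index ?v k = vec_index (0\<^sub>v n) k" by simp
    with assms show False by simp
  qed
  ultimately show ?thesis
    unfolding mdet_def using det_0_iff_vec_prod_zero[OF mat_carrier] vec_carrier[of n g] by blast
qed

text \<open>Only the columns are bounded: \<open>variation_diminishing\<close> inducts on their
  number, while the rows are chosen freely by an alternating chain of outputs.\<close>

definition tn_cols :: "nat \<Rightarrow> (nat \<Rightarrow> nat \<Rightarrow> real) \<Rightarrow> bool" where
  "tn_cols n B \<longleftrightarrow> (\<forall>k r s. strict_mono_on {..<k} r \<longrightarrow> strict_mono_on {..<k} s \<longrightarrow>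
     s ` {..<k} \<subseteq> {..<n} \<longrightarrow> 0 \<le> mdet k (\<lambda>i j. B (r i) (s j)))"

text \<open>Encodes at least \<open>l - 1\<close> sign changes of \<open>z\<close>; the free choice
  of positions \<open>r\<close> passes over zeros and repeated signs.\<close>

definition alt_chain :: "(nat \<Rightarrow> real) \<Rightarrow> nat \<Rightarrow> (nat \<Rightarrow> nat) \<Rightarrow> bool" where
  "alt_chain z l r \<longleftrightarrow> strict_mono_on {..<l} r \<and> (\<forall>i. Suc i < l \<longrightarrow> z (r i) * z (r (Suc i)) < 0)"

lemma tn_colsD:
  assumes "tn_cols n B" "strict_mono_on {..<k} r" "strict_mono_on {..<k} s" "s ` {..<k} \<subseteq> {..<n}"
  shows "0 \<le> mdet k (\<lambda>i j. B (r i) (s j))"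
  using assms unfolding tn_cols_def by blast

lemma insert_index_less_iff: "insert_index j x < insert_index j y \<longleftrightarrow> x < y"
  by (auto simp: insert_index_def)

lemma insert_index_less: "x < n \<Longrightarrow> insert_index j x < Suc n"
  by (auto simp: insert_index_def)

lemma tn_cols_drop:
  assumes "tn_cols (Suc n) B"
  shows "tn_cols n (\<lambda>i k. B i (insert_index j k))"
  unfolding tn_cols_def
proof (intro allI impI)
  fix k :: nat and r s :: "nat \<Rightarrow> nat"
  assume "strict_mono_on {..<k} r" "strict_mono_on {..<k} s" "s ` {..<k} \<subseteq> {..<n}"
  then show "0 \<le> mdet k (\<lambda>i p. B (r i) (insert_index j (s p)))"
    by (intro tn_colsD[OF assms, where s = "\<lambda>p. insert_index j (s p)"])
      (auto simp: strict_mono_on_def insert_index_less_iff image_subset_iff insert_index_less)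
qed

lemma sum_drop_index:
  fixes f :: "nat \<Rightarrow> real"
  assumes "j < Suc n"
  shows "(\<Sum>k<Suc n. f k) = f j + (\<Sum>k<n. f (insert_index j k))"
proof -
  have eq: "{..<Suc n} = insert j (insert_index j ` {..<n})"
  proof (intro equalityI subsetI)
    fix x assume "x \<in> {..<Suc n}"
    then have "x = j \<or> x = insert_index j (delete_index j x) \<and> delete_index j x < n"
      using assms by (auto simp: insert_index_def delete_index_def)
    then show "x \<in> insert j (insert_index j ` {..<n})" by blast
  qed (use assms insert_index_less in auto)
  have "j \<notin> insert_index j ` {..<n}" "inj_on (insert_index j) {..<n}"
    by (auto simp: insert_index_def inj_on_def split: if_splits)
  then show ?thesis
    unfolding eq by (simp add: sum.reindex)
qed

lemma alt_chain_sgn: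
  assumes "alt_chain a' l s" "\<And>k. sgn (a' k) = sgn (a (f k))" "\<And>x y. x < y \<Longrightarrow> f x < f y"
  shows "alt_chain a l (\<lambda>i. f (s i))"
proof -
  have "a (f (s i)) * a (f (s (Suc i))) < 0" if "Suc i < l" for i
  proof -
    have "sgn (a' (s i) * a' (s (Suc i))) = -1"
      using assms(1) that unfolding alt_chain_def sgn_1_neg by blast
    then have "sgn (a (f (s i)) * a (f (s (Suc i)))) = -1"
      by (simp add: sgn_mult assms(2))
    then show ?thesis
      by (simp only: sgn_1_neg)
  qed
  then show ?thesis
    using assms(1,3) by (auto simp: alt_chain_def strict_mono_on_def)
qed

text \<open>By linearity in the merged column a minor splits into one that uses column
  \<open>j\<close> and one that uses \<open>Suc j\<close> instead. Since these are neighbours, the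
  exchange keeps the selection increasing.\<close>

lemma tn_cols_merge:
  assumes B: "tn_cols (Suc n) B" and j: "Suc j < Suc n" and u: "u \<ge> 0" "v \<ge> 0"
  shows "tn_cols n (\<lambda>i. (\<lambda>k. B i (insert_index (Suc j) k))(j := u * B i j + v * B i (Suc j)))"
    (is "tn_cols n ?B'")
  unfolding tn_cols_def
proof (intro allI impI)
  fix k :: nat and r s :: "nat \<Rightarrow> nat"
  assume r: "strict_mono_on {..<k} r" and s: "strict_mono_on {..<k} s" "s ` {..<k} \<subseteq> {..<n}"
  let ?B = "\<lambda>i k. B i (insert_index (Suc j) k)"
  have drop: "0 \<le> mdet k (\<lambda>i p. ?B (r i) (s p))"
    by (rule tn_colsD[OF tn_cols_drop[OF B] r s])
  show "0 \<le> mdet k (\<lambda>i p. ?B' (r i) (s p))"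
  proof (cases "j \<in> s ` {..<k}")
    case False
    then have "mdet k (\<lambda>i p. ?B' (r i) (s p)) = mdet k (\<lambda>i p. ?B (r i) (s p))"
      by (intro mdet_cong) auto
    with drop show ?thesis by simp
  next
    case True
    then obtain q where q: "q < k" "s q = j" by auto
    define s' where "s' = (\<lambda>p. insert_index (Suc j) (s p))(q := Suc j)"
    have lt: "s p < j" if "p < q" for p
      using s(1) q that by (auto simp: strict_mono_on_def)
    have gt: "s p > j" if "p > q" "p < k" for p
      using s(1) q that by (auto simp: strict_mono_on_def)
    have iff: "s p = j \<longleftrightarrow> p = q" if "p < k" for p
      using lt[of p] gt[of p] q that by (cases p q rule: linorder_cases) auto
    have s': "strict_mono_on {..<k} s'"
    proof (rule strict_mono_onI)
      fix x y assume xy: "x \<in> {..<k}" "y \<in> {..<k}" "x < y"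
      then have "s x < s y" using s(1) by (auto simp: strict_mono_on_def)
      then show "s' x < s' y"
        using lt[of x] gt[of y] xy unfolding s'_def by (auto simp: insert_index_def)
    qed
    have s'n: "s' ` {..<k} \<subseteq> {..<Suc n}"
      using s(2) j by (auto simp: s'_def insert_index_def)
    have "mdet k (\<lambda>i p. ?B' (r i) (s p)) =
        mdet k (\<lambda>i. (\<lambda>p. ?B (r i) (s p))(q := u * B (r i) j + v * B (r i) (Suc j)))"
      using q iff by (intro mdet_cong) auto
    also have "\<dots> = u * mdet k (\<lambda>i. (\<lambda>p. ?B (r i) (s p))(q := B (r i) j)) +
        v * mdet k (\<lambda>i. (\<lambda>p. ?B (r i) (s p))(q := B (r i) (Suc j)))"
      by (rule mdet_upd_col_linear[OF q(1)])
    also have "mdet k (\<lambda>i. (\<lambda>p. ?B (r i) (s p))(q := B (r i) j)) = mdet k (\<lambda>i p. ?B (r i) (s p))"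
      using q by (intro mdet_cong) (auto simp: insert_index_def)
    also have "mdet k (\<lambda>i. (\<lambda>p. ?B (r i) (s p))(q := B (r i) (Suc j))) =
        mdet k (\<lambda>i p. B (r i) (s' p))"
      by (intro mdet_cong) (auto simp: s'_def)
    finally show ?thesis
      using drop tn_colsD[OF B r s' s'n] u by simp
  qed
qed

lemma strict_mono_on_card_le:
  fixes s :: "nat \<Rightarrow> nat"
  assumes "strict_mono_on {..<l} s" "s ` {..<l} \<subseteq> {..<n}"
  shows "l \<le> n"
  using card_inj_on_le[OF strict_mono_on_imp_inj_on[OF assms(1)] assms(2)] by simp

text \<open>Induction on the columns. A zero coefficient deletes its column; neighbours of equal
  sign merge into one column with nonnegative weights; otherwise \<open>a\<close> alternates
  throughout, and only a chain longer than the number of columns could fail, which a kernel vector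
  excludes.\<close>

theorem variation_diminishing:
  assumes "tn_cols n B" "l \<ge> 2" "alt_chain (\<lambda>i. \<Sum>j<n. B i j * a j) l r"
  shows "\<exists>s. s ` {..<l} \<subseteq> {..<n} \<and> alt_chain a l s"
  using assms
proof (induction n arbitrary: B a l r)
  case 0
  then have "(0::real) < 0"
    unfolding alt_chain_def by (auto dest: spec[of _ 0])
  then show ?case by simp
next
  case (Suc n)
  let ?z = "\<lambda>i. \<Sum>j<Suc n. B i j * a j"
  note [simp del] = sum.lessThan_Suc insert_index
  have chain: "alt_chain ?z l r" by fact
  consider (zero) j where "j < Suc n" "a j = 0"
    | (merge) j where "Suc j < Suc n" "a j * a (Suc j) > 0"
    | (alt) "\<And>j. j < Suc n \<Longrightarrow> a j \<noteq> 0" "\<And>j. Suc j < Suc n \<Longrightarrow> a j * a (Suc j) < 0"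
    by (metis Suc_lessD linorder_neqE_linordered_idom mult_eq_0_iff)
  then show ?case
  proof cases
    case zero
    have eq: "?z = (\<lambda>i. \<Sum>k<n. B i (insert_index j k) * a (insert_index j k))"
      using zero by (subst sum_drop_index[of j]) auto
    obtain s where s: "s ` {..<l} \<subseteq> {..<n}" "alt_chain (\<lambda>k. a (insert_index j k)) l s"
      using Suc.IH[OF tn_cols_drop[OF Suc.prems(1), of j] Suc.prems(2) chain[unfolded eq]] by blast
    have "alt_chain a l (\<lambda>i. insert_index j (s i))"
      by (rule alt_chain_sgn[OF s(2)]) (simp_all add: insert_index_less_iff)
    with s(1) show ?thesis
      by (intro exI[of _ "\<lambda>i. insert_index j (s i)"]) (auto simp: insert_index_less image_subset_iff)
  next
    case merge
    let ?B' = "\<lambda>i. (\<lambda>k. B i (insert_index (Suc j) k))(j := \<bar>a j\<bar> * B i j + \<bar>a (Suc j)\<bar> * B i (Suc j))"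
    let ?a' = "(\<lambda>k. a (insert_index (Suc j) k))(j := sgn (a j))"
    have B': "tn_cols n ?B'"
      by (rule tn_cols_merge[OF Suc.prems(1) merge(1)]) auto
    have jn: "j < n" using merge by simp
    have sg: "sgn (a (Suc j)) = sgn (a j)"
      using merge(2) by (auto simp: zero_less_mult_iff)
    have eq: "?z = (\<lambda>i. \<Sum>k<n. ?B' i k * ?a' k)"
    proof
      fix i
      obtain m where n: "n = Suc m" using jn by (cases n) auto
      have "?z i = B i (Suc j) * a (Suc j) +
          (\<Sum>k<n. B i (insert_index (Suc j) k) * a (insert_index (Suc j) k))"
        using merge(1) by (rule sum_drop_index)
      also have "(\<Sum>k<n. B i (insert_index (Suc j) k) * a (insert_index (Suc j) k)) =
          B i j * a j + (\<Sum>k<m. B i (insert_index (Suc j) (insert_index j k)) *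
            a (insert_index (Suc j) (insert_index j k)))"
        unfolding n by (subst sum_drop_index[of j]) (use jn n in \<open>auto simp: insert_index_def\<close>)
      also have "B i (Suc j) * a (Suc j) + (B i j * a j + (\<Sum>k<m. B i (insert_index (Suc j) (insert_index j k)) *
            a (insert_index (Suc j) (insert_index j k)))) = (\<Sum>k<n. ?B' i k * ?a' k)"
      proof -
        have ne: "insert_index j k \<noteq> j" for k by (simp add: insert_index_def)
        have "sgn (a j) * \<bar>a j\<bar> = a j" "sgn (a j) * \<bar>a (Suc j)\<bar> = a (Suc j)"
          using sg by (simp add: sgn_mult_abs, metis sgn_mult_abs)
        then have "?B' i j * ?a' j = B i (Suc j) * a (Suc j) + B i j * a j"
          by (simp add: algebra_simps)
        then show ?thesis
          unfolding n by (subst sum_drop_index[of j]) (use jn n ne in auto)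
      qed
      finally show "?z i = (\<Sum>k<n. ?B' i k * ?a' k)" .
    qed
    obtain s where s: "s ` {..<l} \<subseteq> {..<n}" "alt_chain ?a' l s"
      using Suc.IH[OF B' Suc.prems(2) chain[unfolded eq]] by blast
    have "alt_chain a l (\<lambda>i. insert_index (Suc j) (s i))"
      by (rule alt_chain_sgn[OF s(2)]) (auto simp: insert_index_less_iff insert_index_def)
    with s(1) show ?thesis
      by (intro exI[of _ "\<lambda>i. insert_index (Suc j) (s i)"])
        (auto simp: insert_index_less image_subset_iff)
  next
    case alt
    show ?thesis
    proof (cases "l \<le> Suc n")
      case True
      with alt show ?thesis
        by (intro exI[of _ id]) (auto simp: alt_chain_def strict_mono_on_def)
    next
      case False
      have False
      proof -
        let ?N = "Suc n"
        have zz: "?z (r i) * ?z (r (Suc i)) < 0" if "Suc i < l" for i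
          using chain that by (auto simp: alt_chain_def)
        have r: "strict_mono_on {..<l} r" using chain by (simp add: alt_chain_def)
        define e where "e = ?z (r 0)"
        have sign: "e * (-1) ^ i * ?z (r i) > 0" if "i < l" for i
          using that
        proof (induction i)
          case 0
          have "e \<noteq> 0" using zz[of 0] Suc.prems(2) unfolding e_def by auto
          then show ?case unfolding e_def by (auto simp: zero_less_mult_iff)
        next
          case (Suc i)
          then have "e * (-1) ^ i * ?z (r i) > 0" "?z (r i) * ?z (r (Suc i)) < 0"
            using zz[of i] by auto
          then show ?case
            by (auto simp: zero_less_mult_iff mult_less_0_iff)
        qed
        \<comment> \<open>Appending the output as an extra column gives a singular matrix. In the
          expansion along that column the alternation of the outputs cancels the cofactor signs, so
          all terms are nonnegative and each of them vanishes.\<close>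
        define M where "M = (\<lambda>i j. if j < ?N then B (r i) j else ?z (r i))"
        have "mdet (Suc ?N) M = 0"
        proof (rule mdet_kernel_imp_zero[of _ _ "\<lambda>j. if j < ?N then a j else -1" ?N])
          show "(\<Sum>j<Suc ?N. M i j * (if j < ?N then a j else - 1)) = 0" for i
            by (simp add: sum.lessThan_Suc[of _ ?N] M_def)
        qed auto
        then have "(\<Sum>i<Suc ?N. M i ?N * ((-1) ^ (i + ?N) *
            mdet ?N (\<lambda>i' j'. M (insert_index i i') (insert_index ?N j')))) = 0"
          by (subst (asm) mdet_expand_col[of ?N]) auto
        then have "e * (-1) ^ ?N * (\<Sum>i<Suc ?N. M i ?N * ((-1) ^ (i + ?N) *
            mdet ?N (\<lambda>i' j'. M (insert_index i i') (insert_index ?N j')))) = 0"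
          by simp
        also have "e * (-1) ^ ?N * (\<Sum>i<Suc ?N. M i ?N * ((-1) ^ (i + ?N) *
            mdet ?N (\<lambda>i' j'. M (insert_index i i') (insert_index ?N j')))) =
          (\<Sum>i<Suc ?N. (e * (-1) ^ i * ?z (r i)) *
            mdet ?N (\<lambda>i' j'. M (insert_index i i') (insert_index ?N j')))"
        proof (subst sum_distrib_left, intro sum.cong refl)
          fix i
          have sq: "(-1) ^ ?N * (-1) ^ (i + ?N) = ((-1) ^ i :: real)"
            by (simp add: power_add)
          have MN: "M i ?N = ?z (r i)" by (simp add: M_def)
          have alg: "e * p * (z * (w * m)) = e * (p * w) * z * m" for p z w m :: real by simp
          show "e * (-1) ^ ?N * (M i ?N * ((-1) ^ (i + ?N) *
              mdet ?N (\<lambda>i' j'. M (insert_index i i') (insert_index ?N j')))) =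
            e * (-1) ^ i * ?z (r i) * mdet ?N (\<lambda>i' j'. M (insert_index i i') (insert_index ?N j'))"
            by (simp only: alg sq MN)
        qed
        finally have vanish: "(\<Sum>i<Suc ?N. (e * (-1) ^ i * ?z (r i)) *
            mdet ?N (\<lambda>i' j'. M (insert_index i i') (insert_index ?N j'))) = 0" .
        have minor: "0 \<le> mdet ?N (\<lambda>i' j'. M (insert_index i i') (insert_index ?N j'))"
          if "i < Suc ?N" for i
        proof -
          have "mdet ?N (\<lambda>i' j'. M (insert_index i i') (insert_index ?N j')) =
              mdet ?N (\<lambda>i' j'. B (r (insert_index i i')) (id j'))"
            by (intro mdet_cong) (auto simp: M_def insert_index_def)
          also have "\<dots> \<ge> 0"
            using r False that
            by (intro tn_colsD[OF Suc.prems(1)])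
              (auto simp: strict_mono_on_def insert_index_less_iff insert_index_def)
          finally show ?thesis .
        qed
        have "0 \<le> (e * (-1) ^ i * ?z (r i)) *
            mdet ?N (\<lambda>i' j'. M (insert_index i i') (insert_index ?N j'))" if "i < Suc ?N" for i
          by (rule mult_nonneg_nonneg[OF less_imp_le[OF sign] minor]) (use that False in auto)
        with vanish have "(e * (-1) ^ ?N * ?z (r ?N)) *
            mdet ?N (\<lambda>i' j'. M (insert_index ?N i') (insert_index ?N j')) = 0"
          by (subst (asm) sum_nonneg_eq_0_iff) auto
        moreover have "e * (-1) ^ ?N * ?z (r ?N) > 0" using sign[of ?N] False by auto
        ultimately have "mdet ?N (\<lambda>i' j'. M (insert_index ?N i') (insert_index ?N j')) = 0"
          by auto
        also have "mdet ?N (\<lambda>i' j'. M (insert_index ?N i') (insert_index ?N j')) =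
            mdet ?N (\<lambda>i j. B (r i) j)"
          by (intro mdet_cong) (auto simp: M_def insert_index_def)
        finally obtain g where g: "\<exists>j<?N. g j \<noteq> 0"
          and gker: "\<And>i. i < ?N \<Longrightarrow> (\<Sum>j<?N. B (r i) j * g j) = 0"
          using mdet_zero_imp_kernel by blast
        \<comment> \<open>Subtracting a multiple of the kernel vector \<open>g\<close> removes one
          coefficient without changing the first \<open>Suc n\<close> outputs; the induction
          hypothesis then puts \<open>Suc n\<close> alternating positions among \<open>n\<close>
          columns.\<close>
        define J where "J = {j. j < ?N \<and> g j \<noteq> 0}"
        have "finite J" "J \<noteq> {}" using g by (auto simp: J_def)
        define q where "q = arg_min_on (\<lambda>j. \<bar>a j / g j\<bar>) J"
        have q: "q \<in> J" "\<And>j. j \<in> J \<Longrightarrow> \<bar>a q / g q\<bar> \<le> \<bar>a j / g j\<bar>"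
          using arg_min_if_finite[OF \<open>finite J\<close> \<open>J \<noteq> {}\<close>, of "\<lambda>j. \<bar>a j / g j\<bar>"]
          unfolding q_def by (auto simp: not_less)
        define a' where "a' = (\<lambda>j. a j - (a q / g q) * g j)"
        have a'q: "a' q = 0" "q < ?N" using q(1) by (auto simp: a'_def J_def)
        have sum_a': "(\<Sum>j<?N. B (r i) j * a' j) = ?z (r i)" if "i < ?N" for i
        proof -
          have "(\<Sum>j<?N. B (r i) j * a' j) =
              ?z (r i) - (a q / g q) * (\<Sum>j<?N. B (r i) j * g j)"
            unfolding a'_def by (simp add: algebra_simps sum_subtractf sum_distrib_left)
          then show ?thesis using gker[OF that] by simp
        qed
        have drop: "(\<Sum>k<n. B (r i) (insert_index q k) * a' (insert_index q k)) = ?z (r i)"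
          if "i < ?N" for i
          using sum_a'[OF that] a'q by (subst (asm) sum_drop_index[of q]) auto
        \<comment> \<open>The induction hypothesis asks for a chain of length at least 2.\<close>
        have n: "n \<noteq> 0"
        proof
          assume "n = 0"
          then have "?z (r 0) = 0" using drop[of 0] by auto
          then show False using zz[of 0] Suc.prems(2) by auto
        qed
        have "alt_chain (\<lambda>i. \<Sum>k<n. B i (insert_index q k) * a' (insert_index q k)) ?N r"
          unfolding alt_chain_def
        proof (intro conjI allI impI)
          show "strict_mono_on {..<?N} r" using r False by (auto simp: strict_mono_on_def)
          show "(\<Sum>k<n. B (r i) (insert_index q k) * a' (insert_index q k)) *
            (\<Sum>k<n. B (r (Suc i)) (insert_index q k) * a' (insert_index q k)) < 0" if "Suc i < ?N" for i
            using zz[of i] drop[of i] drop[of "Suc i"] that False by simp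
        qed
        from Suc.IH[OF tn_cols_drop[OF Suc.prems(1), of q] _ this] n
        obtain s where "s ` {..<?N} \<subseteq> {..<n}" "alt_chain (\<lambda>k. a' (insert_index q k)) ?N s"
          by force
        then show False
          using strict_mono_on_card_le[of ?N s n] by (auto simp: alt_chain_def)
      qed
      then show ?thesis ..
    qed
  qed
qed

subsection \<open>Real-rootedness of totally nonnegative sequences\<close>

lemma alt_chain_between:
  fixes a :: "nat \<Rightarrow> real"
  assumes "a p * a q < 0" "p < q" "\<And>j. p \<le> j \<Longrightarrow> j \<le> q \<Longrightarrow> a j \<noteq> 0"
  shows "\<exists>j\<ge>p. j < q \<and> a j * a (Suc j) < 0"
proof (rule ccontr)
  assume neg: "\<not> ?thesis"
  have "a p * a j > 0" if "p \<le> j" "j \<le> q" for j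
    using that
  proof (induction j rule: dec_induct)
    case base
    then show ?case using assms(3)[of p] assms(2) by (simp add: zero_less_mult_iff, linarith)
  next
    case (step j)
    then have "a j * a (Suc j) > 0"
      using neg assms(3)[of j] assms(3)[of "Suc j"]
      by (metis Suc_le_eq dual_order.strict_implies_order le_SucI linorder_neqE_linordered_idom
          mult_eq_0_iff order_less_imp_le)
    with step show ?case by (auto simp: zero_less_mult_iff)
  qed
  from this[of q] assms show False by simp
qed

text \<open>Every link of the chain contains an adjacent sign change, at a different place for each
  link; the places in \<open>B\<close> are not among them.\<close>

lemma alt_chain_length:
  assumes s: "alt_chain a l s" "s ` {..<l} \<subseteq> {..L}"
    and nz: "\<And>j. j \<le> L \<Longrightarrow> a j \<noteq> 0"
    and B: "B \<subseteq> {..<L}" "\<And>j. j \<in> B \<Longrightarrow> a j * a (Suc j) > 0"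
  shows "l \<le> Suc (L - card B)"
proof -
  define CH where "CH = {j. j < L \<and> a j * a (Suc j) < 0}"
  have sm: "strict_mono_on {..<l} s" using s(1) by (simp add: alt_chain_def)
  have "\<exists>j\<ge>s i. j < s (Suc i) \<and> a j * a (Suc j) < 0" if "Suc i < l" for i
  proof (rule alt_chain_between)
    show "a (s i) * a (s (Suc i)) < 0" using s(1) that by (simp add: alt_chain_def)
    show "s i < s (Suc i)" using sm that by (auto simp: strict_mono_on_def)
    show "a j \<noteq> 0" if "j \<le> s (Suc i)" for j
      using s(2) nz that \<open>Suc i < l\<close> by (metis atMost_iff image_subset_iff lessThan_iff order_trans)
  qed
  then obtain f where f: "\<And>i. Suc i < l \<Longrightarrow> s i \<le> f i \<and> f i < s (Suc i) \<and> a (f i) * a (Suc (f i)) < 0"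
    by metis
  have "strict_mono_on {..<l - 1} f"
  proof (rule strict_mono_onI)
    fix x y assume xy: "x \<in> {..<l - 1}" "y \<in> {..<l - 1}" "x < y"
    then have "f x < s (Suc x)" "s y \<le> f y" using f by auto
    moreover have "s (Suc x) \<le> s y"
    proof (cases "Suc x = y")
      case False
      then have "Suc x < y" "y < l" using xy by auto
      then show ?thesis using strict_mono_onD[OF sm, of "Suc x" y] by simp
    qed simp
    ultimately show "f x < f y" by linarith
  qed
  then have inj: "inj_on f {..<l - 1}" by (rule strict_mono_on_imp_inj_on)
  have im: "f ` {..<l - 1} \<subseteq> CH"
  proof
    fix y assume "y \<in> f ` {..<l - 1}"
    then obtain i where i: "i < l - 1" "y = f i" by auto
    then have "Suc i \<in> {..<l}" by auto
    then have "s (Suc i) \<le> L" using s(2) by blast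
    moreover have "s i \<le> f i \<and> f i < s (Suc i) \<and> a (f i) * a (Suc (f i)) < 0"
      using f[of i] \<open>Suc i \<in> {..<l}\<close> by simp
    ultimately show "y \<in> CH" using i by (simp add: CH_def)
  qed
  have fin: "finite CH" "finite B"
    using B(1) by (auto simp: CH_def intro: finite_subset)
  have "l - 1 \<le> card CH"
    using card_inj_on_le[OF inj im fin(1)] by simp
  moreover have "card CH + card B \<le> L"
  proof -
    have "CH \<inter> B = {}" using B(2) by (force simp: CH_def)
    then have "card CH + card B = card (CH \<union> B)" using fin by (simp add: card_Un_disjoint)
    also have "\<dots> \<le> card {..<L}" using B(1) by (intro card_mono) (auto simp: CH_def)
    finally show ?thesis by simp
  qed
  ultimately show ?thesis by linarith
qed

text \<open>A nonvanishing solution of a second-order recurrence with nonreal characteristic roots keeps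
  its sign infinitely often: otherwise the ratios \<open>- \<kappa> (j + 1) / \<kappa> j\<close> would be positive while
  decreasing by a fixed amount at each step.\<close>

lemma recurrence_keeps_sign:
  fixes \<kappa> :: "nat \<Rightarrow> real"
  assumes rec: "\<And>j. \<kappa> (Suc (Suc j)) = 2 * p * \<kappa> (Suc j) - m\<^sup>2 * \<kappa> j"
    and nz: "\<And>j. \<kappa> j \<noteq> 0" and pm: "\<bar>p\<bar> < m"
  shows "\<exists>j\<ge>J. \<kappa> j * \<kappa> (Suc j) > 0"
proof (rule ccontr)
  assume neg: "\<not> ?thesis"
  define t where "t j = - \<kappa> (Suc j) / \<kappa> j" for j
  have t_pos: "t j > 0" if "j \<ge> J" for j
  proof -
    have "\<kappa> j * \<kappa> (Suc j) < 0"
      using neg that nz[of j] nz[of "Suc j"] by (metis linorder_neqE_linordered_idom mult_eq_0_iff)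
    then show ?thesis
      by (auto simp: t_def mult_less_0_iff field_simps divide_less_0_iff)
  qed
  define d where "d = 2 * p + 2 * m"
  have d: "d > 0" using pm by (simp add: d_def)
  have t_step: "t (Suc j) \<le> t j - d" if "j \<ge> J" for j
  proof -
    have pos: "t j > 0" using t_pos that by simp
    have "t (Suc j) = - 2 * p - m\<^sup>2 / t j"
      unfolding t_def using nz[of j] nz[of "Suc j"] by (simp add: rec field_simps)
    moreover have "0 \<le> (t j - m)\<^sup>2 / t j" using pos by simp
    then have "0 \<le> t j - 2 * m + m\<^sup>2 / t j"
      using pos by (simp add: field_simps power2_eq_square)
    ultimately show ?thesis by (simp add: d_def)
  qed
  have t_lin: "t (J + n) \<le> t J - real n * d" for n
  proof (induction n)
    case (Suc n)
    with t_step[of "J + n"] show ?case by (simp add: algebra_simps)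
  qed simp
  obtain n where "t J < real n * d"
    using reals_Archimedean3[OF d] by blast
  with t_lin[of n] t_pos[of "J + n"] show False by simp
qed

text \<open>From row \<open>N\<close> on the Toeplitz matrix sees all of \<open>c\<close> and acts
  as a plain convolution; the earlier rows are given up.\<close>

lemma sum_conv_shift:
  fixes c a :: "nat \<Rightarrow> 'a::comm_semiring_1"
  assumes "N \<le> i" "i \<le> L" "\<And>k. k > N \<Longrightarrow> c k = 0"
  shows "(\<Sum>j<Suc L. (if j \<le> i then c (i - j) else 0) * a j) = (\<Sum>k\<le>N. c k * a (i - k))"
proof -
  have "(\<Sum>j<Suc L. (if j \<le> i then c (i - j) else 0) * a j) = (\<Sum>j\<le>i. c (i - j) * a j)"
    using assms(2) by (intro sum.mono_neutral_cong_right) auto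
  also have "\<dots> = (\<Sum>k\<le>i. c k * a (i - k))"
    by (rule sum.reindex_bij_witness[of _ "\<lambda>k. i - k" "\<lambda>j. i - j"]) auto
  also have "\<dots> = (\<Sum>k\<le>N. c k * a (i - k))"
    using assms by (intro sum.mono_neutral_right) auto
  finally show ?thesis .
qed

lemma inverse_power_diff:
  fixes x :: "'a::field"
  assumes "x \<noteq> 0" "k \<le> i"
  shows "inverse x ^ (i - k) = inverse x ^ i * x ^ k"
proof -
  have "inverse x ^ i * x ^ k = inverse x ^ (i - k) * (inverse x ^ k * x ^ k)"
    using assms(2) by (simp only: mult.assoc[symmetric] power_add[symmetric] le_add_diff_inverse2)
  also have "inverse x ^ k * x ^ k = 1"
    using assms(1) by (simp flip: power_mult_distrib)
  finally show ?thesis by simp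
qed

text \<open>If \<open>z\<close> were a nonreal root, the input \<open>Re (\<zeta> z\<^sup>-\<^sup>j)\<close> would be annihilated by the Toeplitz
  matrix; adding a tiny multiple of an alternating geometric sequence, one obtains an output that
  alternates in every place although the input does not, against variation diminution.\<close>

theorem tn_sequence_roots_real:
  fixes c :: "nat \<Rightarrow> real" and z :: complex
  assumes pos: "\<And>k. k \<le> N \<Longrightarrow> c k > 0" and zero: "\<And>k. k > N \<Longrightarrow> c k = 0"
    and tn: "\<And>n. tn_cols n (\<lambda>i j. if j \<le> i then c (i - j) else 0)"
    and root: "(\<Sum>k\<le>N. of_real (c k) * z ^ k) = 0"
  shows "z \<in> \<real>"
proof (rule ccontr)
  assume "z \<notin> \<real>"
  then have z: "z \<noteq> 0" "Im z \<noteq> 0" by (auto simp: complex_is_Real_iff)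
  define w where "w = inverse z"
  have w: "w \<noteq> 0" "Im w \<noteq> 0" using z by (auto simp: w_def)
  \<comment> \<open>Each \<open>j\<close> forbids at most one value of \<tau>; an allowed one lets
    no \<open>Re (\<zeta> * w ^ j)\<close> vanish.\<close>
  have "countable (range (\<lambda>j. Re (w ^ j) / Im (w ^ j)))" by simp
  then obtain \<tau> where \<tau>: "\<tau> \<notin> range (\<lambda>j. Re (w ^ j) / Im (w ^ j))"
    using uncountable_UNIV_real by (metis UNIV_eq_I)
  define \<zeta> where "\<zeta> = Complex 1 \<tau>"
  define \<kappa> where "\<kappa> j = Re (\<zeta> * w ^ j)" for j
  have \<kappa>_nz: "\<kappa> j \<noteq> 0" for j
  proof
    assume "\<kappa> j = 0"
    then have eq: "Re (w ^ j) = \<tau> * Im (w ^ j)" by (simp add: \<kappa>_def \<zeta>_def)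
    have "w ^ j \<noteq> 0" using w by simp
    then have "Im (w ^ j) \<noteq> 0" using eq by (auto simp: complex_eq_iff)
    then have "\<tau> = Re (w ^ j) / Im (w ^ j)" using eq by simp
    with \<tau> show False by blast
  qed
  have rec: "\<kappa> (Suc (Suc j)) = 2 * Re w * \<kappa> (Suc j) - (cmod w)\<^sup>2 * \<kappa> j" for j
  proof -
    have ww: "w * w = of_real (2 * Re w) * w - of_real ((cmod w)\<^sup>2)"
      by (simp add: complex_eq_iff cmod_power2) (simp add: power2_eq_square)
    have Re_lin: "Re (of_real s * X - of_real t * Y) = s * Re X - t * Re Y" for s t X Y
      by simp
    have "\<zeta> * w ^ Suc (Suc j) = \<zeta> * w ^ j * (w * w)"
      by (simp only: power_Suc mult_ac)
    also have "\<dots> = of_real (2 * Re w) * (\<zeta> * w ^ Suc j) - of_real ((cmod w)\<^sup>2) * (\<zeta> * w ^ j)"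
      unfolding ww by (simp add: algebra_simps)
    finally show ?thesis
      by (simp only: \<kappa>_def Re_lin)
  qed
  have less: "\<bar>Re w\<bar> < cmod w"
  proof (rule power2_less_imp_less)
    have "0 < (Im w)\<^sup>2" using w(2) by simp
    then show "\<bar>Re w\<bar>\<^sup>2 < (cmod w)\<^sup>2" unfolding cmod_power2 power2_abs by linarith
  qed simp
  have keep: "\<exists>j\<ge>J. \<kappa> j * \<kappa> (Suc j) > 0" for J
    by (rule recurrence_keeps_sign[of \<kappa> "Re w" "cmod w"]) (fact rec \<kappa>_nz less)+
  have "infinite {j. \<kappa> j * \<kappa> (Suc j) > 0}"
    using keep by (simp add: infinite_nat_iff_unbounded_le)
  \<comment> \<open>Restricting the output to rows from \<open>N\<close> on costs \<open>N\<close>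
    sign changes, so \<open>N + 1\<close> places where the input keeps its sign give a
    contradiction.\<close>
  then obtain B where B: "finite B" "card B = Suc N" "B \<subseteq> {j. \<kappa> j * \<kappa> (Suc j) > 0}"
    using infinite_arbitrarily_large by blast
  define L where "L = Suc (Max B)"
  have BL: "B \<subseteq> {..<L}"
    using B(1) by (auto simp: L_def less_Suc_eq_le)
  have NL: "N < L" using card_mono[OF _ BL] B(2) by simp
  define P where "P = (\<Sum>k\<le>N. Polynomial.monom (c k) k)"
  have Pv: "poly P x = (\<Sum>k\<le>N. c k * x ^ k)" for x
    by (simp add: P_def poly_sum poly_monom)
  have "P \<noteq> 0"
  proof
    assume "P = 0"
    then have "poly P 1 = 0" by simp
    moreover have "poly P 1 > 0" unfolding Pv using pos by (auto intro!: sum_pos)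
    ultimately show False by simp
  qed
  then have "finite {x. poly P x = 0}" by (rule poly_roots_finite)
  moreover have "infinite {..<0::real}" by (simp add: infinite_Iio)
  \<comment> \<open>A negative base makes \<open>inverse x ^ j\<close> alternate; avoiding the roots
    of \<open>P\<close> keeps its image under the convolution nonzero.\<close>
  ultimately obtain x where x: "x < 0" "poly P x \<noteq> 0"
    by (metis (mono_tags, lifting) finite_subset lessThan_iff mem_Collect_eq subsetI)
  \<comment> \<open>Small enough that adding \<open>\<epsilon> * inverse x ^ j\<close> changes no
    sign of \<open>\<kappa> j\<close> for \<open>j \<le> L\<close>.\<close>
  define \<epsilon> where "\<epsilon> = Min ((\<lambda>j. \<bar>\<kappa> j\<bar> * \<bar>x\<bar> ^ j) ` {..L}) / 2"
  have \<epsilon>: "\<epsilon> > 0" "\<And>j. j \<le> L \<Longrightarrow> \<epsilon> < \<bar>\<kappa> j\<bar> * \<bar>x\<bar> ^ j"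
  proof -
    let ?S = "(\<lambda>j. \<bar>\<kappa> j\<bar> * \<bar>x\<bar> ^ j) ` {..L}"
    have "Min ?S > 0" using x \<kappa>_nz by (subst Min_gr_iff) auto
    then show "\<epsilon> > 0" by (simp add: \<epsilon>_def)
    show "\<epsilon> < \<bar>\<kappa> j\<bar> * \<bar>x\<bar> ^ j" if "j \<le> L" for j
    proof -
      have "Min ?S \<le> \<bar>\<kappa> j\<bar> * \<bar>x\<bar> ^ j" using that by (intro Min_le) auto
      with \<open>Min ?S > 0\<close> show ?thesis unfolding \<epsilon>_def by linarith
    qed
  qed
  define a where "a j = \<kappa> j + \<epsilon> * inverse x ^ j" for j
  have sgn_a: "sgn (a j) = sgn (\<kappa> j)" if "j \<le> L" for j
  proof -
    have "\<bar>\<epsilon> * inverse x ^ j\<bar> < \<bar>\<kappa> j\<bar>"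
      using \<epsilon>(1) \<epsilon>(2)[OF that] x by (simp add: abs_mult power_inverse power_abs field_simps)
    then show ?thesis by (auto simp: a_def sgn_if)
  qed
  let ?M = "\<lambda>i j. if j \<le> i then c (i - j) else 0"
  have out: "(\<Sum>j<Suc L. ?M i j * a j) = \<epsilon> * poly P x * inverse x ^ i" if i: "N \<le> i" "i \<le> L" for i
  proof -
    have "(\<Sum>j<Suc L. ?M i j * a j) = (\<Sum>k\<le>N. c k * a (i - k))"
      by (rule sum_conv_shift[OF i zero])
    also have "\<dots> = (\<Sum>k\<le>N. c k * \<kappa> (i - k)) + \<epsilon> * (\<Sum>k\<le>N. c k * inverse x ^ (i - k))"
      by (simp add: a_def algebra_simps sum.distrib sum_distrib_left)
    also have "(\<Sum>k\<le>N. c k * inverse x ^ (i - k)) = poly P x * inverse x ^ i"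
      unfolding Pv sum_distrib_right using i x
      by (intro sum.cong refl) (simp add: inverse_power_diff mult_ac)
    also have "(\<Sum>k\<le>N. c k * \<kappa> (i - k)) = Re (\<Sum>k\<le>N. of_real (c k) * (\<zeta> * w ^ (i - k)))"
      by (simp add: \<kappa>_def Re_sum)
    also have "(\<Sum>k\<le>N. of_real (c k) * (\<zeta> * w ^ (i - k))) = \<zeta> * w ^ i * (\<Sum>k\<le>N. of_real (c k) * z ^ k)"
      unfolding sum_distrib_left using i z
      by (intro sum.cong refl) (simp add: w_def inverse_power_diff mult_ac)
    also have "\<dots> = 0" using root by simp
    finally show ?thesis by simp
  qed
  define l where "l = Suc (L - N)"
  have "alt_chain (\<lambda>i. \<Sum>j<Suc L. ?M i j * a j) l (\<lambda>m. N + m)"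
    unfolding alt_chain_def
  proof (intro conjI allI impI)
    show "strict_mono_on {..<l} ((+) N)" by (simp add: strict_mono_on_def)
    fix m assume "Suc m < l"
    then have m: "N + m \<le> L" "N + Suc m \<le> L" by (auto simp: l_def)
    have "(\<Sum>j<Suc L. ?M (N + m) j * a j) * (\<Sum>j<Suc L. ?M (N + Suc m) j * a j) =
        (\<epsilon> * poly P x * inverse x ^ (N + m))\<^sup>2 * inverse x"
      using out[of "N + m"] out[of "N + Suc m"] m
      by (simp add: power2_eq_square del: sum.lessThan_Suc)
    also have "\<dots> < 0"
      using \<epsilon>(1) x by (intro mult_pos_neg) auto
    finally show "(\<Sum>j<Suc L. ?M (N + m) j * a j) * (\<Sum>j<Suc L. ?M (N + Suc m) j * a j) < 0" .
  qed
  moreover have "2 \<le> l" using NL by (simp add: l_def)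
  ultimately obtain s where s: "s ` {..<l} \<subseteq> {..<Suc L}" "alt_chain a l s"
    using variation_diminishing[where n = "Suc L" and a = a and l = l and r = "\<lambda>m. N + m", OF tn]
    by blast
  have "l \<le> Suc (L - card B)"
  proof (rule alt_chain_length[OF s(2) _ _ BL])
    show "s ` {..<l} \<subseteq> {..L}" using s(1) by auto
    show "a j \<noteq> 0" if "j \<le> L" for j
      using sgn_a[OF that] \<kappa>_nz[of j] by (metis sgn_0_0)
    show "a j * a (Suc j) > 0" if "j \<in> B" for j
    proof -
      have "j < L" using BL that by auto
      then have "sgn (a j * a (Suc j)) = sgn (\<kappa> j * \<kappa> (Suc j))" by (simp add: sgn_mult sgn_a)
      moreover have "\<kappa> j * \<kappa> (Suc j) > 0" using B(3) that by auto
      ultimately show ?thesis by (metis sgn_greater)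
    qed
  qed
  then show False using NL B(2) by (simp add: l_def)
qed

section \<open>Variance bound for polynomials with negative roots\<close>

definition rpoly :: "real poly \<Rightarrow> complex poly" where "rpoly = map_poly of_real"

lemma rpoly_linear_mult: "rpoly ([:- x, 1:] * q) = [:- of_real x, 1:] * rpoly q"
  by (rule poly_eqI) (auto simp: rpoly_def coeff_map_poly coeff_pCons split: nat.split)

lemma poly_rpoly_of_real: "poly (rpoly p) (of_real x) = of_real (poly p x)"
  unfolding rpoly_def by (induction p) (auto simp: map_poly_pCons)

text \<open>For a polynomial with negative roots only, the quantity bounded here, divided by the square of
  the value at 1, is the variance of a sum of \<open>degree p\<close> independent Bernoulli variables.\<close>

lemma negative_roots_variance:
  fixes p :: "real poly"
  assumes "p \<noteq> 0" "\<And>z. poly (rpoly p) z = 0 \<Longrightarrow> z \<in> \<real> \<and> Re z < 0"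
  shows "poly p 1 * (poly (pderiv (pderiv p)) 1 + poly (pderiv p) 1) - (poly (pderiv p) 1)\<^sup>2
    \<le> real (degree p) / 4 * (poly p 1)\<^sup>2"
  using assms
proof (induction "degree p" arbitrary: p)
  case 0
  then obtain a where "p = [:a:]" by (metis degree_eq_zeroE)
  then show ?case by simp
next
  case (Suc n)
  have "degree (rpoly p) = Suc n"
    unfolding rpoly_def using Suc(2) by (subst degree_map_poly) auto
  then have "\<not> constant (poly (rpoly p))" by (simp add: constant_degree)
  then obtain z where z: "poly (rpoly p) z = 0"
    using fundamental_theorem_of_algebra by blast
  then have "z \<in> \<real>" "Re z < 0" using Suc.prems(2) by auto
  then obtain x where x: "z = of_real x" "x < 0" by (auto elim!: Reals_cases)
  then have "poly p x = 0" using z poly_rpoly_of_real[of p x] by simp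
  then obtain q where q: "p = [:- x, 1:] * q" by (metis dvdE poly_eq_0_iff_dvd)
  have q0: "q \<noteq> 0" using Suc.prems q by auto
  have deg: "degree p = Suc (degree q)"
    unfolding q using q0 by (subst degree_mult_eq) auto
  have IH: "poly q 1 * (poly (pderiv (pderiv q)) 1 + poly (pderiv q) 1) - (poly (pderiv q) 1)\<^sup>2
      \<le> real (degree q) / 4 * (poly q 1)\<^sup>2"
  proof (rule Suc.hyps(1))
    show "n = degree q" using Suc.hyps(2) deg by simp
    show "z \<in> \<real> \<and> Re z < 0" if "poly (rpoly q) z = 0" for z
      using that Suc.prems(2)[of z] unfolding q rpoly_linear_mult by simp
  qed (rule q0)
  define A B C where "A = poly q 1" and "B = poly (pderiv q) 1" and "C = poly (pderiv (pderiv q)) 1"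
  have p1: "poly p 1 = (1 - x) * A"
    unfolding q A_def by (simp add: algebra_simps)
  have d1: "pderiv p = q + [:- x, 1:] * pderiv q"
    unfolding q by (simp only: pderiv_mult) (simp add: pderiv_pCons)
  have d2: "pderiv (pderiv p) = pderiv q + (pderiv q + [:- x, 1:] * pderiv (pderiv q))"
    unfolding d1 by (simp only: pderiv_mult pderiv_add) (simp add: pderiv_pCons)
  have p2: "poly (pderiv p) 1 = A + (1 - x) * B"
    unfolding d1 A_def B_def by (simp add: algebra_simps)
  have p3: "poly (pderiv (pderiv p)) 1 = 2 * B + (1 - x) * C"
    unfolding d2 B_def C_def by (simp add: algebra_simps)
  \<comment> \<open>Variances add: after division by the squared value at 1, the factor with root
    \<open>x\<close> contributes \<open>- x / (1 - x)^2\<close>, the variance of a Bernoulli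
    variable with success probability \<open>1 / (1 - x)\<close>, which is at most
    \<open>1 / 4\<close>.\<close>
  have "poly p 1 * (poly (pderiv (pderiv p)) 1 + poly (pderiv p) 1) - (poly (pderiv p) 1)\<^sup>2 =
      (1 - x)\<^sup>2 * (A * (C + B) - B\<^sup>2) + (- x) * A\<^sup>2"
    unfolding p1 p2 p3 by (simp add: power2_eq_square algebra_simps)
  also have "\<dots> \<le> (1 - x)\<^sup>2 * (real (degree q) / 4 * A\<^sup>2) + (1 - x)\<^sup>2 / 4 * A\<^sup>2"
  proof (intro add_mono mult_left_mono mult_right_mono)
    show "A * (C + B) - B\<^sup>2 \<le> real (degree q) / 4 * A\<^sup>2" using IH by (simp add: A_def B_def C_def)
    have "0 \<le> (1 + x)\<^sup>2" by simp
    then show "- x \<le> (1 - x)\<^sup>2 / 4" by (simp add: power2_eq_square algebra_simps)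
  qed auto
  also have "\<dots> = real (degree p) / 4 * (poly p 1)\<^sup>2"
    unfolding p1 deg power_mult_distrib by (simp add: algebra_simps)
  finally show ?case .
qed

subsection \<open>Totally nonnegative functions with bounded support\<close>

definition tn_fun :: "(real \<Rightarrow> real) \<Rightarrow> bool" where
  "tn_fun f \<longleftrightarrow> (\<forall>n x y. strict_mono_on {..<n} x \<longrightarrow> strict_mono_on {..<n} y \<longrightarrow>
     0 \<le> mdet n (\<lambda>i j. f (x i - y j)))"

definition tp_fun :: "(real \<Rightarrow> real) \<Rightarrow> bool" where
  "tp_fun f \<longleftrightarrow> (\<forall>n x y. strict_mono_on {..<n} x \<longrightarrow> strict_mono_on {..<n} y \<longrightarrow>
     0 < mdet n (\<lambda>i j. f (x i - y j)))"

lemma totally_nonneg_iff_tn_fun: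
  assumes "\<And>x y. K (x, y) = f (x - y)"
  shows "totally_nonneg K \<longleftrightarrow> tn_fun f"
  unfolding totally_nonneg_def tn_fun_def mdet_def assms ..

lemma totally_pos_iff_tp_fun:
  assumes "\<And>x y. K (x, y) = f (x - y)"
  shows "totally_pos K \<longleftrightarrow> tp_fun f"
  unfolding totally_pos_def tp_fun_def mdet_def assms ..

lemma tn_funD:
  "tn_fun f \<Longrightarrow> strict_mono_on {..<n} x \<Longrightarrow> strict_mono_on {..<n} y \<Longrightarrow>
    0 \<le> mdet n (\<lambda>i j. f (x i - y j))"
  unfolding tn_fun_def by blast

lemma tp_funD:
  "tp_fun f \<Longrightarrow> strict_mono_on {..<n} x \<Longrightarrow> strict_mono_on {..<n} y \<Longrightarrow>
    0 < mdet n (\<lambda>i j. f (x i - y j))"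
  unfolding tp_fun_def by blast

lemma tp_fun_imp_tn_fun: "tp_fun f \<Longrightarrow> tn_fun f"
  unfolding tp_fun_def tn_fun_def by (blast intro: less_imp_le)

lemma strict_mono_on_2:
  fixes x :: "nat \<Rightarrow> real"
  assumes "x 0 < x 1"
  shows "strict_mono_on {..<2} x"
proof (rule strict_mono_onI)
  fix r s :: nat assume "r \<in> {..<2}" "s \<in> {..<2}" "r < s"
  then have "r = 0" "s = 1" by auto
  with assms show "x r < x s" by simp
qed

lemma strict_mono_on_Suc_0: "strict_mono_on {..<Suc 0} x"
  by (auto simp: strict_mono_on_def)

lemma tn_fun_nonneg: "tn_fun f \<Longrightarrow> 0 \<le> f t"
  using tn_funD[OF _ strict_mono_on_Suc_0 strict_mono_on_Suc_0, of f "\<lambda>_. t" "\<lambda>_. 0"] by simp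

lemma tp_fun_pos: "tp_fun f \<Longrightarrow> 0 < f t"
  using tp_funD[OF _ strict_mono_on_Suc_0 strict_mono_on_Suc_0, of f "\<lambda>_. t" "\<lambda>_. 0"] by simp

definition minors_nonneg :: "nat \<Rightarrow> (real \<Rightarrow> real) \<Rightarrow> bool" where
  "minors_nonneg n f \<longleftrightarrow> (\<forall>x y. strict_mono_on {..<n} x \<longrightarrow> strict_mono_on {..<n} y \<longrightarrow>
     0 \<le> mdet n (\<lambda>i j. f (x i - y j)))"

lemma tn_fun_imp_minors_nonneg: "tn_fun f \<Longrightarrow> minors_nonneg n f"
  unfolding tn_fun_def minors_nonneg_def by blast

text \<open>Rows \<open>c\<close>, \<open>b\<close> and columns \<open>0\<close>,
  \<open>c - a\<close> give the differences \<open>c\<close>, \<open>a\<close> and \<open>b\<close>,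
  \<open>a + b - c\<close>: moving two arguments towards each other with fixed sum cannot decrease
  the product.\<close>

lemma minors_nonneg_2:
  assumes f: "minors_nonneg 2 f" and le: "a \<le> c" "c \<le> b"
  shows "f a * f b \<le> f c * f (a + b - c)"
proof (cases "a = c \<or> c = b")
  case False
  have "strict_mono_on {..<2} (\<lambda>i::nat. if i = 0 then c else b)"
    "strict_mono_on {..<2} (\<lambda>j::nat. if j = 0 then 0 else c - a)"
    using le False by (auto intro!: strict_mono_on_2)
  with f have "0 \<le> mdet 2 (\<lambda>i j. f ((if i = 0 then c else b) - (if j = 0 then 0 else c - a)))"
    unfolding minors_nonneg_def by blast
  then show ?thesis by (simp add: mdet_2 algebra_simps)
qed auto

lemma tn_fun_minor_2:
  "tn_fun f \<Longrightarrow> a \<le> c \<Longrightarrow> c \<le> b \<Longrightarrow> f a * f b \<le> f c * f (a + b - c)"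
  by (intro minors_nonneg_2 tn_fun_imp_minors_nonneg)

lemma tn_fun_support_convex:
  assumes "tn_fun f" "f a > 0" "f b > 0" "a \<le> c" "c \<le> b"
  shows "f c > 0"
proof -
  have "0 < f a * f b" using assms by simp
  also have "\<dots> \<le> f c * f (a + b - c)" by (rule tn_fun_minor_2) (use assms in auto)
  finally show ?thesis
    using tn_fun_nonneg[OF assms(1), of c] by (auto simp: zero_less_mult_iff)
qed

section \<open>Spread of log-concave coefficient sequences\<close>

lemma telescope_le:
  fixes L :: "nat \<Rightarrow> real"
  assumes "i \<le> k" "\<And>j. i \<le> j \<Longrightarrow> j < k \<Longrightarrow> L (Suc j) - L j \<le> u"
  shows "L k - L i \<le> real (k - i) * u"
  using assms
proof (induction k rule: dec_induct)
  case (step n)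
  from step(3)[OF step(4)] step(4)[of n] step(1)
  show ?case by (simp add: Suc_diff_le algebra_simps)
qed simp

lemma telescope_ge:
  fixes L :: "nat \<Rightarrow> real"
  assumes "i \<le> k" "\<And>j. i \<le> j \<Longrightarrow> j < k \<Longrightarrow> u \<le> L (Suc j) - L j"
  shows "real (k - i) * u \<le> L k - L i"
  using telescope_le[of i k "\<lambda>k. - L k" "- u"] assms by (simp add: algebra_simps)

text \<open>Increments decrease, and equality at \<open>A\<close> and \<open>A + m\<close> makes
  them nonnegative before \<open>A\<close> and nonpositive after \<open>A + m\<close>. The rise in
  between is no steeper than over the \<open>m\<close> steps before \<open>A\<close>, which bounds
  the peak.\<close>

lemma concave_seq_bounds:
  fixes L :: "nat \<Rightarrow> real"
  assumes conc: "\<And>k. Suc (Suc k) \<le> N \<Longrightarrow> L k + L (Suc (Suc k)) \<le> 2 * L (Suc k)"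
    and m: "0 < m" "m \<le> A" "A + m \<le> N" and eq: "L (A + m) = L A"
  shows "k \<le> N \<Longrightarrow> L k \<le> 2 * L A - L (A - m)"
    and "A \<le> k \<Longrightarrow> k \<le> A + m \<Longrightarrow> L A \<le> L k"
proof -
  define d where "d k = L (Suc k) - L k" for k
  have d_mono: "d j \<le> d i" if "i \<le> j" "j < N" for i j
    using that
  proof (induction j rule: dec_induct)
    case (step n)
    then show ?case using conc[of n] by (simp add: d_def)
  qed simp
  have "0 \<le> real m * d A"
    using telescope_le[of A "A + m" L "d A"] d_mono[of A] m eq by (force simp: d_def)
  then have dA: "0 \<le> d A" using m by (simp add: zero_le_mult_iff)
  have "real m * d (A + m - 1) \<le> 0"
    using telescope_ge[of A "A + m" "d (A + m - 1)" L] d_mono[of _ "A + m - 1"] m eq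
    by (force simp: d_def)
  then have dB: "d (A + m - 1) \<le> 0" using m by (simp add: mult_le_0_iff)
  have left: "real m * d A \<le> L A - L (A - m)"
    using telescope_ge[of "A - m" A "d A" L] d_mono[of _ A] m by (force simp: d_def)
  show "L k \<le> 2 * L A - L (A - m)" if "k \<le> N"
  proof -
    have nn: "0 \<le> L A - L (A - m)" using left dA m by (meson mult_nonneg_nonneg of_nat_0_le_iff order_trans)
    consider "k \<le> A" | "A \<le> k" "k \<le> A + m" | "A + m \<le> k" by linarith
    then show ?thesis
    proof cases
      case 1
      have "0 \<le> L (Suc j) - L j" if "k \<le> j" "j < A" for j
        using d_mono[of j A] dA that m by (simp add: d_def)
      then have "0 \<le> L A - L k" using telescope_ge[of k A 0 L] 1 by simp
      with nn show ?thesis by simp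
    next
      case 2
      have "L k - L A \<le> real (k - A) * d A"
        using telescope_le[of A k L "d A"] d_mono[of A] 2 m by (force simp: d_def)
      also have "\<dots> \<le> real m * d A"
        using 2 dA by (intro mult_right_mono) auto
      finally show ?thesis using left by simp
    next
      case 3
      have "L (Suc j) - L j \<le> 0" if "A + m \<le> j" "j < k" for j
      proof -
        have "d j \<le> d (A + m - 1)" by (rule d_mono) (use that \<open>k \<le> N\<close> in auto)
        with dB show ?thesis unfolding d_def by linarith
      qed
      then have "L k - L (A + m) \<le> 0" using telescope_le[of "A + m" k L 0] 3 by simp
      with nn eq show ?thesis by simp
    qed
  qed
  show "L A \<le> L k" if "A \<le> k" "k \<le> A + m"
  proof (cases "k = A + m")
    case True
    with eq show ?thesis by simp
  next
    case False
    with that m have kN: "k < N" "k < A + m" by auto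
    show ?thesis
    proof (cases "0 \<le> d k")
      case True
      then have "0 \<le> L (Suc j) - L j" if "A \<le> j" "j < k" for j
        using d_mono[of j k] that kN by (simp add: d_def)
      then show ?thesis using telescope_ge[of A k 0 L] that by simp
    next
      case False
      then have "L (Suc j) - L j \<le> 0" if "k \<le> j" "j < A + m" for j
        using d_mono[of k j] that m by (simp add: d_def)
      then have "L (A + m) - L k \<le> 0" using telescope_le[of k "A + m" L 0] kN by simp
      with eq show ?thesis by simp
    qed
  qed
qed

text \<open>Twice the variance, up to normalisation, as the mean squared distance of two independent
  samples; this form is bounded below by keeping only some pairs.\<close>

lemma sum_square_diff:
  fixes c :: "nat \<Rightarrow> real"
  shows "(\<Sum>j\<le>N. \<Sum>k\<le>N. (real k - real j)\<^sup>2 * (c j * c k)) =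
    2 * ((\<Sum>k\<le>N. c k) * (\<Sum>k\<le>N. (real k)\<^sup>2 * c k) - (\<Sum>k\<le>N. real k * c k)\<^sup>2)"
proof -
  have "(\<Sum>j\<le>N. \<Sum>k\<le>N. (real k - real j)\<^sup>2 * (c j * c k)) =
      (\<Sum>j\<le>N. \<Sum>k\<le>N. c j * ((real k)\<^sup>2 * c k)) + (\<Sum>j\<le>N. \<Sum>k\<le>N. ((real j)\<^sup>2 * c j) * c k)
      - 2 * (\<Sum>j\<le>N. \<Sum>k\<le>N. (real j * c j) * (real k * c k))"
    by (simp add: power2_diff algebra_simps sum.distrib sum_subtractf sum_distrib_left)
  then show ?thesis
    unfolding sum_product[symmetric] by (simp add: power2_eq_square algebra_simps)
qed

lemma pderiv_sum: "pderiv (\<Sum>x\<in>S. g x) = (\<Sum>x\<in>S. pderiv (g x))"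
  by (induction S rule: infinite_finite_induct) (auto simp: pderiv_add)

text \<open>Scaling the variable of the generating polynomial so as to equalise the coefficients at
  \<open>A\<close> and \<open>A + m\<close> leaves the roots real. By log-concavity the coefficients
  between are at least \<open>b A\<close>, and none exceeds \<open>R * b A\<close>. Pairs from that
  range bound the variance below, the real roots bound it above.\<close>

lemma tn_sequence_spread:
  fixes c :: "nat \<Rightarrow> real"
  assumes pos: "\<And>k. k \<le> N \<Longrightarrow> c k > 0" and zero: "\<And>k. k > N \<Longrightarrow> c k = 0"
    and tn: "\<And>n. tn_cols n (\<lambda>i j. if j \<le> i then c (i - j) else 0)"
    and lc: "\<And>k. c k * c (Suc (Suc k)) \<le> (c (Suc k))\<^sup>2"
    and m: "m = 4 * q" "0 < q" "m \<le> A" "A + m \<le> N"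
    and R: "R = (c A)\<^sup>2 / (c (A - m) * c (A + m))"
  shows "8 * real q ^ 4 \<le> real N * (real N + 1)\<^sup>2 * R\<^sup>2"
proof -
  \<comment> \<open>The slope that makes \<open>L A = L (A + m)\<close>.\<close>
  define \<mu> where "\<mu> = (ln (c A) - ln (c (A + m))) / real m"
  define L where "L k = ln (c k) + real k * \<mu>" for k
  define x where "x = exp \<mu>"
  define b where "b k = c k * x ^ k" for k
  have x: "x > 0" by (simp add: x_def)
  have b_exp: "b k = exp (L k)" if "k \<le> N" for k
    using pos[OF that] by (simp add: b_def L_def x_def exp_add exp_of_nat_mult)
  have conc: "L k + L (Suc (Suc k)) \<le> 2 * L (Suc k)" if "Suc (Suc k) \<le> N" for k
  proof -
    have p: "c k > 0" "c (Suc k) > 0" "c (Suc (Suc k)) > 0" using pos that by auto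
    have "ln (c k * c (Suc (Suc k))) \<le> ln ((c (Suc k))\<^sup>2)"
      using lc[of k] p by (subst ln_le_cancel_iff) auto
    then have "ln (c k) + ln (c (Suc (Suc k))) \<le> 2 * ln (c (Suc k))"
      using p by (simp add: ln_mult ln_realpow)
    then show ?thesis by (simp add: L_def algebra_simps)
  qed
  have eqL: "L (A + m) = L A"
    using m(1,2) by (simp add: L_def \<mu>_def field_simps)
  note bounds = concave_seq_bounds[of N L m A, OF conc _ m(3,4) eqL]
  have R_exp: "R = exp (L A - L (A - m))"
  proof -
    have p: "c A > 0" "c (A - m) > 0" "c (A + m) > 0" using pos m by auto
    have "L A - L (A - m) = ln (c A) - ln (c (A - m)) + real m * \<mu>"
      using m(3) by (simp add: L_def algebra_simps)
    also have "real m * \<mu> = ln (c A) - ln (c (A + m))" using m(1,2) by (simp add: \<mu>_def)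
    finally have "exp (L A - L (A - m)) =
        exp (ln (c A) - ln (c (A - m)) + (ln (c A) - ln (c (A + m))))" by (rule arg_cong)
    also have "\<dots> = c A / c (A - m) * (c A / c (A + m))"
      using p by (simp only: exp_add exp_diff exp_ln)
    finally show ?thesis by (simp add: R power2_eq_square)
  qed
  have bA: "b A > 0" using pos m x by (simp add: b_def)
  have upper: "b k \<le> R * b A" if "k \<le> N" for k
    using bounds(1)[OF _ _ that] m b_exp that
    by (simp add: R_exp exp_add[symmetric] del: exp_add)
  have lower: "b A \<le> b k" if "A \<le> k" "k \<le> A + m" for k
    using bounds(2)[OF _ _ that] m b_exp that by simp
  have b_nn: "b k \<ge> 0" for k
    using pos[of k] zero[of k] x by (cases "k \<le> N") (auto simp: b_def)
  define P where "P = (\<Sum>k\<le>N. Polynomial.monom (b k) k)"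
  have Pv: "poly P y = (\<Sum>k\<le>N. b k * y ^ k)" for y
    by (simp add: P_def poly_sum poly_monom)
  have coeffP: "coeff P k = (if k \<le> N then b k else 0)" for k
    by (simp add: P_def coeff_sum)
  have rPv: "poly (rpoly P) z = (\<Sum>k\<le>N. of_real (b k) * z ^ k)" for z
  proof -
    have "rpoly P = (\<Sum>k\<le>N. Polynomial.monom (of_real (b k)) k)"
      by (rule poly_eqI) (auto simp: rpoly_def coeff_map_poly coeffP coeff_sum)
    then show ?thesis by (simp add: poly_sum poly_monom)
  qed
  have Ppos: "poly P y > 0" if "y \<ge> 0" for y
  proof -
    have "0 < b 0 * y ^ 0" using pos[of 0] by (simp add: b_def)
    also have "\<dots> \<le> (\<Sum>k\<le>N. b k * y ^ k)"
      using b_nn that by (intro member_le_sum) auto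
    finally show ?thesis by (simp add: Pv)
  qed
  have degP: "degree P \<le> N" by (rule degree_le) (simp add: coeffP)
  have "P \<noteq> 0" using Ppos[of 0] by auto
  moreover have "z \<in> \<real> \<and> Re z < 0" if "poly (rpoly P) z = 0" for z
  proof -
    have "(\<Sum>k\<le>N. of_real (c k) * (of_real x * z) ^ k) = 0"
      using that unfolding rPv b_def by (simp add: power_mult_distrib mult.assoc)
    then have "of_real x * z \<in> \<real>"
      using tn_sequence_roots_real[OF pos zero tn] by blast
    then have "z \<in> \<real>" using x by (simp add: complex_is_Real_iff)
    moreover from this have "Re z < 0"
      using that poly_rpoly_of_real[of P "Re z"] Ppos[of "Re z"] by (force simp: not_less of_real_Re)
    ultimately show ?thesis by simp
  qed
  ultimately have var: "poly P 1 * (poly (pderiv (pderiv P)) 1 + poly (pderiv P) 1) - (poly (pderiv P) 1)\<^sup>2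
    \<le> real (degree P) / 4 * (poly P 1)\<^sup>2"
    by (rule negative_roots_variance)
  have P1: "poly P 1 = (\<Sum>k\<le>N. b k)" by (simp add: Pv)
  have P2: "poly (pderiv P) 1 = (\<Sum>k\<le>N. real k * b k)"
    by (simp add: P_def pderiv_sum pderiv_monom poly_sum poly_monom)
  have P3: "poly (pderiv (pderiv P)) 1 + poly (pderiv P) 1 = (\<Sum>k\<le>N. (real k)\<^sup>2 * b k)"
  proof -
    have "poly (pderiv (pderiv P)) 1 = (\<Sum>k\<le>N. real (k - 1) * (real k * b k))"
      by (simp add: P_def pderiv_sum pderiv_monom poly_sum poly_monom)
    moreover have "real (k - 1) * (real k * b k) + real k * b k = (real k)\<^sup>2 * b k" for k
      by (cases k) (auto simp: power2_eq_square algebra_simps)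
    ultimately show ?thesis by (simp add: P2 sum.distrib[symmetric])
  qed
  let ?T = "\<lambda>j k. (real k - real j)\<^sup>2 * (b j * b k)"
  have T_nn: "0 \<le> ?T j k" for j k using b_nn by simp
  \<comment> \<open>Indices from the first and the last quarter of the plateau, at least
    \<open>2 * q\<close> apart.\<close>
  let ?U = "{A..<A + q}" and ?V = "{A + 3 * q..<A + 4 * q}"
  have "4 * real q ^ 4 * (b A)\<^sup>2 = (\<Sum>j\<in>?U. \<Sum>k\<in>?V. (2 * real q)\<^sup>2 * (b A * b A))"
    by (simp add: power2_eq_square eval_nat_numeral)
  also have "\<dots> \<le> (\<Sum>j\<in>?U. \<Sum>k\<in>?V. ?T j k)"
  proof (intro sum_mono mult_mono power_mono)
    fix j k assume "j \<in> ?U" "k \<in> ?V"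
    then show "2 * real q \<le> real k - real j" "b A \<le> b j" "b A \<le> b k"
      using lower[of j] lower[of k] m(1) by auto
  qed (use bA b_nn in auto)
  also have "\<dots> \<le> (\<Sum>j\<in>?U. \<Sum>k\<le>N. ?T j k)"
    using T_nn m by (intro sum_mono sum_mono2) auto
  also have "\<dots> \<le> (\<Sum>j\<le>N. \<Sum>k\<le>N. ?T j k)"
    using T_nn m by (intro sum_mono2 sum_nonneg) auto
  also have "\<dots> = 2 * (poly P 1 * (poly (pderiv (pderiv P)) 1 + poly (pderiv P) 1) - (poly (pderiv P) 1)\<^sup>2)"
    by (simp only: sum_square_diff P1[symmetric] P2[symmetric] P3[symmetric])
  also have "\<dots> \<le> 2 * (real (degree P) / 4 * (poly P 1)\<^sup>2)"
    using var by simp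
  also have "\<dots> \<le> real N / 2 * ((real N + 1) * (R * b A))\<^sup>2"
  proof -
    have "poly P 1 \<le> (\<Sum>k\<le>N. R * b A)" unfolding P1 using upper by (intro sum_mono) auto
    also have "\<dots> = (real N + 1) * (R * b A)" by (simp add: algebra_simps)
    finally have "(poly P 1)\<^sup>2 \<le> ((real N + 1) * (R * b A))\<^sup>2"
      using Ppos[of 1] by (intro power_mono) auto
    then have "real (degree P) * (poly P 1)\<^sup>2 \<le> real N * ((real N + 1) * (R * b A))\<^sup>2"
      using degP by (intro mult_mono) auto
    then show ?thesis by simp
  qed
  also have "\<dots> = (real N * (real N + 1)\<^sup>2 * R\<^sup>2) * (b A)\<^sup>2 / 2"
    unfolding power_mult_distrib by simp
  finally have "8 * real q ^ 4 * (b A)\<^sup>2 \<le> (real N * (real N + 1)\<^sup>2 * R\<^sup>2) * (b A)\<^sup>2"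
    by simp
  then show ?thesis using bA by (simp add: mult_le_cancel_right)
qed

text \<open>A totally nonnegative function with bounded support would be nearly constant on fine lattices,
  giving polynomials of degree \<open>O(n)\<close> whose coefficients have spread of order \<open>n\<^sup>2\<close>; real-rootedness
  only permits order \<open>n\<close>.\<close>

theorem tn_fun_bounded_support:
  assumes f: "tn_fun f" and fp: "f p > 0" "f p' > 0" "p < p'"
    and B: "\<And>x. \<bar>x\<bar> > B \<Longrightarrow> f x = 0"
  shows False
proof -
  \<comment> \<open>Thirds, so that \<open>p\<close>, \<open>p + h\<close> and
    \<open>p + 2 * h\<close> lie in the support. On every lattice they are sampled at
    \<open>A - m\<close>, \<open>A\<close> and \<open>A + m\<close>, which keeps \<open>R\<close>
    independent of \<open>q\<close>.\<close>
  define h where "h = (p' - p) / 3"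
  have h: "h > 0" using fp by (simp add: h_def)
  have fpos: "f (p + t * h) > 0" if "0 \<le> t" "t \<le> 3" for t
  proof (rule tn_fun_support_convex[OF f fp(1,2)])
    show "p \<le> p + t * h" using that h by simp
    have "t * h \<le> 3 * h" using that h by (intro mult_right_mono) auto
    then show "p + t * h \<le> p'" by (simp add: h_def)
  qed
  have pB: "\<bar>p\<bar> \<le> B" using B[of p] fp by fastforce
  define R where "R = (f (p + h))\<^sup>2 / (f p * f (p + 2 * h))"
  define C where "C = 8 * (B + \<bar>p\<bar>) / h"
  have R: "R \<ge> 0" using tn_fun_nonneg[OF f] by (simp add: R_def)
  have C: "C \<ge> 0" using h pB by (simp add: C_def)
  have main: "8 * real q ^ 4 \<le> C * real q * (C * real q + 1)\<^sup>2 * R\<^sup>2" if q: "q > 0" for q :: nat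
  proof -
    define m where "m = 4 * q"
    have m: "m > 0" using q by (simp add: m_def)
    define \<delta> where "\<delta> = h / real m"
    have \<delta>: "\<delta> > 0" "real m * \<delta> = h" using h m by (auto simp: \<delta>_def)
    define g where "g k = f (p + real_of_int k * \<delta>)" for k :: int
    define S where "S = {k. g k > 0}"
    have S_bd: "\<bar>real_of_int k\<bar> \<le> (B + \<bar>p\<bar>) / \<delta>" if "k \<in> S" for k
    proof -
      have "\<bar>p + real_of_int k * \<delta>\<bar> \<le> B"
        using that B[of "p + real_of_int k * \<delta>"] by (force simp: S_def g_def)
      then have "\<bar>real_of_int k * \<delta>\<bar> \<le> B + \<bar>p\<bar>" by linarith
      then show ?thesis using \<delta> by (simp add: abs_mult field_simps)
    qed
    have "S \<subseteq> {- \<lceil>(B + \<bar>p\<bar>) / \<delta>\<rceil>..\<lceil>(B + \<bar>p\<bar>) / \<delta>\<rceil>}"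
    proof
      fix k assume "k \<in> S"
      from S_bd[OF this] show "k \<in> {- \<lceil>(B + \<bar>p\<bar>) / \<delta>\<rceil>..\<lceil>(B + \<bar>p\<bar>) / \<delta>\<rceil>}"
        by (auto simp: abs_le_iff) linarith+
    qed
    then have finS: "finite S" by (rule finite_subset) simp
    have inS: "int i \<in> S" if "i \<le> 3 * m" for i
    proof -
      have "real i / real m \<le> 3" using that m by (simp add: field_simps)
      then have "f (p + real i / real m * h) > 0" by (intro fpos) auto
      moreover have "real i / real m * h = real i * \<delta>" by (simp add: \<delta>_def)
      ultimately show ?thesis by (simp add: S_def g_def)
    qed
    define k0 k1 where "k0 = Min S" and "k1 = Max S"
    have "S \<noteq> {}" using inS[of 0] by auto
    then have k01: "k0 \<in> S" "k1 \<in> S" "\<And>k. k \<in> S \<Longrightarrow> k0 \<le> k \<and> k \<le> k1"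
      using finS by (auto simp: k0_def k1_def)
    have k0: "k0 \<le> 0" "int (3 * m) \<le> k1"
      using k01(3)[OF inS[of 0]] k01(3)[OF inS[of "3 * m"]] by auto
    have S_int: "k \<in> S \<longleftrightarrow> k0 \<le> k \<and> k \<le> k1" for k
    proof
      assume "k0 \<le> k \<and> k \<le> k1"
      then show "k \<in> S"
        using k01(1,2) \<delta> tn_fun_support_convex[OF f, of "p + real_of_int k0 * \<delta>" "p + real_of_int k1 * \<delta>"
          "p + real_of_int k * \<delta>"] by (simp add: S_def g_def)
    qed (use k01 in auto)
    have g0: "g k = 0" if "k \<notin> S" for k
      using that tn_fun_nonneg[OF f] by (force simp: S_def g_def not_less intro: antisym)
    define N where "N = nat (k1 - k0)"
    define c where "c k = g (k0 + int k)" for k :: nat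
    define A where "A = m + nat (- k0)"
    have cA: "c A = f (p + h)" "c (A - m) = f p" "c (A + m) = f (p + 2 * h)"
      using k0(1) \<delta>(2) by (auto simp: c_def g_def A_def algebra_simps)
    have "8 * real q ^ 4 \<le> real N * (real N + 1)\<^sup>2 * R\<^sup>2"
    proof (rule tn_sequence_spread[where c = c and A = A and m = m])
      show "c k > 0" if "k \<le> N" for k
        using that S_int[of "k0 + int k"] k0 by (simp add: c_def S_def N_def)
      show "c k = 0" if "k > N" for k
        using that S_int[of "k0 + int k"] k0 by (simp add: c_def N_def g0)
      show "tn_cols n (\<lambda>i j. if j \<le> i then c (i - j) else 0)" for n
        unfolding tn_cols_def
      proof (intro allI impI)
        fix k and r s :: "nat \<Rightarrow> nat"
        assume r: "strict_mono_on {..<k} r" and s: "strict_mono_on {..<k} s"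
        let ?x = "\<lambda>i. p + (real_of_int k0 + real (r i)) * \<delta>" and ?y = "\<lambda>j. real (s j) * \<delta>"
        have "0 \<le> mdet k (\<lambda>i j. f (?x i - ?y j))"
          using r s \<delta> by (intro tn_funD[OF f]) (auto simp: strict_mono_on_def)
        also have "mdet k (\<lambda>i j. f (?x i - ?y j)) =
            mdet k (\<lambda>i j. if s j \<le> r i then c (r i - s j) else 0)"
        proof (rule mdet_cong)
          fix i j
          have "f (?x i - ?y j) = g (k0 + int (r i) - int (s j))"
            by (simp add: g_def algebra_simps)
          then show "f (?x i - ?y j) = (if s j \<le> r i then c (r i - s j) else 0)"
            using S_int[of "k0 + int (r i) - int (s j)"] g0[of "k0 + int (r i) - int (s j)"]
            by (auto simp: c_def of_nat_diff algebra_simps)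
        qed
        finally show "0 \<le> mdet k (\<lambda>i j. if s j \<le> r i then c (r i - s j) else 0)" .
      qed
      show "c k * c (Suc (Suc k)) \<le> (c (Suc k))\<^sup>2" for k
      proof -
        let ?t = "\<lambda>k. p + real_of_int (k0 + int k) * \<delta>"
        have "f (?t k) * f (?t (Suc (Suc k))) \<le> f (?t (Suc k)) * f (?t k + ?t (Suc (Suc k)) - ?t (Suc k))"
          using \<delta> by (intro tn_fun_minor_2[OF f]) (auto simp: algebra_simps)
        moreover have eq: "?t k + ?t (Suc (Suc k)) - ?t (Suc k) = ?t (Suc k)"
          by (simp add: algebra_simps)
        ultimately show ?thesis unfolding eq c_def g_def power2_eq_square by blast
      qed
      show "A + m \<le> N" using k0 by (simp add: A_def N_def)
    qed (use q cA in \<open>auto simp: m_def A_def R_def\<close>)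
    also have "\<dots> \<le> C * real q * (C * real q + 1)\<^sup>2 * R\<^sup>2"
    proof -
      have "real N = real_of_int k1 - real_of_int k0" using k0 by (simp add: N_def)
      also have "\<dots> \<le> 2 * ((B + \<bar>p\<bar>) / \<delta>)" using S_bd[OF k01(1)] S_bd[OF k01(2)] by linarith
      also have "\<dots> = C * real q" using h m by (simp add: C_def \<delta>_def m_def field_simps)
      finally have "real N \<le> C * real q" .
      then show ?thesis using C R by (intro mult_mono power_mono) auto
    qed
    finally show ?thesis .
  qed
  \<comment> \<open>In \<open>main\<close> the left side grows like \<open>q ^ 4\<close>, the right
    side only like \<open>q ^ 3\<close>.\<close>
  define D where "D = C * (C + 1)\<^sup>2 * R\<^sup>2"
  obtain q :: nat where "max D 0 < real q" using reals_Archimedean2 by blast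
  then have q: "D < real q" "q > 0" by auto
  have "8 * real q ^ 4 \<le> C * real q * (C * real q + 1)\<^sup>2 * R\<^sup>2" by (rule main[OF q(2)])
  also have "\<dots> \<le> C * real q * (C * real q + real q)\<^sup>2 * R\<^sup>2"
    using C R q by (intro mult_mono power_mono) auto
  also have "\<dots> = D * real q ^ 3"
    by (simp add: D_def power2_eq_square eval_nat_numeral algebra_simps)
  also have "\<dots> < real q * real q ^ 3" using q by (intro mult_strict_right_mono) auto
  also have "\<dots> = real q ^ 4" by (simp add: eval_nat_numeral)
  finally show False using q by simp
qed

subsection \<open>Totally positive functions and limits of minors\<close>

lemma has_real_derivative_mdet_row:
  assumes "k < n" "\<And>j. j < n \<Longrightarrow> (u j has_real_derivative u' j) (at t)"
  shows "((\<lambda>t. mdet n (A(k := (\<lambda>j. u j t)))) has_real_derivative mdet n (A(k := u'))) (at t)"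
proof -
  obtain m where n: "n = Suc m"
    using assms(1) by (cases n) auto
  show ?thesis
    using assms unfolding n
    by (auto simp: mdet_upd_row_expand simp del: sum.lessThan_Suc
        intro!: DERIV_sum DERIV_cmult_right)
qed

lemma tendsto_mdet_row_0:
  assumes "k < n" "\<And>j. j < n \<Longrightarrow> ((\<lambda>t. u j t) \<longlongrightarrow> 0) F"
  shows "((\<lambda>t. mdet n (A(k := (\<lambda>j. u j t)))) \<longlongrightarrow> 0) F"
proof -
  obtain m where n: "n = Suc m"
    using assms(1) by (cases n) auto
  show ?thesis
    using assms unfolding n
    by (auto simp: mdet_upd_row_expand simp del: sum.lessThan_Suc
        intro!: tendsto_null_sum tendsto_mult_left_zero)
qed

text \<open>Turning the rows one by one from derivatives into primitives: as a function of its last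
  primitive row the determinant vanishes at the preceding node and has positive derivative.\<close>

lemma mdet_primitive_rows_pos:
  fixes h k :: "nat \<Rightarrow> real \<Rightarrow> real"
  assumes deriv: "\<And>j t. j < n \<Longrightarrow> (h j has_real_derivative k j t) (at t)"
    and base: "\<And>x. strict_mono_on {..<n} x \<Longrightarrow>
      0 < mdet n (\<lambda>i j. if i < Suc 0 then h j (x i) else k j (x i))"
    and m: "Suc 0 \<le> m" "m \<le> n" and x: "strict_mono_on {..<n} x"
  shows "0 < mdet n (\<lambda>i j. if i < m then h j (x i) else k j (x i))"
  using m x
proof (induction m arbitrary: x rule: dec_induct)
  case base
  then show ?case using assms(2) by simp
next
  case (step m)
  define A where "A = (\<lambda>i j. if i < Suc m then h j (x i) else k j (x i))"
  define \<phi> where "\<phi> = (\<lambda>t. mdet n (A(m := (\<lambda>j. h j t))))"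
  define \<phi>' where "\<phi>' = (\<lambda>t. mdet n (A(m := (\<lambda>j. k j t))))"
  have mn: "m < n" "0 < m" using step.prems step.hyps by auto
  have lt: "x (m - 1) < x m"
    using step.prems(2) mn by (auto simp: strict_mono_on_def)
  have "(\<phi> has_real_derivative \<phi>' t) (at t)" for t
    unfolding \<phi>_def \<phi>'_def using mn(1) deriv by (rule has_real_derivative_mdet_row)
  then obtain z where z: "x (m - 1) < z" "z < x m" "\<phi> (x m) - \<phi> (x (m - 1)) = (x m - x (m - 1)) * \<phi>' z"
    using MVT2[OF lt, of \<phi> \<phi>'] by blast
  have "\<phi> (x (m - 1)) = 0"
    unfolding \<phi>_def by (rule mdet_eq_rows[of "m - 1" _ m]) (use mn in \<open>auto simp: A_def\<close>)
  moreover have "\<phi>' z > 0"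
  proof -
    let ?x = "x(m := z)"
    have sx: "strict_mono_on {..<n} ?x"
    proof (rule strict_mono_onI)
      fix r s assume rs: "r \<in> {..<n}" "s \<in> {..<n}" "r < s"
      have mono: "x r \<le> x s" if "r \<le> s" "s < n" for r s
        using strict_mono_onD[OF step.prems(2), of r s] that by (cases "r = s") auto
      show "?x r < ?x s"
      proof (cases "s = m")
        case True
        then have "x r \<le> x (m - 1)" using rs mn by (intro mono) auto
        with z True rs show ?thesis by simp
      next
        case False
        have "x m \<le> x s" if "r = m" using rs that by (intro mono) auto
        with z False rs strict_mono_onD[OF step.prems(2), of r s] show ?thesis by auto
      qed
    qed
    have "\<phi>' z = mdet n (\<lambda>i j. if i < m then h j (?x i) else k j (?x i))"
      unfolding \<phi>'_def A_def by (rule mdet_cong) auto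
    with step.IH[OF _ sx] mn show ?thesis by simp
  qed
  ultimately have "\<phi> (x m) > 0" using z lt by simp
  also have "\<phi> (x m) = mdet n A"
    unfolding \<phi>_def A_def by (rule mdet_cong) auto
  finally show ?case by (simp add: A_def)
qed

text \<open>Pulling \<open>exp (s i * t 0)\<close> out of the rows turns column 0 into ones. With
  all rows but the first differentiated, that column becomes a unit vector, and what remains is a
  minor of the same kind, one size smaller, up to positive column factors.\<close>

lemma mdet_exp_pos:
  assumes "strict_mono_on {..<n} s" "strict_mono_on {..<n} t"
  shows "0 < mdet n (\<lambda>i j. exp (s i * t j))"
  using assms
proof (induction n arbitrary: s t)
  case (Suc n)
  define h where "h j y = exp (y * (t j - t 0))" for j y
  define k where "k j y = (t j - t 0) * exp (y * (t j - t 0))" for j y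
  have "0 < mdet (Suc n) (\<lambda>i j. if i < Suc n then h j (s i) else k j (s i))"
  proof (rule mdet_primitive_rows_pos)
    show "(h j has_real_derivative k j y) (at y)" for j y
      unfolding h_def k_def by (auto intro!: derivative_eq_intros)
  next
    fix x :: "nat \<Rightarrow> real" assume x: "strict_mono_on {..<Suc n} x"
    let ?A = "\<lambda>i j. if i < Suc 0 then h j (x i) else k j (x i)"
    have "mdet (Suc n) ?A = (\<Sum>i<Suc n. ?A i 0 * ((- 1) ^ (i + 0) *
        mdet n (\<lambda>i' j'. ?A (insert_index i i') (insert_index 0 j'))))"
      by (rule mdet_expand_col) simp
    also have "\<dots> = (\<Sum>i\<in>{0}. ?A i 0 * ((- 1) ^ (i + 0) *
        mdet n (\<lambda>i' j'. ?A (insert_index i i') (insert_index 0 j'))))"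
      by (intro sum.mono_neutral_right) (auto simp: k_def)
    also have "\<dots> = mdet n (\<lambda>i j. 1 * (t (Suc j) - t 0) * exp (x (Suc i) * (t (Suc j) - t 0)))"
      by (simp add: h_def k_def insert_index_def)
    also have "\<dots> = (\<Prod>i<n. 1) * (\<Prod>j<n. t (Suc j) - t 0) *
        mdet n (\<lambda>i j. exp (x (Suc i) * (t (Suc j) - t 0)))"
      by (rule mdet_scale)
    also have "\<dots> > 0"
    proof -
      have "0 < mdet n (\<lambda>i j. exp (x (Suc i) * (t (Suc j) - t 0)))"
        using x Suc.prems by (intro Suc.IH) (auto simp: strict_mono_on_def)
      moreover have "0 < (\<Prod>j<n. t (Suc j) - t 0)"
        using Suc.prems(2) by (intro prod_pos) (auto simp: strict_mono_on_def)
      ultimately show ?thesis by simp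
    qed
    finally show "0 < mdet (Suc n) ?A" .
  qed (use Suc.prems in auto)
  also have "mdet (Suc n) (\<lambda>i j. if i < Suc n then h j (s i) else k j (s i)) =
      mdet (Suc n) (\<lambda>i j. h j (s i))"
    by (rule mdet_cong) simp
  finally have "0 < (\<Prod>i<Suc n. exp (s i * t 0)) * (\<Prod>j<Suc n. 1) * mdet (Suc n) (\<lambda>i j. h j (s i))"
    by (intro mult_pos_pos prod_pos) auto
  also have "\<dots> = mdet (Suc n) (\<lambda>i j. exp (s i * t 0) * 1 * h j (s i))"
    by (rule mdet_scale[symmetric])
  also have "\<dots> = mdet (Suc n) (\<lambda>i j. exp (s i * t j))"
    by (rule mdet_cong) (simp add: h_def exp_add[symmetric] algebra_simps)
  finally show ?case .
qed simp

text \<open>All rows but the first are integrated by \<open>mdet_primitive_rows_pos\<close>. The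
  node of the first row moves in from minus infinity, where the determinant tends to 0; its
  derivative on the way is a minor of \<open>k\<close>.\<close>

lemma tp_fun_primitive:
  assumes k: "tp_fun k" and deriv: "\<And>t. (h has_real_derivative k t) (at t)"
    and lim: "(h \<longlongrightarrow> 0) at_bot"
  shows "tp_fun h"
  unfolding tp_fun_def
proof (intro allI impI)
  fix n and x y :: "nat \<Rightarrow> real"
  assume x: "strict_mono_on {..<n} x" and y: "strict_mono_on {..<n} y"
  show "0 < mdet n (\<lambda>i j. h (x i - y j))"
  proof (cases "n = 0")
    case False
    have shift: "((\<lambda>t. h (t - y j)) has_real_derivative k (t - y j)) (at t)" for j t
      using deriv[of "t - y j"] DERIV_shift[of h "k (t - y j)" t "- y j"] by simp
    have "0 < mdet n (\<lambda>i j. if i < n then h (x i - y j) else k (x i - y j))"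
    proof (rule mdet_primitive_rows_pos[where h = "\<lambda>j t. h (t - y j)" and k = "\<lambda>j t. k (t - y j)"])
      show "((\<lambda>t. h (t - y j)) has_real_derivative k (t - y j)) (at t)" for j t
        by (rule shift)
    next
      fix x :: "nat \<Rightarrow> real" assume x: "strict_mono_on {..<n} x"
      define A where "A = (\<lambda>i j. if i < Suc 0 then h (x i - y j) else k (x i - y j))"
      define \<phi> where "\<phi> = (\<lambda>t. mdet n (A(0 := (\<lambda>j. h (t - y j)))))"
      define \<phi>' where "\<phi>' = (\<lambda>t. mdet n (A(0 := (\<lambda>j. k (t - y j)))))"
      have d: "(\<phi> has_real_derivative \<phi>' t) (at t)" for t
        unfolding \<phi>_def \<phi>'_def using False
        by (intro has_real_derivative_mdet_row shift) auto
      have pos: "\<phi>' t > 0" if "t \<le> x 0" for t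
      proof -
        have "strict_mono_on {..<n} (x(0 := t))"
          using x that unfolding strict_mono_on_def by (force intro: le_less_trans)
        then have "0 < mdet n (\<lambda>i j. k ((x(0 := t)) i - y j))"
          using y by (rule tp_funD[OF k])
        also have "mdet n (\<lambda>i j. k ((x(0 := t)) i - y j)) = \<phi>' t"
          unfolding \<phi>'_def A_def by (rule mdet_cong) auto
        finally show ?thesis .
      qed
      have mono: "\<phi> s < \<phi> t" if "s < t" "t \<le> x 0" for s t
        using that by (intro DERIV_pos_imp_increasing[of s t \<phi>]) (auto intro!: exI[of _ "\<phi>' _"] d pos)
      have "(\<phi> \<longlongrightarrow> 0) at_bot"
        unfolding \<phi>_def using False
      proof (intro tendsto_mdet_row_0)
        fix j
        have "filterlim (\<lambda>t. t - y j) at_bot at_bot" by real_asymp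
        then show "((\<lambda>t. h (t - y j)) \<longlongrightarrow> 0) at_bot" by (rule filterlim_compose[OF lim])
      qed simp
      \<comment> \<open>The limit yields only a weak inequality, so it is taken at
        \<open>x 0 - 1\<close>; strictness comes from the last unit step.\<close>
      moreover have "\<forall>\<^sub>F t in at_bot. \<phi> t \<le> \<phi> (x 0 - 1)"
        using eventually_le_at_bot[of "x 0 - 1"]
        by eventually_elim (metis diff_le_self less_eq_real_def mono order_trans zero_le_one diff_add_cancel le_add_same_cancel1)
      ultimately have "0 \<le> \<phi> (x 0 - 1)" by (intro tendsto_upperbound) auto
      also have "\<dots> < \<phi> (x 0)" by (rule mono) auto
      also have "\<phi> (x 0) = mdet n A"
        unfolding \<phi>_def A_def by (rule mdet_cong) auto
      finally show "0 < mdet n (\<lambda>i j. if i < Suc 0 then h (x i - y j) else k (x i - y j))"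
        by (simp add: A_def)
    qed (use False x in auto)
    also have "mdet n (\<lambda>i j. if i < n then h (x i - y j) else k (x i - y j)) = mdet n (\<lambda>i j. h (x i - y j))"
      by (rule mdet_cong) simp
    finally show ?thesis .
  qed simp
qed

lemma mdet_tilt:
  "mdet n (\<lambda>i j. exp (\<mu> * (x i - y j)) * f (x i - y j)) =
    (\<Prod>i<n. exp (\<mu> * x i)) * (\<Prod>j<n. exp (- \<mu> * y j)) * mdet n (\<lambda>i j. f (x i - y j))"
  by (subst mdet_scale[symmetric], rule mdet_cong) (simp add: exp_add[symmetric] algebra_simps)

lemma minors_nonneg_tilt:
  "minors_nonneg n f \<Longrightarrow> minors_nonneg n (\<lambda>x. exp (\<mu> * x) * f x)"
  unfolding minors_nonneg_def mdet_tilt by (auto intro!: mult_nonneg_nonneg prod_nonneg)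

lemma tp_fun_tilt: "tp_fun f \<Longrightarrow> tp_fun (\<lambda>x. exp (\<mu> * x) * f x)"
  unfolding tp_fun_def mdet_tilt by (auto intro!: mult_pos_pos prod_pos)

lemma mdet_smult: "mdet n (\<lambda>i j. c * A i j) = c ^ n * mdet n A"
  using mdet_scale[of n "\<lambda>_. c" "\<lambda>_. 1" A] by simp

lemma tp_fun_smult: "tp_fun f \<Longrightarrow> c > 0 \<Longrightarrow> tp_fun (\<lambda>x. c * f x)"
  unfolding tp_fun_def mdet_smult by (auto intro!: mult_pos_pos)

section \<open>Concrete totally positive functions\<close>

lemma tp_fun_gaussian:
  assumes "\<kappa> > 0"
  shows "tp_fun (\<lambda>x. exp (- \<kappa> * x\<^sup>2))"
  unfolding tp_fun_def
proof (intro allI impI)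
  fix n and x y :: "nat \<Rightarrow> real"
  assume "strict_mono_on {..<n} x" "strict_mono_on {..<n} y"
  then have "0 < mdet n (\<lambda>i j. exp (2 * \<kappa> * x i * y j))"
    using assms by (intro mdet_exp_pos) (auto simp: strict_mono_on_def)
  then have "0 < (\<Prod>i<n. exp (- \<kappa> * (x i)\<^sup>2)) * (\<Prod>j<n. exp (- \<kappa> * (y j)\<^sup>2)) *
      mdet n (\<lambda>i j. exp (2 * \<kappa> * x i * y j))"
    by (intro mult_pos_pos prod_pos) auto
  also have "\<dots> = mdet n (\<lambda>i j. exp (- \<kappa> * (x i)\<^sup>2) * exp (- \<kappa> * (y j)\<^sup>2) * exp (2 * \<kappa> * x i * y j))"
    by (rule mdet_scale[symmetric])
  also have "\<dots> = mdet n (\<lambda>i j. exp (- \<kappa> * (x i - y j)\<^sup>2))"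
    by (rule mdet_cong) (simp add: exp_add[symmetric] power2_eq_square algebra_simps)
  finally show "0 < mdet n (\<lambda>i j. exp (- \<kappa> * (x i - y j)\<^sup>2))" .
qed

text \<open>An exponential kernel \<open>exp (s * t)\<close> in the increasing quantities
  \<open>- exp (- x)\<close> and \<open>exp y\<close>.\<close>

lemma tp_fun_exp_exp: "tp_fun (\<lambda>x. exp (- exp (- x)))"
  unfolding tp_fun_def
proof (intro allI impI)
  fix n and x y :: "nat \<Rightarrow> real"
  assume "strict_mono_on {..<n} x" "strict_mono_on {..<n} y"
  then have "0 < mdet n (\<lambda>i j. exp (- exp (- x i) * exp (y j)))"
    by (intro mdet_exp_pos) (auto simp: strict_mono_on_def)
  also have "\<dots> = mdet n (\<lambda>i j. exp (- exp (- (x i - y j))))"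
    by (rule mdet_cong) (simp add: exp_add[symmetric])
  finally show "0 < mdet n (\<lambda>i j. exp (- exp (- (x i - y j))))" .
qed

text \<open>In the variable \<open>v = exp (- x)\<close> these arise from the totally positive \<open>exp (- v)\<close> by multiplying
  with powers of \<open>v\<close> and taking primitives in \<open>x\<close>. What matters is which Taylor coefficients vanish:
  \<open>W1 v = 1 - v / 2 + O(v\<^sup>3)\<close> and \<open>W2 v = 1 - v\<^sup>2 / 4 + v\<^sup>3 / 12 + O(v\<^sup>5)\<close>.\<close>

definition W1 :: "real \<Rightarrow> real" where "W1 v = (1 + v / 2) * exp (- v)"
definition W2 :: "real \<Rightarrow> real" where "W2 v = (1 + v / 2)\<^sup>2 * exp (- v)"

lemma tp_fun_W1: "tp_fun (\<lambda>x. W1 (exp (- x)))"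
  and tp_fun_W2: "tp_fun (\<lambda>x. W2 (exp (- x)))"
proof -
  let ?h0 = "\<lambda>x::real. (1 + exp (- x)) * exp (- exp (- x))"
  let ?h1 = "\<lambda>x::real. (2 + exp (- x)) * exp (- exp (- x))"
  let ?h2 = "\<lambda>x::real. (2 + exp (- x))\<^sup>2 * exp (- exp (- x))"
  have h0: "tp_fun ?h0"
  proof (rule tp_fun_primitive[OF tp_fun_tilt[OF tp_fun_exp_exp, of "-2"]])
    show "(?h0 has_real_derivative exp (- 2 * t) * exp (- exp (- t))) (at t)" for t
      by (auto intro!: derivative_eq_intros simp: exp_add[symmetric] algebra_simps)
    show "(?h0 \<longlongrightarrow> 0) at_bot" by real_asymp
  qed
  have h1: "tp_fun ?h1"
  proof (rule tp_fun_primitive[OF tp_fun_tilt[OF h0, of "-1"]])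
    show "(?h1 has_real_derivative exp (- 1 * t) * ?h0 t) (at t)" for t
      by (auto intro!: derivative_eq_intros simp: exp_add[symmetric] algebra_simps)
    show "(?h1 \<longlongrightarrow> 0) at_bot" by real_asymp
  qed
  have h2: "tp_fun ?h2"
  proof (rule tp_fun_primitive[OF tp_fun_tilt[OF h1, of "-2"]])
    show "(?h2 has_real_derivative exp (- 2 * t) * ?h1 t) (at t)" for t
    proof -
      have "exp (- (2 * t)) = exp (- t) * exp (- t)" by (simp add: exp_add[symmetric])
      then show ?thesis
        by (auto intro!: derivative_eq_intros simp: power2_eq_square algebra_simps)
    qed
    show "(?h2 \<longlongrightarrow> 0) at_bot" by real_asymp
  qed
  show "tp_fun (\<lambda>x. W1 (exp (- x)))"
    using tp_fun_smult[OF h1, of "1 / 2"] by (simp add: W1_def add_divide_distrib algebra_simps)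
  show "tp_fun (\<lambda>x. W2 (exp (- x)))"
    using tp_fun_smult[OF h2, of "1 / 4"] by (simp add: W2_def power2_eq_square add_divide_distrib algebra_simps)
qed

section \<open>Sending nodes to infinity\<close>

lemma mdet_sub_last_row:
  assumes "m \<le> n"
  shows "mdet (Suc n) (\<lambda>i j. if i < m then A i j - A n j else A i j) = mdet (Suc n) A"
  using assms
proof (induction m)
  case (Suc m)
  let ?B = "\<lambda>i j. if i < m then A i j - A n j else A i j"
  have "mdet (Suc n) (\<lambda>i j. if i < Suc m then A i j - A n j else A i j) =
      mdet (Suc n) (?B(m := (\<lambda>j. ?B m j + (-1) * ?B n j)))"
    using Suc.prems by (intro mdet_cong) (auto simp: less_Suc_eq)
  also have "\<dots> = mdet (Suc n) ?B"
    by (rule mdet_add_row) (use Suc.prems in auto)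
  finally show ?case using Suc by simp
qed simp

text \<open>Let the last node \<open>x\<close> tend to \<open>\<infinity>\<close> and the first node \<open>y\<close> to \<open>- \<infinity>\<close>.\<close>

lemma minors_nonneg_limit:
  assumes f: "minors_nonneg (Suc n) f" and lim: "(f \<longlongrightarrow> a) at_top" and a: "a > 0"
  shows "minors_nonneg n (\<lambda>t. a - f t)"
  unfolding minors_nonneg_def
proof (intro allI impI)
  fix x y :: "nat \<Rightarrow> real"
  assume x: "strict_mono_on {..<n} x" and y: "strict_mono_on {..<n} y"
  define X where "X M i = (if i < n then x i else M)" for M i
  define Y where "Y M j = (if j = 0 then - M else y (j - 1))" for M j
  \<comment> \<open>The limit matrix: last row and first column are constantly \<open>a\<close>.
    Subtracting the last row leaves \<open>f - a\<close> as a block beside one entry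
    \<open>a\<close>; the sign \<open>(-1) ^ n\<close> of its cofactor cancels that of passing to
    \<open>a - f\<close>.\<close>
  define B where "B i j = (if i < n \<and> j > 0 then f (x i - y (j - 1)) else a)" for i j
  have "\<forall>\<^sub>F M in at_top. 0 \<le> mdet (Suc n) (\<lambda>i j. f (X M i - Y M j))"
  proof -
    define M0 where "M0 = 1 + (\<Sum>i<n. \<bar>x i\<bar>) + (\<Sum>i<n. \<bar>y i\<bar>)"
    have bd: "\<bar>x i\<bar> < M0" "\<bar>y i\<bar> < M0" if "i < n" for i
    proof -
      have "\<bar>x i\<bar> \<le> (\<Sum>i<n. \<bar>x i\<bar>)" "\<bar>y i\<bar> \<le> (\<Sum>i<n. \<bar>y i\<bar>)"
        using that by (auto intro!: member_le_sum)
      moreover have "0 \<le> (\<Sum>i<n. \<bar>x i\<bar>)" "0 \<le> (\<Sum>i<n. \<bar>y i\<bar>)" by (auto intro!: sum_nonneg)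
      ultimately show "\<bar>x i\<bar> < M0" "\<bar>y i\<bar> < M0" unfolding M0_def by linarith+
    qed
    show ?thesis
      using eventually_ge_at_top[of M0]
    proof eventually_elim
      case (elim M)
      have "strict_mono_on {..<Suc n} (X M)"
      proof (rule strict_mono_onI)
        fix r s assume "r \<in> {..<Suc n}" "s \<in> {..<Suc n}" "r < s"
        then show "X M r < X M s"
          using strict_mono_onD[OF x, of r s] bd(1)[of r] elim by (auto simp: X_def)
      qed
      moreover have "strict_mono_on {..<Suc n} (Y M)"
      proof (rule strict_mono_onI)
        fix r s assume "r \<in> {..<Suc n}" "s \<in> {..<Suc n}" "r < s"
        then show "Y M r < Y M s"
        proof (cases "r = 0")
          case True
          with \<open>s \<in> {..<Suc n}\<close> \<open>r < s\<close> have "s - 1 < n" by auto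
          with bd(2)[of "s - 1"] elim True \<open>r < s\<close> show ?thesis by (simp add: Y_def)
        next
          case False
          with \<open>s \<in> {..<Suc n}\<close> \<open>r < s\<close> have "r - 1 < s - 1" "s - 1 < n" by auto
          with strict_mono_onD[OF y, of "r - 1" "s - 1"] False \<open>r < s\<close> show ?thesis
            by (simp add: Y_def)
        qed
      qed
      ultimately show ?case using f by (simp add: minors_nonneg_def)
    qed
  qed
  moreover have "((\<lambda>M. mdet (Suc n) (\<lambda>i j. f (X M i - Y M j))) \<longlongrightarrow> mdet (Suc n) B) at_top"
  proof (rule tendsto_mdet)
    fix i j
    have *: "filterlim (\<lambda>M. M - y (j - 1)) at_top at_top" "filterlim (\<lambda>M. x i + M) at_top at_top"
      "filterlim (\<lambda>M::real. M + M) at_top at_top" by real_asymp+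
    show "((\<lambda>M. f (X M i - Y M j)) \<longlongrightarrow> B i j) at_top"
      using *[THEN filterlim_compose[OF lim]]
      by (cases "i < n"; cases "j = 0") (simp_all add: X_def Y_def B_def)
  qed
  ultimately have "0 \<le> mdet (Suc n) B" by (intro tendsto_lowerbound) auto
  also have "mdet (Suc n) B = mdet (Suc n) (\<lambda>i j. if i < n then B i j - B n j else B i j)"
    by (rule mdet_sub_last_row[symmetric]) simp
  also have "\<dots> = mdet (Suc n) (\<lambda>i j. if i < n then (if j = 0 then 0 else f (x i - y (j - 1)) - a) else a)"
    (is "_ = mdet _ ?C") by (rule mdet_cong) (auto simp: B_def)
  also have "\<dots> = (\<Sum>i<Suc n. ?C i 0 * ((- 1) ^ (i + 0) *
      mdet n (\<lambda>i' j'. ?C (insert_index i i') (insert_index 0 j'))))"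
    by (rule mdet_expand_col) simp
  also have "\<dots> = a * (-1) ^ n * mdet n (\<lambda>i' j'. ?C (insert_index n i') (insert_index 0 j'))"
    by (simp add: sum.lessThan_Suc)
  also have "mdet n (\<lambda>i' j'. ?C (insert_index n i') (insert_index 0 j')) =
      mdet n (\<lambda>i j. (-1) * (a - f (x i - y j)))"
    by (rule mdet_cong) (auto simp: insert_index_def)
  also have "a * (-1) ^ n * \<dots> = a * mdet n (\<lambda>i j. a - f (x i - y j))"
    unfolding mdet_smult by (simp flip: power_mult_distrib)
  finally show "0 \<le> mdet n (\<lambda>i j. a - f (x i - y j))" using a by (simp add: zero_le_mult_iff)
qed

subsection \<open>Monotonicity and logarithmic concavity\<close>

text \<open>It suffices to find, around each interior point \<open>m\<close>, a single pair \<open>s\<close>, \<open>z\<close> that is nearly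
  symmetric about \<open>m\<close>: apply this at a maximum of \<open>\<phi>\<close> minus its chord plus a small parabola.\<close>

lemma below_chord:
  fixes \<phi> :: "real \<Rightarrow> real"
  assumes ab: "a < b" and cont: "continuous_on {a..b} \<phi>"
    and loc: "\<And>m \<epsilon>. a < m \<Longrightarrow> m < b \<Longrightarrow> \<epsilon> > 0 \<Longrightarrow> \<exists>s\<in>{a..b}. \<exists>z\<in>{a..b}.
      s \<noteq> z \<and> 2 * \<phi> m \<le> \<phi> s + \<phi> z \<and> \<bar>s + z - 2 * m\<bar> \<le> \<epsilon> * (s - z)\<^sup>2"
    and x: "x \<in> {a..b}"
  shows "\<phi> x \<le> \<phi> a + (\<phi> b - \<phi> a) / (b - a) * (x - a)"
proof (rule ccontr)
  define k where "k = (\<phi> b - \<phi> a) / (b - a)"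
  assume neg: "\<not> \<phi> x \<le> \<phi> a + (\<phi> b - \<phi> a) / (b - a) * (x - a)"
  define \<eta> where "\<eta> = \<phi> x - (\<phi> a + k * (x - a))"
  have \<eta>: "\<eta> > 0" using neg by (simp add: \<eta>_def k_def)
  \<comment> \<open>The parabola is then at most \<open>\<eta> / 2\<close> deep on the interval, so
    \<open>H x\<close> stays positive.\<close>
  define \<kappa> where "\<kappa> = \<eta> / (2 * (b - a)\<^sup>2)"
  have \<kappa>: "\<kappa> > 0" using \<eta> ab by (simp add: \<kappa>_def)
  define Q where "Q y = \<kappa> * (y - a) * (y - b) - (\<phi> a + k * (y - a))" for y
  define H where "H y = \<phi> y + Q y" for y
  have Hab: "H a = 0" "H b = 0" using ab by (auto simp: H_def Q_def k_def)
  have "(x - a) * (b - x) \<le> (b - a) * (b - a)"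
    using x by (intro mult_mono) auto
  then have "\<kappa> * ((x - a) * (b - x)) \<le> \<kappa> * (b - a)\<^sup>2"
    using \<kappa> by (simp add: power2_eq_square)
  moreover have "\<kappa> * (b - a)\<^sup>2 = \<eta> / 2" using ab by (simp add: \<kappa>_def)
  ultimately have Hx: "H x > 0" using \<eta> by (simp add: H_def Q_def \<eta>_def algebra_simps)
  have "continuous_on {a..b} H"
    unfolding H_def Q_def by (intro continuous_intros cont)
  then obtain m where m: "m \<in> {a..b}" "\<And>y. y \<in> {a..b} \<Longrightarrow> H y \<le> H m"
    using continuous_attains_sup[of "{a..b}" H] ab by auto
  have "H m > 0" using m(2)[OF x] Hx by simp
  then have mab: "a < m" "m < b" using m(1) Hab by (auto simp: less_le)
  define M where "M = \<kappa> * (b - a) + \<bar>k\<bar>"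
  have M: "M \<ge> 0" using \<kappa> ab by (simp add: M_def)
  \<comment> \<open>The second difference of the parabola is \<open>\<kappa> / 2\<close> times the
    squared gap; this \<epsilon> lets the asymmetry spoil at most half of it.\<close>
  define \<epsilon> where "\<epsilon> = \<kappa> / (4 * (M + 1))"
  have \<epsilon>: "\<epsilon> > 0" using \<kappa> M by (simp add: \<epsilon>_def)
  obtain s z where sz: "s \<in> {a..b}" "z \<in> {a..b}" "s \<noteq> z" "2 * \<phi> m \<le> \<phi> s + \<phi> z"
    "\<bar>s + z - 2 * m\<bar> \<le> \<epsilon> * (s - z)\<^sup>2"
    using loc[OF mab \<epsilon>] by blast
  define e where "e = s + z - 2 * m"
  define w where "w = \<kappa> * ((s + z) / 2 + m - (a + b)) - k"
  have Q: "Q s + Q z - 2 * Q m = \<kappa> * (s - z)\<^sup>2 / 2 + e * w"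
    by (simp add: Q_def e_def w_def power2_eq_square field_simps)
  have "a \<le> s" "s \<le> b" "a \<le> z" "z \<le> b" "a \<le> m" "m \<le> b" using sz(1,2) m(1) by auto
  then have "\<bar>(s + z) / 2 + m - (a + b)\<bar> \<le> b - a" by (intro abs_leI) argo+
  then have "\<kappa> * \<bar>(s + z) / 2 + m - (a + b)\<bar> \<le> \<kappa> * (b - a)" using \<kappa> by simp
  moreover have "\<bar>w\<bar> \<le> \<bar>\<kappa> * ((s + z) / 2 + m - (a + b))\<bar> + \<bar>k\<bar>"
    unfolding w_def by (rule abs_triangle_ineq4)
  moreover have "\<bar>\<kappa> * ((s + z) / 2 + m - (a + b))\<bar> = \<kappa> * \<bar>(s + z) / 2 + m - (a + b)\<bar>"
    using \<kappa> by (simp only: abs_mult abs_of_pos)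
  ultimately have "\<bar>w\<bar> \<le> M" unfolding M_def by linarith
  then have "\<bar>e * w\<bar> \<le> \<epsilon> * (s - z)\<^sup>2 * M"
    unfolding abs_mult using sz(5) \<epsilon> by (intro mult_mono) (auto simp: e_def)
  also have "\<epsilon> * (s - z)\<^sup>2 * M \<le> \<epsilon> * (s - z)\<^sup>2 * (M + 1)"
    using \<epsilon> by (intro mult_left_mono) auto
  also have "\<dots> = \<kappa> * (s - z)\<^sup>2 / 4" using M by (simp add: \<epsilon>_def field_simps)
  finally have "Q s + Q z - 2 * Q m \<ge> \<kappa> * (s - z)\<^sup>2 / 4" using Q by linarith
  moreover have "\<kappa> * (s - z)\<^sup>2 / 4 > 0" using \<kappa> sz(3) by simp
  ultimately have "2 * H m < H s + H z" using sz(4) by (simp add: H_def)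
  with m(2)[OF sz(1)] m(2)[OF sz(2)] show False by simp
qed

lemma convex_on_by_chords:
  fixes \<phi> :: "real \<Rightarrow> real"
  assumes "convex S"
    and "\<And>a b x. a \<in> S \<Longrightarrow> b \<in> S \<Longrightarrow> a < b \<Longrightarrow> x \<in> {a..b} \<Longrightarrow>
      \<phi> x \<le> \<phi> a + (\<phi> b - \<phi> a) / (b - a) * (x - a)"
  shows "convex_on S \<phi>"
proof (rule convex_on_linorderI[OF _ assms(1)])
  fix t x y :: real
  assume t: "0 < t" "t < 1" and xy: "x \<in> S" "y \<in> S" "x < y"
  let ?z = "(1 - t) *\<^sub>R x + t *\<^sub>R y"
  have z: "?z - x = t * (y - x)" by (simp add: algebra_simps)
  have "0 \<le> t * (y - x)" "t * (y - x) \<le> 1 * (y - x)"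
    using t xy by (auto intro!: mult_right_mono)
  then have "?z \<in> {x..y}" using z by auto
  then have "\<phi> ?z \<le> \<phi> x + (\<phi> y - \<phi> x) / (y - x) * (?z - x)" by (rule assms(2)[OF xy])
  also have "\<dots> = (1 - t) * \<phi> x + t * \<phi> y"
    unfolding z using xy by (simp add: field_simps)
  finally show "\<phi> ?z \<le> (1 - t) * \<phi> x + t * \<phi> y" .
qed

lemma convex_on_subgradient:
  fixes \<phi> :: "real \<Rightarrow> real"
  assumes "convex_on S \<phi>" "open S" "x \<in> S"
  obtains D where "\<And>y. y \<in> S \<Longrightarrow> \<phi> x + D * (y - x) \<le> \<phi> y"
proof (rule that)
  have "x \<in> interior S" using assms(2,3) by (simp add: interior_open)
  then show "\<phi> x + Inf ((\<lambda>t. (\<phi> x - \<phi> t) / (x - t)) ` ({x<..} \<inter> S)) * (y - x) \<le> \<phi> y"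
    if "y \<in> S" for y
    using that by (rule convex_le_Inf_differential[OF assms(1)])
qed

text \<open>A drop by a factor \<open>r < 1\<close> over distance \<open>d\<close> is repeated, by
  the minors, at every further step of length \<open>d\<close>; \<theta> would decay geometrically
  and fall below the positive limit of \<open>l\<close>.\<close>

lemma minor_2_nondecreasing:
  fixes \<theta> :: "real \<Rightarrow> real"
  assumes pos: "\<And>x. \<theta> x > 0"
    and minor: "\<And>a b c. a \<le> c \<Longrightarrow> c \<le> b \<Longrightarrow> \<theta> a * \<theta> b \<le> \<theta> c * \<theta> (a + b - c)"
    and low: "\<And>x. l x \<le> \<theta> x" "(l \<longlongrightarrow> L) at_top" "L > 0"
    and xy: "x < y"
  shows "\<theta> x \<le> \<theta> y"
proof (rule ccontr)
  assume neg: "\<not> \<theta> x \<le> \<theta> y"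
  define r where "r = \<theta> y / \<theta> x"
  have r: "0 < r" "r < 1" using pos neg by (auto simp: r_def)
  define d where "d = y - x"
  have d: "d > 0" using xy by (simp add: d_def)
  have step: "\<theta> (x + real (Suc k) * d) \<le> r * \<theta> (x + real k * d)" for k
  proof -
    have "\<theta> x * \<theta> (x + real (Suc k) * d) \<le> \<theta> y * \<theta> (x + (x + real (Suc k) * d) - y)"
    proof (rule minor)
      have "0 \<le> real k * d" using d by simp
      then show "y \<le> x + real (Suc k) * d" by (simp add: d_def algebra_simps)
    qed (use xy in simp)
    also have "x + (x + real (Suc k) * d) - y = x + real k * d" by (simp add: d_def algebra_simps)
    finally show ?thesis using pos[of x] by (simp add: r_def field_simps)
  qed
  have geom: "\<theta> (x + real k * d) \<le> r ^ k * \<theta> x" for k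
  proof (induction k)
    case (Suc k)
    have "r * \<theta> (x + real k * d) \<le> r * (r ^ k * \<theta> x)" using Suc r by (intro mult_left_mono) auto
    with step[of k] show ?case by simp
  qed simp
  have "filterlim (\<lambda>k. x + real k * d) at_top sequentially" using d by real_asymp
  then have "(\<lambda>k. l (x + real k * d)) \<longlonglongrightarrow> L" by (rule filterlim_compose[OF low(2)])
  moreover have "(\<lambda>k. r ^ k * \<theta> x) \<longlonglongrightarrow> 0 * \<theta> x"
    using r by (intro tendsto_mult LIMSEQ_realpow_zero tendsto_const) auto
  moreover have "l (x + real k * d) \<le> r ^ k * \<theta> x" for k
    using low(1) geom order_trans by blast
  ultimately have "L \<le> 0 * \<theta> x" by (intro LIMSEQ_le) auto
  with low(3) show False by simp
qed

lemma nondecreasing_if_gaussian_tn: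
  assumes nn: "\<And>x. x > 0 \<Longrightarrow> F x \<ge> 0"
    and tn: "\<And>\<kappa> y. \<kappa> > 0 \<Longrightarrow> y > 0 \<Longrightarrow> tn_fun (\<lambda>t. F (y * exp (- \<kappa> * t\<^sup>2)))"
    and xy: "0 < x" "x \<le> y"
  shows "F x \<le> F y"
proof (cases "x = y")
  case False
  \<comment> \<open>The Gaussian with peak \<open>y\<close> then has height \<open>x\<close> at
    \<open>-1\<close> and \<open>1\<close>, and the minor compares \<open>F x\<close> with
    \<open>F y\<close>.\<close>
  define \<kappa> where "\<kappa> = ln (y / x)"
  have \<kappa>: "\<kappa> > 0" using xy False by (simp add: \<kappa>_def)
  let ?f = "\<lambda>t. y * exp (- \<kappa> * t\<^sup>2)"
  have "tn_fun (\<lambda>t. F (?f t))" using \<kappa> xy by (intro tn) auto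
  from tn_fun_minor_2[OF this, of "-1" 0 1]
  have "F (?f (-1)) * F (?f 1) \<le> F (?f 0) * F (?f 0)" by simp
  moreover have "y * exp (- \<kappa>) = x" using xy by (simp add: \<kappa>_def exp_minus)
  ultimately have "(F x)\<^sup>2 \<le> (F y)\<^sup>2" by (simp add: power2_eq_square)
  then show ?thesis using nn[of y] xy by (auto intro: power2_le_imp_le)
qed simp

text \<open>The common consequence of all preservation hypotheses of the theorem, once positivity is
  known; test functions are continuous, so measurability is automatic.\<close>

locale tp_to_tn =
  fixes F :: "real \<Rightarrow> real"
  assumes pos: "x > 0 \<Longrightarrow> F x > 0"
    and pres: "tp_fun f \<Longrightarrow> continuous_on UNIV f \<Longrightarrow> tn_fun (\<lambda>x. F (f x))"
begin

lemma mono: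
  assumes "0 < x" "x \<le> y"
  shows "F x \<le> F y"
proof (rule nondecreasing_if_gaussian_tn[OF _ _ assms])
  show "tn_fun (\<lambda>t. F (y * exp (- \<kappa> * t\<^sup>2)))" if "\<kappa> > 0" "y > 0" for \<kappa> y
    using that by (intro pres tp_fun_smult tp_fun_gaussian continuous_intros) auto
qed (use pos in \<open>auto intro: less_imp_le\<close>)

definition g where "g t = ln (F (exp t))"

lemma exp_g: "exp (g t) = F (exp t)"
  using pos by (simp add: g_def)

lemma g_mono: "s \<le> t \<Longrightarrow> g s \<le> g t"
  unfolding g_def using pos mono by (subst ln_le_cancel_iff) auto

lemma g_mid_eps:
  assumes "\<epsilon> > 0"
  shows "g p + g q \<le> 2 * g ((p + q) / 2 + \<epsilon>)"
proof -
  define m \<nu> where "m = (p + q) / 2" and "\<nu> = (q - p) / 2"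
  \<comment> \<open>The logarithm of \<open>?f\<close> is \<open>p\<close>,
    \<open>m + \<epsilon>\<close>, \<open>q\<close> at \<open>-1\<close>, \<open>0\<close>,
    \<open>1\<close>; the curvature of a Gaussian forces the slack \<epsilon>.\<close>
  let ?f = "\<lambda>t. exp (m + \<epsilon>) * (exp (\<nu> * t) * exp (- \<epsilon> * t\<^sup>2))"
  have "tn_fun (\<lambda>t. F (?f t))"
    using assms by (intro pres tp_fun_smult tp_fun_tilt tp_fun_gaussian continuous_intros) auto
  from tn_fun_minor_2[OF this, of "-1" 0 1]
  have "F (?f (-1)) * F (?f 1) \<le> F (?f 0) * F (?f 0)" by simp
  moreover have "?f (-1) = exp p" "?f 1 = exp q"
    by (simp_all add: exp_add[symmetric] m_def \<nu>_def field_simps)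
  ultimately have "exp (g p + g q) \<le> exp (2 * g (m + \<epsilon>))"
    by (simp add: exp_add exp_g exp_double power2_eq_square)
  then show ?thesis by (simp add: m_def)
qed

text \<open>With slack \<open>\<delta> / 2\<close>, near-midpoint concavity bounds the increment
  over the last \<delta> by the one over the preceding \<open>2 * \<delta>\<close>. Iterating with
  doubled lengths gives \<open>n\<close> adjacent intervals of total length
  \<open>(2 ^ n - 1) * \<delta>\<close>.\<close>

lemma g_increment_iterate:
  assumes "\<delta> > 0"
  shows "real n * (g t - g (t - \<delta>)) \<le> g t - g (t - (2 ^ n - 1) * \<delta>)"
  using assms
proof (induction n arbitrary: t \<delta>)
  case (Suc n)
  have "g (t - 3 * \<delta>) + g t \<le> 2 * g ((t - 3 * \<delta> + t) / 2 + \<delta> / 2)"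
    by (rule g_mid_eps) (use Suc.prems in simp)
  moreover have eq: "(t - 3 * \<delta> + t) / 2 + \<delta> / 2 = t - \<delta>" "t - \<delta> - 2 * \<delta> = t - 3 * \<delta>"
    by (simp_all add: field_simps)
  ultimately have "g t - g (t - \<delta>) \<le> g (t - \<delta>) - g (t - \<delta> - 2 * \<delta>)"
    unfolding eq by linarith
  then have "real n * (g t - g (t - \<delta>)) \<le> real n * (g (t - \<delta>) - g (t - \<delta> - 2 * \<delta>))"
    by (intro mult_left_mono) auto
  also have "\<dots> \<le> g (t - \<delta>) - g (t - \<delta> - (2 ^ n - 1) * (2 * \<delta>))"
    by (rule Suc.IH) (use Suc.prems in simp)
  also have "t - \<delta> - (2 ^ n - 1) * (2 * \<delta>) = t - (2 ^ Suc n - 1) * \<delta>"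
    by (simp add: algebra_simps)
  finally show ?case by (simp add: algebra_simps)
qed simp

text \<open>An increment over a length below \<open>1 / 2 ^ n\<close> would be matched
  \<open>n\<close> times inside a window on which the monotone \<open>g\<close> has bounded total
  increment.\<close>

lemma g_continuous: "isCont g t"
  unfolding continuous_at_eps_delta
proof (intro allI impI)
  fix e :: real assume e: "0 < e"
  define R where "R = g (t + 1) - g (t - 2)"
  obtain n where n: "R < real n * e"
    using reals_Archimedean3[OF e] by blast
  have R: "R \<ge> 0" unfolding R_def using g_mono[of "t - 2" "t + 1"] by simp
  have n0: "n > 0" using n R e by (cases n) auto
  have inc: "g v - g u < e" if "u < v" "v - u < 1 / 2 ^ n" "v \<le> t + 1" "t - 1 \<le> v" for u v
  proof -
    have "real n * (g v - g (v - (v - u))) \<le> g v - g (v - (2 ^ n - 1) * (v - u))"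
      by (rule g_increment_iterate) (use that in simp)
    moreover have "(2 ^ n - 1) * (v - u) \<le> 1"
    proof -
      have "(2 ^ n - 1) * (v - u) \<le> 2 ^ n * (v - u)" using that by (intro mult_right_mono) auto
      also have "\<dots> \<le> 1" using that by (simp add: field_simps)
      finally show ?thesis .
    qed
    then have "g (t - 2) \<le> g (v - (2 ^ n - 1) * (v - u))" using that by (intro g_mono) auto
    moreover have "g v \<le> g (t + 1)" using that by (intro g_mono) auto
    ultimately have "real n * (g v - g u) < real n * e" using n by (simp add: R_def)
    then show ?thesis using n0 by simp
  qed
  show "\<exists>d>0. \<forall>s. dist s t < d \<longrightarrow> dist (g s) (g t) < e"
  proof (intro exI conjI allI impI)
    show "0 < (1 / 2 ^ n :: real)" by simp
    fix s assume "dist s t < 1 / 2 ^ n"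
    then have d: "\<bar>s - t\<bar> < 1 / 2 ^ n" by (simp add: dist_real_def)
    have "(1 / 2 ^ n :: real) \<le> 1" by simp
    then have s1: "\<bar>s - t\<bar> < 1" using d by linarith
    show "dist (g s) (g t) < e"
    proof (cases s t rule: linorder_cases)
      case less
      then show ?thesis using inc[of s t] g_mono[of s t] d s1 by (simp add: dist_real_def)
    next
      case greater
      then show ?thesis using inc[of t s] g_mono[of t s] d s1 by (simp add: dist_real_def)
    qed (use e in simp)
  qed
qed

lemma g_midpoint: "g p + g q \<le> 2 * g ((p + q) / 2)"
proof -
  have "((\<lambda>\<epsilon>. 2 * g ((p + q) / 2 + \<epsilon>)) \<longlongrightarrow> 2 * g ((p + q) / 2 + 0)) (at_right 0)"
    by (intro tendsto_intros isCont_tendsto_compose[OF g_continuous])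
  moreover have "\<forall>\<^sub>F \<epsilon> in at_right 0. g p + g q \<le> 2 * g ((p + q) / 2 + \<epsilon>)"
    using eventually_at_right_less by eventually_elim (rule g_mid_eps)
  ultimately show ?thesis by (intro tendsto_lowerbound[where F = "at_right (0::real)"]) auto
qed

lemma g_concave: "convex_on UNIV (\<lambda>t. - g t)"
proof (rule convex_on_by_chords)
  fix a b x :: real assume ab: "a < b" and x: "x \<in> {a..b}"
  show "- g x \<le> - g a + (- g b - - g a) / (b - a) * (x - a)"
  proof (rule below_chord[OF ab _ _ x])
    show "continuous_on {a..b} (\<lambda>t. - g t)"
      by (intro continuous_intros continuous_at_imp_continuous_on ballI g_continuous)
    fix m \<epsilon> :: real assume m: "a < m" "m < b" and \<epsilon>: "0 < \<epsilon>"
    define u where "u = min (m - a) (b - m)"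
    have "u > 0" using m by (simp add: u_def)
    moreover have "g (m - u) + g (m + u) \<le> 2 * g m" using g_midpoint[of "m - u" "m + u"] by simp
    ultimately show "\<exists>s\<in>{a..b}. \<exists>z\<in>{a..b}. s \<noteq> z \<and> 2 * - g m \<le> - g s + - g z \<and> \<bar>s + z - 2 * m\<bar> \<le> \<epsilon> * (s - z)\<^sup>2"
      using m \<epsilon> by (intro bexI[of _ "m - u"] bexI[of _ "m + u"]) (auto simp: u_def)
  qed
qed simp

text \<open>A supporting line of the concave \<open>g\<close> at \<open>ln s\<close>, read back as a
  power function touching \<open>F\<close> from above.\<close>

lemma upper_tangent:
  assumes "s > 0"
  obtains \<gamma> where "\<And>\<tau>. F (s * exp \<tau>) \<le> F s * exp (\<gamma> * \<tau>)"
proof -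
  obtain D where D: "\<And>y. y \<in> UNIV \<Longrightarrow> - g (ln s) + D * (y - ln s) \<le> - g y"
    using convex_on_subgradient[OF g_concave] by auto
  have "F (s * exp \<tau>) \<le> F s * exp (- D * \<tau>)" for \<tau>
  proof -
    have "F (s * exp \<tau>) = exp (g (ln s + \<tau>))" using assms by (simp add: exp_g exp_add)
    also have "\<dots> \<le> exp (g (ln s) + - D * \<tau>)" using D[of "ln s + \<tau>"] by simp
    also have "\<dots> = exp (g (ln s)) * exp (- D * \<tau>)" by (rule exp_add)
    also have "exp (g (ln s)) = F s" using assms by (simp add: exp_g)
    finally show ?thesis .
  qed
  then show thesis by (rule that)
qed

lemma isCont_F:
  assumes "x > 0"
  shows "isCont F x"
proof -
  have "isCont (\<lambda>x. exp (g (ln x))) x"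
    using assms by (intro isCont_exp' isCont_o2[OF _ g_continuous] isCont_ln) auto
  moreover have "\<forall>\<^sub>F y in nhds x. exp (g (ln y)) = F y"
    by (rule eventually_mono[OF eventually_nhds_in_open[of "{0<..}" x]]) (use assms in \<open>auto simp: exp_g\<close>)
  ultimately show ?thesis by (subst (asm) isCont_cong)
qed

lemma continuous_F: "continuous_on {0<..} F"
  by (rule continuous_at_imp_continuous_on) (auto intro: isCont_F)

text \<open>To the right, the supporting power at \<open>q\<close> has exponent at most 0 and
  monotonicity does the rest. To the left, concavity still permits growth, so a minor of size three
  is used.\<close>

lemma constant_if_not_strict:
  assumes pq: "0 < p" "p < q" "F p = F q" and x: "x > 0"
  shows "F x = F q"
proof -
  obtain \<gamma> where \<gamma>: "\<And>\<tau>. F (q * exp \<tau>) \<le> F q * exp (\<gamma> * \<tau>)"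
    using upper_tangent[of q] pq by auto
  have "F q \<le> F q * exp (\<gamma> * ln (p / q))" using \<gamma>[of "ln (p / q)"] pq by simp
  then have "0 \<le> \<gamma> * ln (p / q)" using pos[of q] pq by simp
  moreover have "ln (p / q) < 0" using pq by simp
  ultimately have "\<gamma> \<le> 0" by (simp add: zero_le_mult_iff)
  have above: "F y = F q" if "y \<ge> q" for y
  proof (rule antisym)
    have "F y \<le> F q * exp (\<gamma> * ln (y / q))" using \<gamma>[of "ln (y / q)"] pq that by simp
    also have "\<dots> \<le> F q * exp 0"
      using \<open>\<gamma> \<le> 0\<close> pq that pos[of q] by (intro mult_left_mono) (auto simp: mult_nonpos_nonneg)
    finally show "F y \<le> F q" by simp
  qed (use mono pq that in auto)
  have below: "F x = F q" if xq: "x < q"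
  proof (rule ccontr)
    assume ne: "F x \<noteq> F q"
    then have lt: "F x < F q" using mono[of x q] x xq by simp
    \<comment> \<open>Chosen so that \<open>?f\<close> exceeds \<open>q\<close> at \<open>0\<close>,
      equals \<open>q\<close> at distance 1 and \<open>x\<close> at distance 2; the matrix then has
      \<open>F q\<close> everywhere except \<open>F x\<close> in two corners.\<close>
    define \<kappa> where "\<kappa> = ln (q / x) / 3"
    have \<kappa>: "\<kappa> > 0" using x xq by (simp add: \<kappa>_def)
    let ?f = "\<lambda>t. q * exp \<kappa> * exp (- \<kappa> * t\<^sup>2)"
    have tn: "tn_fun (\<lambda>t. F (?f t))"
      using pq \<kappa> by (intro pres tp_fun_smult tp_fun_gaussian continuous_intros) auto
    have "strict_mono_on {..<3} real" by (simp add: strict_mono_on_def)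
    from tn_funD[OF tn this this]
    have "0 \<le> mdet 3 (\<lambda>i j. F (?f (real i - real j)))" .
    moreover have "q * (exp \<kappa> * exp (- (\<kappa> * 4))) = x"
    proof -
      have "exp \<kappa> * exp (- (\<kappa> * 4)) = exp (- ln (q / x))" by (simp add: exp_add[symmetric] \<kappa>_def)
      then show ?thesis using x xq by (simp add: exp_minus)
    qed
    moreover have "F (q * exp \<kappa>) = F q" using pq \<kappa> by (intro above) simp
    moreover have "q * (exp \<kappa> * exp (- \<kappa>)) = q" by (simp add: exp_add[symmetric])
    ultimately have "0 \<le> F q * (F q * F q - F q * F q) - F q * (F q * F q - F q * F x) + F x * (F q * F q - F q * F x)"
      by (simp add: mdet_3 mult.assoc)
    also have "\<dots> = - F q * (F q - F x)\<^sup>2" by (simp add: power2_eq_square algebra_simps)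
    also have "\<dots> < 0" using pos[of q] pq lt by (simp add: mult_neg_pos)
    finally show False by simp
  qed
  show ?thesis
  proof (cases "x < q")
    case False
    then show ?thesis by (intro above) simp
  qed (rule below)
qed


end

subsection \<open>Convexity and concavity\<close>

text \<open>Here \<open>q v\<close> is nearly the midpoint of \<open>1\<close> and
  \<open>w v\<close>, with an error small against the squared gap. Taking \<open>s = m / q v\<close>
  places the middle point exactly at \<open>m\<close>, as \<open>below_chord\<close> asks.\<close>

lemma below_chord_rescaled:
  fixes \<phi> q w :: "real \<Rightarrow> real"
  assumes ab: "0 < a" "a < b" and cont: "continuous_on {a..b} \<phi>" and x: "x \<in> {a..b}"
    and q: "(q \<longlongrightarrow> 1) (at_right 0)" "\<forall>\<^sub>F v in at_right 0. q v \<le> 1"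
    and w: "(w \<longlongrightarrow> 1) (at_right 0)" "\<forall>\<^sub>F v in at_right 0. w v < 1"
    and qw: "((\<lambda>v. (1 + w v - 2 * q v) / (1 - w v)\<^sup>2) \<longlongrightarrow> 0) (at_right 0)"
    and \<phi>: "\<And>s v. s > 0 \<Longrightarrow> v > 0 \<Longrightarrow> 2 * \<phi> (s * q v) \<le> \<phi> s + \<phi> (s * w v)"
  shows "\<phi> x \<le> \<phi> a + (\<phi> b - \<phi> a) / (b - a) * (x - a)"
proof (rule below_chord[OF ab(2) cont _ x])
  fix m \<epsilon> :: real assume m: "a < m" "m < b" and \<epsilon>: "0 < \<epsilon>"
  have m0: "m > 0" using m ab by simp
  have lim: "((\<lambda>v. m / q v) \<longlongrightarrow> m / 1) (at_right 0)" "((\<lambda>v. m / q v * w v) \<longlongrightarrow> m / 1 * 1) (at_right 0)"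
    by (intro tendsto_intros q w; simp)+
  have "\<forall>\<^sub>F v in at_right 0. 0 < v \<and> 0 < q v \<and> q v \<le> 1 \<and> w v < 1 \<and>
      a < m / q v \<and> m / q v < b \<and> a < m / q v * w v \<and> m / q v * w v < b \<and>
      \<bar>(1 + w v - 2 * q v) / (1 - w v)\<^sup>2\<bar> < \<epsilon> * m"
  proof (intro eventually_conj)
    show "\<forall>\<^sub>F v in at_right 0. \<bar>(1 + w v - 2 * q v) / (1 - w v)\<^sup>2\<bar> < \<epsilon> * m"
      using order_tendstoD(2)[OF tendsto_rabs[OF qw], of "\<epsilon> * m"] \<epsilon> m0 by simp
    show "\<forall>\<^sub>F v in at_right 0. 0 < q v" using order_tendstoD(1)[OF q(1)] by simp
  qed (use q(2) w(2) m order_tendstoD(1)[OF lim(1), of a] order_tendstoD(2)[OF lim(1), of b]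
      order_tendstoD(1)[OF lim(2), of a] order_tendstoD(2)[OF lim(2), of b] in
      \<open>auto simp: eventually_at_right_less\<close>)
  then obtain v where v: "0 < v" "0 < q v" "q v \<le> 1" "w v < 1" "a < m / q v" "m / q v < b"
      "a < m / q v * w v" "m / q v * w v < b" "\<bar>(1 + w v - 2 * q v) / (1 - w v)\<^sup>2\<bar> < \<epsilon> * m"
    using eventually_happens[of _ "at_right (0::real)"] by force
  define s where "s = m / q v"
  have s: "s > 0" "m \<le> s" "s * q v = m" using v m0 by (auto simp: s_def field_simps)
  have d: "0 < 1 - w v" using v by simp
  show "\<exists>s\<in>{a..b}. \<exists>z\<in>{a..b}. s \<noteq> z \<and> 2 * \<phi> m \<le> \<phi> s + \<phi> z \<and> \<bar>s + z - 2 * m\<bar> \<le> \<epsilon> * (s - z)\<^sup>2"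
  proof (rule bexI[of _ s], rule bexI[of _ "s * w v"], intro conjI)
    show "s \<noteq> s * w v" using v s by simp
    show "2 * \<phi> m \<le> \<phi> s + \<phi> (s * w v)" using \<phi>[OF s(1) v(1)] s(3) by simp
    have "s + s * w v - 2 * m = s * ((1 + w v - 2 * q v) / (1 - w v)\<^sup>2 * (1 - w v)\<^sup>2)"
    proof -
      have "(1 + w v - 2 * q v) / (1 - w v)\<^sup>2 * (1 - w v)\<^sup>2 = 1 + w v - 2 * q v"
        using d by simp
      moreover have "s + s * w v - 2 * m = s * (1 + w v - 2 * q v)"
        using s(3) by (simp add: algebra_simps)
      ultimately show ?thesis by simp
    qed
    then have "\<bar>s + s * w v - 2 * m\<bar> = s * \<bar>(1 + w v - 2 * q v) / (1 - w v)\<^sup>2\<bar> * (1 - w v)\<^sup>2"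
      using s(1) by (simp add: abs_mult)
    also have "\<dots> \<le> s * (\<epsilon> * s) * (1 - w v)\<^sup>2"
    proof -
      have "\<epsilon> * m \<le> \<epsilon> * s" using s(2) \<epsilon> by simp
      then show ?thesis using v(9) s(1) by (intro mult_right_mono mult_left_mono) auto
    qed
    also have "\<dots> = \<epsilon> * (s - s * w v)\<^sup>2" by (simp add: power2_eq_square algebra_simps)
    finally show "\<bar>s + s * w v - 2 * m\<bar> \<le> \<epsilon> * (s - s * w v)\<^sup>2" .
  qed (use v in \<open>auto simp: s_def\<close>)
qed

lemma W1_exp:
  assumes "v \<ge> 0"
  shows "W1 v = exp (ln (1 + v / 2) - v)"
proof -
  have "exp (ln (1 + v / 2) - v) = exp (ln (1 + v / 2)) * exp (- v)"
    by (simp only: exp_add[symmetric] add_uminus_conv_diff)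
  also have "exp (ln (1 + v / 2)) = 1 + v / 2" using assms by (intro exp_ln) linarith
  finally show ?thesis by (simp only: W1_def)
qed

lemma W2_exp:
  assumes "v \<ge> 0"
  shows "W2 v = exp (2 * ln (1 + v / 2) - v)"
proof -
  have "exp (2 * ln (1 + v / 2) - v) = (exp (ln (1 + v / 2)))\<^sup>2 * exp (- v)"
    by (simp only: exp_double[symmetric] exp_add[symmetric] add_uminus_conv_diff)
  also have "exp (ln (1 + v / 2)) = 1 + v / 2" using assms by (intro exp_ln) linarith
  finally show ?thesis by (simp only: W2_def)
qed

lemma W1_less_1:
  assumes "v > 0"
  shows "W1 v < 1"
proof -
  have "ln (1 + v / 2) \<le> v / 2" using assms by (intro ln_add_one_self_le_self) simp
  then have "ln (1 + v / 2) - v < 0" using assms by linarith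
  then show ?thesis using assms by (simp only: W1_exp less_imp_le exp_less_one_iff)
qed

lemma W1_pos: "v \<ge> 0 \<Longrightarrow> W1 v > 0" by (simp add: W1_exp)
lemma W2_pos: "v \<ge> 0 \<Longrightarrow> W2 v > 0" by (simp add: W2_exp)

context tp_to_tn
begin

lemma exponent_pos:
  assumes strict: "\<And>x y. 0 < x \<Longrightarrow> x < y \<Longrightarrow> F x < F y"
    and s: "s > 0" and \<gamma>: "\<And>\<tau>. F (s * exp \<tau>) \<le> F s * exp (\<gamma> * \<tau>)"
  shows "\<gamma> > 0"
proof -
  have "F s < F (s * exp 1)" using s by (intro strict) auto
  also have "\<dots> \<le> F s * exp \<gamma>" using \<gamma>[of 1] by simp
  finally show ?thesis using pos[OF s] by simp
qed

text \<open>In \<open>v = exp (- x)\<close>, \<theta> is \<open>(F s - F (s * W1 v)) / v\<close>.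
  Its minors of size two come from those of size three of \<phi>, and the power bound keeps it away
  from 0 at infinity, so it is nondecreasing in \<open>x\<close>; comparing \<open>v\<close> with
  \<open>v / 2\<close> gives the claim.\<close>

lemma second_difference_W1:
  assumes strict: "\<And>x y. 0 < x \<Longrightarrow> x < y \<Longrightarrow> F x < F y" and s: "s > 0" and v: "v > 0"
  shows "2 * F (s * W1 (v / 2)) \<le> F s + F (s * W1 v)"
proof -
  define \<phi> where "\<phi> x = F (s * W1 (exp (- x)))" for x
  define \<theta> where "\<theta> x = exp (1 * x) * (F s - \<phi> x)" for x
  obtain \<gamma> where \<gamma>: "\<And>\<tau>. F (s * exp \<tau>) \<le> F s * exp (\<gamma> * \<tau>)" using upper_tangent[OF s] by auto
  have \<gamma>0: "\<gamma> > 0" using strict s \<gamma> by (rule exponent_pos)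
  have "tn_fun \<phi>"
    unfolding \<phi>_def by (intro pres tp_fun_smult tp_fun_W1 s) (auto simp: W1_def intro!: continuous_intros)
  then have "minors_nonneg (Suc 2) \<phi>" by (rule tn_fun_imp_minors_nonneg)
  moreover have "(\<phi> \<longlongrightarrow> F s) at_top"
    unfolding \<phi>_def
  proof (rule isCont_tendsto_compose[OF isCont_F[OF s]])
    show "((\<lambda>x. s * W1 (exp (- x))) \<longlongrightarrow> s) at_top" unfolding W1_def by real_asymp
  qed
  ultimately have "minors_nonneg 2 \<theta>"
    unfolding \<theta>_def by (intro minors_nonneg_tilt minors_nonneg_limit pos s)
  have \<theta>_pos: "\<theta> x > 0" for x
    unfolding \<theta>_def \<phi>_def using s W1_pos[of "exp (- x)"] W1_less_1[of "exp (- x)"]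
    by (intro mult_pos_pos) (auto intro!: strict)
  define l where "l x = exp x * (F s - F s * exp (\<gamma> * (ln (1 + exp (- x) / 2) - exp (- x))))" for x
  have l_le: "l x \<le> \<theta> x" for x
    using \<gamma>[of "ln (1 + exp (- x) / 2) - exp (- x)"] by (simp add: l_def \<theta>_def \<phi>_def W1_exp)
  have "(l \<longlongrightarrow> F s * \<gamma> / 2) at_top"
    unfolding l_def by real_asymp
  then have "\<theta> (- ln v) \<le> \<theta> (- ln v + ln 2)"
    using \<gamma>0 pos[OF s]
    by (intro minor_2_nondecreasing[where l = l and L = "F s * \<gamma> / 2",
        OF \<theta>_pos minors_nonneg_2[OF \<open>minors_nonneg 2 \<theta>\<close>] l_le]) auto
  moreover have "\<theta> (- ln v) = (F s - F (s * W1 v)) / v"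
    using v by (simp add: \<theta>_def \<phi>_def exp_minus field_simps)
  moreover have "\<theta> (- ln v + ln 2) = 2 * (F s - F (s * W1 (v / 2))) / v"
    using v by (simp add: \<theta>_def \<phi>_def exp_minus exp_add exp_diff field_simps)
  ultimately show ?thesis using v by (simp add: divide_right_mono field_simps)
qed

text \<open>As \<open>W1\<close> lacks the term \<open>v^2\<close>, \<open>W1 (v / 2)\<close> is the
  midpoint of \<open>1\<close> and \<open>W1 v\<close> up to order \<open>v^3\<close>, against a
  squared gap of order \<open>v^2\<close>.\<close>

lemma F_below_chord:
  assumes strict: "\<And>x y. 0 < x \<Longrightarrow> x < y \<Longrightarrow> F x < F y" and ab: "0 < a" "a < b" "x \<in> {a..b}"
  shows "F x \<le> F a + (F b - F a) / (b - a) * (x - a)"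
proof (rule below_chord_rescaled[OF ab(1,2) _ ab(3)])
  show "continuous_on {a..b} F" using ab by (intro continuous_on_subset[OF continuous_F]) auto
  show "((\<lambda>v. W1 (v / 2)) \<longlongrightarrow> 1) (at_right 0)" unfolding W1_def by real_asymp
  show "(W1 \<longlongrightarrow> 1) (at_right 0)" unfolding W1_def by real_asymp
  show "\<forall>\<^sub>F v in at_right 0. W1 (v / 2) \<le> 1" unfolding W1_def by real_asymp
  show "\<forall>\<^sub>F v in at_right 0. W1 v < 1" unfolding W1_def by real_asymp
  show "((\<lambda>v. (1 + W1 v - 2 * W1 (v / 2)) / (1 - W1 v)\<^sup>2) \<longlongrightarrow> 0) (at_right 0)"
    unfolding W1_def by real_asymp
qed (rule second_difference_W1[OF strict])

text \<open>The power from above and the line from below meet at \<open>s\<close>; their difference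
  has a minimum there, so the slopes agree and one \<gamma> serves in both bounds.\<close>

lemma tangent:
  assumes strict: "\<And>x y. 0 < x \<Longrightarrow> x < y \<Longrightarrow> F x < F y" and s: "s > 0"
  obtains \<gamma> where "\<gamma> > 0" "\<And>\<tau>. F (s * exp \<tau>) \<le> F s * exp (\<gamma> * \<tau>)"
    "\<And>r. r > 0 \<Longrightarrow> F s + F s * \<gamma> * (r - 1) \<le> F (s * r)"
proof -
  obtain \<gamma> where \<gamma>: "\<And>\<tau>. F (s * exp \<tau>) \<le> F s * exp (\<gamma> * \<tau>)" using upper_tangent[OF s] by auto
  have \<gamma>0: "\<gamma> > 0" using strict s \<gamma> by (rule exponent_pos)
  have "convex_on {0<..} F"
    by (rule convex_on_by_chords, simp, rule F_below_chord[OF strict]) auto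
  then obtain D where D: "\<And>y. y \<in> {0<..} \<Longrightarrow> F s + D * (y - s) \<le> F y"
    using convex_on_subgradient[of "{0<..}" F s] s by auto
  define \<psi> where "\<psi> \<tau> = F s * exp (\<gamma> * \<tau>) - F s - D * (s * exp \<tau> - s)" for \<tau>
  have "\<psi> \<tau> \<ge> 0" for \<tau>
    using \<gamma>[of \<tau>] D[of "s * exp \<tau>"] s by (simp add: \<psi>_def)
  moreover have "\<psi> 0 = 0" by (simp add: \<psi>_def)
  moreover have "(\<psi> has_real_derivative (F s * \<gamma> - D * s)) (at 0)"
    unfolding \<psi>_def by (auto intro!: derivative_eq_intros)
  ultimately have "F s * \<gamma> - D * s = 0"
    by (intro DERIV_local_min[of \<psi> _ 0 1]) auto
  then have "D * s = F s * \<gamma>" by simp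
  then have "F s + F s * \<gamma> * (r - 1) \<le> F (s * r)" if "r > 0" for r
  proof -
    have "F s + D * s * (r - 1) \<le> F (s * r)" using D[of "s * r"] s that by (simp add: algebra_simps)
    with \<open>D * s = F s * \<gamma>\<close> show ?thesis by simp
  qed
  with \<gamma>0 \<gamma> show thesis by (rule that)
qed

text \<open>\<open>A1\<close> and \<open>A2\<close> are successive remainders of
  \<open>F (s * W2 v)\<close> at \<open>v = 0\<close>, divided by \<open>v^2\<close> and then by
  \<open>v\<close>. The bounds \<open>l\<close> and \<open>u\<close> agree through order
  \<open>v^3\<close> and so fix both limits. Three passages to infinity take size four to size one,
  which is the plain sign of the next remainder.\<close>

lemma upper_bound_W2:
  assumes s: "s > 0" and v: "v > 0"
    and \<gamma>: "\<gamma> > 0" "\<And>\<tau>. F (s * exp \<tau>) \<le> F s * exp (\<gamma> * \<tau>)"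
    "\<And>r. r > 0 \<Longrightarrow> F s + F s * \<gamma> * (r - 1) \<le> F (s * r)"
  shows "F (s * W2 v) \<le> F s - F s * \<gamma> * (v\<^sup>2 / 4 - v ^ 3 / 12)"
proof -
  define \<phi> where "\<phi> x = F (s * W2 (exp (- x)))" for x
  define A1 where "A1 x = exp (2 * x) * (F s - \<phi> x)" for x
  define A2 where "A2 x = exp (1 * x) * (F s * \<gamma> / 4 - A1 x)" for x
  define u where "u x = F s * exp (\<gamma> * (2 * ln (1 + exp (- x) / 2) - exp (- x)))" for x
  define l where "l x = F s + F s * \<gamma> * (W2 (exp (- x)) - 1)" for x
  have \<phi>_le: "\<phi> x \<le> u x" for x
    using \<gamma>(2)[of "2 * ln (1 + exp (- x) / 2) - exp (- x)"] by (simp add: \<phi>_def u_def W2_exp)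
  have \<phi>_ge: "l x \<le> \<phi> x" for x
    using \<gamma>(3)[of "W2 (exp (- x))"] by (simp add: \<phi>_def l_def W2_pos)
  have "tn_fun \<phi>"
    unfolding \<phi>_def by (intro pres tp_fun_smult tp_fun_W2 s) (auto simp: W2_def intro!: continuous_intros)
  then have m4: "minors_nonneg (Suc 3) \<phi>" by (rule tn_fun_imp_minors_nonneg)
  have "(\<phi> \<longlongrightarrow> F s) at_top"
    unfolding \<phi>_def
  proof (rule isCont_tendsto_compose[OF isCont_F[OF s]])
    show "((\<lambda>x. s * W2 (exp (- x))) \<longlongrightarrow> s) at_top" unfolding W2_def by real_asymp
  qed
  then have m3: "minors_nonneg (Suc 2) A1"
    using minors_nonneg_tilt[OF minors_nonneg_limit[OF m4 _ pos[OF s]], of 2]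
    by (simp add: A1_def[abs_def])
  have "(A1 \<longlongrightarrow> F s * \<gamma> / 4) at_top"
  proof (rule tendsto_sandwich)
    show "\<forall>\<^sub>F x in at_top. exp (2 * x) * (F s - u x) \<le> A1 x" using \<phi>_le by (simp add: A1_def)
    show "\<forall>\<^sub>F x in at_top. A1 x \<le> exp (2 * x) * (F s - l x)" using \<phi>_ge by (simp add: A1_def)
    show "((\<lambda>x. exp (2 * x) * (F s - u x)) \<longlongrightarrow> F s * \<gamma> / 4) at_top" unfolding u_def by real_asymp
    show "((\<lambda>x. exp (2 * x) * (F s - l x)) \<longlongrightarrow> F s * \<gamma> / 4) at_top" unfolding l_def W2_def by real_asymp
  qed
  then have m2: "minors_nonneg (Suc 1) A2"
    using minors_nonneg_tilt[OF minors_nonneg_limit[OF m3], of "F s * \<gamma> / 4" 1] pos[OF s] \<gamma>(1)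
    by (simp add: A2_def[abs_def] numeral_2_eq_2)
  have "(A2 \<longlongrightarrow> F s * \<gamma> / 12) at_top"
  proof (rule tendsto_sandwich)
    show "\<forall>\<^sub>F x in at_top. exp x * (F s * \<gamma> / 4 - exp (2 * x) * (F s - l x)) \<le> A2 x"
      using \<phi>_ge by (simp add: A1_def A2_def)
    show "\<forall>\<^sub>F x in at_top. A2 x \<le> exp x * (F s * \<gamma> / 4 - exp (2 * x) * (F s - u x))"
      using \<phi>_le by (simp add: A1_def A2_def)
    show "((\<lambda>x. exp x * (F s * \<gamma> / 4 - exp (2 * x) * (F s - l x))) \<longlongrightarrow> F s * \<gamma> / 12) at_top"
      unfolding l_def W2_def by real_asymp
    show "((\<lambda>x. exp x * (F s * \<gamma> / 4 - exp (2 * x) * (F s - u x))) \<longlongrightarrow> F s * \<gamma> / 12) at_top"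
      unfolding u_def by real_asymp
  qed
  from minors_nonneg_limit[OF m2 this]
  have "minors_nonneg (Suc 0) (\<lambda>t. F s * \<gamma> / 12 - A2 t)" using pos[OF s] \<gamma>(1) by simp
  then have "0 \<le> F s * \<gamma> / 12 - A2 (- ln v)"
    unfolding minors_nonneg_def
    using strict_mono_on_Suc_0[of "\<lambda>_. - ln v"] strict_mono_on_Suc_0[of "\<lambda>_. 0"] by force
  moreover have "A2 (- ln v) = (F s * \<gamma> / 4 - (F s - F (s * W2 v)) / v\<^sup>2) / v"
  proof -
    have "exp (- (2 * ln v)) = 1 / v\<^sup>2"
      using v by (simp add: exp_minus exp_double inverse_eq_divide)
    then show ?thesis using v by (simp add: A2_def A1_def \<phi>_def exp_minus field_simps)
  qed
  ultimately show ?thesis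
    using v by (simp add: field_simps power2_eq_square power3_eq_cube)
qed

lemma F_above_chord:
  assumes strict: "\<And>x y. 0 < x \<Longrightarrow> x < y \<Longrightarrow> F x < F y" and ab: "0 < a" "a < b" "x \<in> {a..b}"
  shows "- F x \<le> - F a + (- F b - - F a) / (b - a) * (x - a)"
proof (rule below_chord_rescaled[OF ab(1,2) _ ab(3)])
  \<comment> \<open>Half-way between \<open>1\<close> and the cubic expansion of \<open>W2\<close>.
    As \<open>W2\<close> has no \<open>v^4\<close> term, the error is of order \<open>v^5\<close>
    against a squared gap of order \<open>v^4\<close>. The \<open>max\<close> makes positivity
    evident for all \<open>v\<close>.\<close>
  let ?q = "\<lambda>v::real. max (1 / 2) (1 - v\<^sup>2 / 8 + v ^ 3 / 24)"
  show "continuous_on {a..b} (\<lambda>x. - F x)"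
    using ab by (intro continuous_intros continuous_on_subset[OF continuous_F]) auto
  have ev: "\<forall>\<^sub>F v in at_right 0. ?q v = 1 - v\<^sup>2 / 8 + v ^ 3 / (24::real)"
  proof -
    have "\<forall>\<^sub>F v in at_right 0. 1 / 2 \<le> 1 - v\<^sup>2 / 8 + v ^ 3 / (24::real)" by real_asymp
    then show ?thesis by eventually_elim simp
  qed
  show "(?q \<longlongrightarrow> 1) (at_right 0)"
    unfolding tendsto_cong[OF ev] by real_asymp
  show "(W2 \<longlongrightarrow> 1) (at_right 0)" unfolding W2_def by real_asymp
  have "\<forall>\<^sub>F v in at_right 0. 1 - v\<^sup>2 / 8 + v ^ 3 / (24::real) \<le> 1" by real_asymp
  with ev show "\<forall>\<^sub>F v in at_right 0. ?q v \<le> 1" by eventually_elim simp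
  show "\<forall>\<^sub>F v in at_right 0. W2 v < 1" unfolding W2_def by real_asymp
  have "((\<lambda>v. (1 + W2 v - 2 * (1 - v\<^sup>2 / 8 + v ^ 3 / 24)) / (1 - W2 v)\<^sup>2) \<longlongrightarrow> 0) (at_right 0)"
    unfolding W2_def by real_asymp
  moreover have "\<forall>\<^sub>F v in at_right 0. (1 + W2 v - 2 * ?q v) / (1 - W2 v)\<^sup>2 =
      (1 + W2 v - 2 * (1 - v\<^sup>2 / 8 + v ^ 3 / 24)) / (1 - W2 v)\<^sup>2"
    using ev by eventually_elim simp
  ultimately show "((\<lambda>v. (1 + W2 v - 2 * ?q v) / (1 - W2 v)\<^sup>2) \<longlongrightarrow> 0) (at_right 0)"
    by (simp only: tendsto_cong)
  fix s v :: real assume s: "s > 0" and v: "v > 0"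
  obtain \<gamma> where \<gamma>: "\<gamma> > 0" "\<And>\<tau>. F (s * exp \<tau>) \<le> F s * exp (\<gamma> * \<tau>)"
    "\<And>r. r > 0 \<Longrightarrow> F s + F s * \<gamma> * (r - 1) \<le> F (s * r)"
    using tangent[OF strict s] by blast
  have "F s + F s * \<gamma> * (?q v - 1) \<le> F (s * ?q v)" by (rule \<gamma>(3)) simp
  \<comment> \<open>At the cubic middle point the supporting line has fallen by exactly half of the
    fall in the bound for \<open>F (s * W2 v)\<close>.\<close>
  moreover have "F s * \<gamma> * (1 - v\<^sup>2 / 8 + v ^ 3 / 24 - 1) \<le> F s * \<gamma> * (?q v - 1)"
    using \<gamma>(1) pos[OF s] by (intro mult_left_mono) auto
  moreover have "F (s * W2 v) \<le> F s - F s * \<gamma> * (v\<^sup>2 / 4 - v ^ 3 / 12)"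
    by (rule upper_bound_W2[OF s v \<gamma>])
  ultimately show "2 * - F (s * ?q v) \<le> - F s + - F (s * W2 v)"
    by (simp add: algebra_simps)
qed

theorem constant_or_linear: "\<exists>c>0. (\<forall>x>0. F x = c) \<or> (\<forall>x>0. F x = c * x)"
proof (cases "\<exists>p q. 0 < p \<and> p < q \<and> F p = F q")
  case True
  then obtain p q where pq: "0 < p" "p < q" "F p = F q" by blast
  then have "0 < F q" by (intro pos) simp
  moreover have "\<forall>x>0. F x = F q" using constant_if_not_strict[OF pq] by blast
  ultimately show ?thesis by blast
next
  case False
  then have strict: "F x < F y" if "0 < x" "x < y" for x y
  proof -
    have "F x \<noteq> F y" using False that by blast
    moreover have "F x \<le> F y" using that by (intro mono) auto
    ultimately show ?thesis by simp
  qed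
  define \<beta> \<alpha> where "\<beta> = F 2 - F 1" and "\<alpha> = F 1 - \<beta>"
  have \<beta>: "\<beta> > 0" using strict[of 1 2] by (simp add: \<beta>_def)
  have aff: "F x = \<alpha> + \<beta> * x" if x: "x > 0" for x
  proof -
    \<comment> \<open>The interval contains \<open>x\<close>, \<open>1\<close> and \<open>2\<close>,
      so that one line passes through all three.\<close>
    define a b k where "a = min x 1" and "b = max x 2" and "k = (F b - F a) / (b - a)"
    have ab: "0 < a" "a < b" using x by (auto simp: a_def b_def)
    have line: "F y = F a + k * (y - a)" if "y \<in> {a..b}" for y
    proof -
      have "(- F b - - F a) / (b - a) = - k" unfolding k_def by (simp add: minus_divide_left)
      then show ?thesis
        using F_below_chord[OF strict ab that] F_above_chord[OF strict ab that]
        by (simp flip: k_def)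
    qed
    have "F x = F a + k * (x - a)" "F 1 = F a + k * (1 - a)" "F 2 = F a + k * (2 - a)"
      by (rule line, simp add: a_def b_def)+
    then have "\<beta> = k" "\<alpha> = F a - k * a" by (simp_all add: \<alpha>_def \<beta>_def algebra_simps)
    with \<open>F x = F a + k * (x - a)\<close> show ?thesis by (simp add: algebra_simps)
  qed
  have "\<alpha> \<ge> 0"
  proof (rule ccontr)
    assume "\<not> \<alpha> \<ge> 0"
    then have neg: "\<alpha> < 0" by simp
    then have p: "0 < - \<alpha> / (2 * \<beta>)" using \<beta> by (intro divide_pos_pos) auto
    have "F (- \<alpha> / (2 * \<beta>)) = \<alpha> / 2" using aff[OF p] \<beta> by (simp add: field_simps)
    with pos[OF p] neg show False by simp
  qed
  moreover have "\<alpha> \<le> 0"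
  proof -
    \<comment> \<open>Logarithmic concavity at 1, 2, 4 reads \<open>F 1 * F 4 \<le> (F 2)^2\<close>,
      that is \<open>\<alpha> * \<beta> \<le> 0\<close>.\<close>
    have "g 0 + g (2 * ln 2) \<le> 2 * g (ln 2)" using g_midpoint[of 0 "2 * ln 2"] by simp
    then have "exp (g 0) * exp (g (2 * ln 2)) \<le> (exp (g (ln 2)))\<^sup>2"
      by (simp add: exp_add[symmetric] exp_double[symmetric])
    then have "(\<alpha> + \<beta>) * (\<alpha> + \<beta> * 4) \<le> (\<alpha> + \<beta> * 2)\<^sup>2"
      by (simp add: exp_g exp_double aff)
    then have "\<beta> * \<alpha> \<le> 0" by (simp add: power2_eq_square algebra_simps)
    then show ?thesis using \<beta> by (simp add: mult_le_0_iff)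
  qed
  ultimately have "\<alpha> = 0" by simp
  then show ?thesis using aff \<beta> by (intro exI[of _ \<beta>]) simp
qed

end

subsection \<open>Kernels and the classification\<close>

lemma mdet_first_row:
  assumes "\<And>j. j < n \<Longrightarrow> A 0 (Suc j) = 0"
  shows "mdet (Suc n) A = A 0 0 * mdet n (\<lambda>i j. A (Suc i) (Suc j))"
proof -
  have "mdet (Suc n) A = (\<Sum>j\<in>{0}. A 0 j * ((-1) ^ (0 + j) *
      mdet n (\<lambda>i' j'. A (insert_index 0 i') (insert_index j j'))))"
    unfolding mdet_expand_row[OF zero_less_Suc]
  proof (rule sum.mono_neutral_right)
    show "\<forall>j\<in>{..<Suc n} - {0}. A 0 j * ((-1) ^ (0 + j) *
        mdet n (\<lambda>i' j'. A (insert_index 0 i') (insert_index j j'))) = 0"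
      using assms by (auto simp: gr0_conv_Suc)
  qed auto
  then show ?thesis by simp
qed

lemma mdet_first_col:
  assumes "\<And>i. i < n \<Longrightarrow> A (Suc i) 0 = 0"
  shows "mdet (Suc n) A = A 0 0 * mdet n (\<lambda>i j. A (Suc i) (Suc j))"
proof -
  have "mdet (Suc n) (\<lambda>i j. A j i) = A 0 0 * mdet n (\<lambda>i j. A (Suc j) (Suc i))"
    by (rule mdet_first_row) (rule assms)
  then show ?thesis
    unfolding mdet_transpose[of "Suc n" A] mdet_transpose[of n "\<lambda>i j. A (Suc i) (Suc j)"] .
qed

lemma strict_mono_on_shift: "strict_mono_on {..<Suc n} x \<Longrightarrow> strict_mono_on {..<n} (\<lambda>i. x (Suc i))"
  by (auto simp: strict_mono_on_def)

text \<open>Either the first two columns consist of ones, or the first row vanishes beyond its first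
  entry and the minor reduces to a smaller one.\<close>

lemma tn_fun_indicator_up:
  assumes up: "\<And>x y. x \<in> I \<Longrightarrow> x \<le> y \<Longrightarrow> y \<in> I"
  shows "tn_fun (\<lambda>x. if x \<in> I then 1 else 0)" (is "tn_fun ?f")
  unfolding tn_fun_def
proof (intro allI impI)
  fix n and x y :: "nat \<Rightarrow> real"
  assume "strict_mono_on {..<n} x" "strict_mono_on {..<n} y"
  then show "0 \<le> mdet n (\<lambda>i j. ?f (x i - y j))"
  proof (induction n arbitrary: x y)
    case (Suc n)
    have x: "x 0 \<le> x i" if "i < Suc n" for i
      using strict_mono_onD[OF Suc.prems(1), of 0 i] that by (cases "i = 0") auto
    have y: "y 1 \<le> y (Suc j)" if "j < n" for j
      using strict_mono_onD[OF Suc.prems(2), of 1 "Suc j"] that by (cases "j = 0") auto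
    show ?case
    proof (cases "0 < n \<and> x 0 - y 1 \<in> I")
      case True
      have y01: "y 0 < y 1" using strict_mono_onD[OF Suc.prems(2), of 0 1] True by simp
      have "x i - y 0 \<in> I" "x i - y 1 \<in> I" if "i < Suc n" for i
        using up[of "x 0 - y 1"] True x[OF that] y01 by auto
      then have "mdet (Suc n) (\<lambda>i j. ?f (x i - y j)) = 0"
        by (intro mdet_eq_cols[of 0 _ 1]) (use True in auto)
      then show ?thesis by simp
    next
      case False
      have "?f (x 0 - y (Suc j)) = 0" if "j < n" for j
        using up[of "x 0 - y (Suc j)" "x 0 - y 1"] False y[OF that] that by auto
      then have "mdet (Suc n) (\<lambda>i j. ?f (x i - y j)) =
          ?f (x 0 - y 0) * mdet n (\<lambda>i j. ?f (x (Suc i) - y (Suc j)))"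
        by (rule mdet_first_row)
      also have "\<dots> \<ge> 0"
        using Suc.IH[OF Suc.prems[THEN strict_mono_on_shift]] by simp
      finally show ?thesis .
    qed
  qed simp
qed

lemma tn_fun_reflect:
  assumes "tn_fun f"
  shows "tn_fun (\<lambda>x. f (- x))"
  unfolding tn_fun_def
proof (intro allI impI)
  fix n and x y :: "nat \<Rightarrow> real"
  assume "strict_mono_on {..<n} x" "strict_mono_on {..<n} y"
  then have "0 \<le> mdet n (\<lambda>j i. f (y j - x i))" by (intro tn_funD[OF assms])
  also have "\<dots> = mdet n (\<lambda>i j. f (y j - x i))" by (rule mdet_transpose[symmetric])
  finally show "0 \<le> mdet n (\<lambda>i j. f (- (x i - y j)))" by simp
qed

lemma tn_fun_indicator_down:
  assumes down: "\<And>x y. x \<in> I \<Longrightarrow> y \<le> x \<Longrightarrow> y \<in> I"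
  shows "tn_fun (\<lambda>x. if x \<in> I then 1 else 0)"
proof -
  have "tn_fun (\<lambda>x. if x \<in> {x. - x \<in> I} then 1 else 0)"
    by (rule tn_fun_indicator_up) (use down in simp)
  from tn_fun_reflect[OF this] show ?thesis by simp
qed

text \<open>According to whether \<open>x 0 - y 0\<close> exceeds \<open>a\<close>, the first column
  or the first row vanishes beyond the corner.\<close>

lemma tn_fun_indicator_point: "tn_fun (\<lambda>x. if x = a then 1 else 0)" (is "tn_fun ?f")
  unfolding tn_fun_def
proof (intro allI impI)
  fix n and x y :: "nat \<Rightarrow> real"
  assume "strict_mono_on {..<n} x" "strict_mono_on {..<n} y"
  then show "0 \<le> mdet n (\<lambda>i j. ?f (x i - y j))"
  proof (induction n arbitrary: x y)
    case (Suc n)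
    have x: "x 0 < x (Suc i)" if "i < n" for i
      using strict_mono_onD[OF Suc.prems(1), of 0 "Suc i"] that by auto
    have y: "y 0 < y (Suc j)" if "j < n" for j
      using strict_mono_onD[OF Suc.prems(2), of 0 "Suc j"] that by auto
    have "mdet (Suc n) (\<lambda>i j. ?f (x i - y j)) =
        ?f (x 0 - y 0) * mdet n (\<lambda>i j. ?f (x (Suc i) - y (Suc j)))"
    proof (cases "x 0 - y 0 \<le> a")
      case True
      show ?thesis by (rule mdet_first_row) (use y True in force)
    next
      case False
      show ?thesis by (rule mdet_first_col) (use x False in force)
    qed
    also have "\<dots> \<ge> 0"
      using Suc.IH[OF Suc.prems[THEN strict_mono_on_shift]] by simp
    finally show ?case .
  qed simp
qed

text \<open>The support is convex; if it is closed neither upwards nor downwards it is bounded, and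
  then a single point by \<open>tn_fun_bounded_support\<close>.\<close>

lemma tn_fun_support_indicator:
  assumes f: "tn_fun f"
  shows "tn_fun (\<lambda>x. if f x > 0 then 1 else 0)"
proof -
  define I where "I = {x. f x > 0}"
  have conv: "c \<in> I" if "a \<in> I" "b \<in> I" "a \<le> c" "c \<le> b" for a b c
    using tn_fun_support_convex[OF f, of a b c] that by (simp add: I_def)
  have "tn_fun (\<lambda>x. if x \<in> I then 1 else 0)"
  proof (cases "(\<forall>x y. x \<in> I \<longrightarrow> x \<le> y \<longrightarrow> y \<in> I) \<or> (\<forall>x y. x \<in> I \<longrightarrow> y \<le> x \<longrightarrow> y \<in> I)")
    case True
    then show ?thesis
    proof
      assume "\<forall>x y. x \<in> I \<longrightarrow> x \<le> y \<longrightarrow> y \<in> I"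
      then show ?thesis by (intro tn_fun_indicator_up) blast
    next
      assume "\<forall>x y. x \<in> I \<longrightarrow> y \<le> x \<longrightarrow> y \<in> I"
      then show ?thesis by (intro tn_fun_indicator_down) blast
    qed
  next
    case False
    then obtain p r q s where out: "p \<in> I" "p \<le> r" "r \<notin> I" "q \<in> I" "s \<le> q" "s \<notin> I" by blast
    have bd: "s < x" "x < r" if "x \<in> I" for x
      using conv[of p x r] conv[of x q s] that out by (meson linorder_not_le)+
    have f0: "f x = 0" if "\<bar>x\<bar> > max \<bar>r\<bar> \<bar>s\<bar>" for x
    proof -
      have "x \<notin> I" using bd[of x] that by auto
      then show ?thesis using tn_fun_nonneg[OF f, of x] by (simp add: I_def not_less)
    qed
    have two: False if "u \<in> I" "v \<in> I" "u < v" for u v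
    proof (rule tn_fun_bounded_support[OF f _ _ that(3)])
      show "f u > 0" "f v > 0" using that by (auto simp: I_def)
      show "f x = 0" if "\<bar>x\<bar> > max \<bar>r\<bar> \<bar>s\<bar>" for x using that by (rule f0)
    qed
    have "x = p" if "x \<in> I" for x
      using two[OF that out(1)] two[OF out(1) that] by (cases x p rule: linorder_cases) auto
    with out(1) have "I = {p}" by blast
    then show ?thesis using tn_fun_indicator_point[of p] by simp
  qed
  then show ?thesis by (simp add: I_def)
qed

lemma tn_fun_smult: "tn_fun f \<Longrightarrow> c \<ge> 0 \<Longrightarrow> tn_fun (\<lambda>x. c * f x)"
  unfolding tn_fun_def mdet_smult by (auto intro!: mult_nonneg_nonneg)

lemma not_tp_fun_const: "\<not> tp_fun (\<lambda>_. c)"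
proof
  assume "tp_fun (\<lambda>_. c)"
  moreover have "strict_mono_on {..<2} real" by (simp add: strict_mono_on_def)
  ultimately have "0 < mdet 2 (\<lambda>i j. c)" by (auto dest: tp_funD)
  then show False by (simp add: mdet_2)
qed

section \<open>Toeplitz kernels on the plane\<close>

definition kernel :: "(real \<Rightarrow> real) \<Rightarrow> real \<times> real \<Rightarrow> real" where
  "kernel f = (\<lambda>(x, y). f (x - y))"

lemma toeplitz_iff_kernel: "toeplitz K \<longleftrightarrow> (\<exists>f. K = kernel f)"
  by (auto simp: toeplitz_def kernel_def fun_eq_iff)

lemma toeplitz_kernel: "toeplitz (kernel f)"
  by (auto simp: toeplitz_iff_kernel)

lemma comp_kernel: "F \<circ> kernel f = kernel (\<lambda>x. F (f x))"
  by (auto simp: kernel_def)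

lemma totally_nonneg_kernel: "totally_nonneg (kernel f) \<longleftrightarrow> tn_fun f"
  by (rule totally_nonneg_iff_tn_fun) (simp add: kernel_def)

lemma totally_pos_kernel: "totally_pos (kernel f) \<longleftrightarrow> tp_fun f"
  by (rule totally_pos_iff_tp_fun) (simp add: kernel_def)

lemma measurable_kernel:
  assumes "f \<in> borel_measurable borel"
  shows "lebesgue_measurable_kernel (kernel f)"
proof -
  have "(\<lambda>p :: real \<times> real. fst p - snd p) \<in> borel_measurable borel"
    by (intro borel_measurable_continuous_onI continuous_intros)
  then have "(\<lambda>p :: real \<times> real. f (fst p - snd p)) \<in> borel_measurable lborel"
    using measurable_compose[OF _ assms] by simp
  then show ?thesis
    unfolding lebesgue_measurable_kernel_def kernel_def case_prod_unfold
    by (rule measurable_completion)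
qed

definition tn_preserver :: "(real \<Rightarrow> real) \<Rightarrow> bool" where
  "tn_preserver F \<longleftrightarrow> (\<forall>K. totally_nonneg K \<and> lebesgue_measurable_kernel K \<and> toeplitz K \<longrightarrow>
     totally_nonneg (F \<circ> K) \<and> lebesgue_measurable_kernel (F \<circ> K) \<and> toeplitz (F \<circ> K))"

lemma tn_preserverD:
  assumes "tn_preserver F" "tn_fun f" "f \<in> borel_measurable borel"
  shows "tn_fun (\<lambda>x. F (f x))"
proof -
  have "totally_nonneg (F \<circ> kernel f)"
    using assms(1) measurable_kernel[OF assms(3)] assms(2) toeplitz_kernel
    unfolding tn_preserver_def totally_nonneg_kernel[symmetric] by blast
  then show ?thesis by (simp only: comp_kernel totally_nonneg_kernel)
qed

lemma tn_preserver_classification: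
  assumes F: "F \<in> {0..} \<rightarrow> {0..}" "\<exists>x\<ge>0. F x \<noteq> 0" and pres: "tn_preserver F"
  shows "\<exists>c>0. (\<forall>x\<ge>0. F x = c) \<or> (\<forall>x\<ge>0. F x = c * x) \<or> (\<forall>x\<ge>0. F x = c * (if x > 0 then 1 else 0))"
proof -
  have nn: "F x \<ge> 0" if "x \<ge> 0" for x using F(1) that by auto
  show ?thesis
  proof (cases "F 0 = 0")
    case False
    then have F0: "F 0 > 0" using nn[of 0] by simp
    have "F a = F 0" if "a \<ge> 0" for a
    proof (rule antisym)
      \<comment> \<open>This step function is 0 at \<open>-3\<close>, \<open>-2\<close>,
        \<open>-1\<close> and \<open>a\<close> at \<open>0\<close>, so the minor reads
        \<open>F 0 * F a \<le> F 0 * F 0\<close>.\<close>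
      have "tn_fun (\<lambda>x. a * (if x \<in> {0::real..} then 1 else 0))"
        using that by (intro tn_fun_smult tn_fun_indicator_up) auto
      then have "tn_fun (\<lambda>x. F (a * (if x \<in> {0::real..} then 1 else 0)))"
        by (rule tn_preserverD[OF pres]) measurable
      from tn_fun_minor_2[OF this, of "-3" "-1" 0] show "F a \<le> F 0"
        using F0 by simp
    next
      have "tn_fun (\<lambda>x. a * (if x = 0 then 1 else 0))"
        using that by (intro tn_fun_smult tn_fun_indicator_point)
      then have "tn_fun (\<lambda>x. F (a * (if x = 0 then 1 else 0)))"
        by (rule tn_preserverD[OF pres]) measurable
      from tn_fun_minor_2[OF this, of "-1" 0 1] have "(F 0)\<^sup>2 \<le> (F a)\<^sup>2"
        by (simp add: power2_eq_square)
      then show "F 0 \<le> F a" using nn[OF that] by (rule power2_le_imp_le)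
    qed
    with F0 show ?thesis by blast
  next
    case True
    have gauss: "tn_fun (\<lambda>t. F (y * exp (- \<kappa> * t\<^sup>2)))" if "\<kappa> > 0" "y > 0" for \<kappa> y
      using that by (intro tn_preserverD[OF pres] tp_fun_imp_tn_fun tp_fun_smult tp_fun_gaussian)
        (auto intro!: borel_measurable_continuous_onI continuous_intros)
    have mono: "F x \<le> F y" if "0 < x" "x \<le> y" for x y
      using nondecreasing_if_gaussian_tn[of F x y, OF _ gauss] nn that by simp
    obtain x0 where x0: "x0 \<ge> 0" "F x0 \<noteq> 0" using F(2) by blast
    have x0_pos: "x0 > 0" "F x0 > 0"
      using x0 True nn[of x0] by (auto simp: less_le)
    have F_pos: "F t > 0" if t: "t > 0" for t
    proof (rule ccontr)
      assume "\<not> F t > 0"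
      then have Ft: "F t = 0" using nn[of t] t by simp
      \<comment> \<open>A Gaussian equal to \<open>x0\<close> at \<open>-1\<close> and
        \<open>1\<close>. By monotonicity \<open>F\<close> vanishes on positive arguments below
        \<open>t\<close>, so the composition would have bounded support with two points in
        it.\<close>
      let ?f = "\<lambda>x. x0 * exp 1 * exp (- 1 * x\<^sup>2)"
      have "tn_fun (\<lambda>x. F (?f x))" using x0_pos by (intro gauss) auto
      then show False
      proof (rule tn_fun_bounded_support)
        have eq: "?f (-1) = x0" "?f 1 = x0" by (simp_all add: mult.assoc exp_add[symmetric])
        show "F (?f (-1)) > 0" "F (?f 1) > 0" unfolding eq by (rule x0_pos)+
        show "F (?f x) = 0" if x: "\<bar>x\<bar> > max 1 (x0 * exp 1 / t)" for x
        proof -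
          have "x0 * exp 1 / t < \<bar>x\<bar>" using x by simp
          also have "\<bar>x\<bar> \<le> x\<^sup>2"
          proof -
            have "\<bar>x\<bar> * 1 \<le> \<bar>x\<bar> * \<bar>x\<bar>" using x by (intro mult_left_mono) auto
            then show ?thesis by (simp add: power2_eq_square)
          qed
          also have "x\<^sup>2 \<le> exp (x\<^sup>2)" using exp_ge_add_one_self[of "x\<^sup>2"] by linarith
          finally have "?f x < t" using t by (simp add: exp_minus field_simps)
          then have "F (?f x) \<le> F t" using x0_pos by (intro mono) auto
          then show ?thesis using Ft nn[of "?f x"] x0_pos by simp
        qed
      qed simp
    qed
    interpret tp_to_tn F
    proof
      show "tn_fun (\<lambda>x. F (f x))" if "tp_fun f" "continuous_on UNIV f" for f
        using that by (intro tn_preserverD[OF pres] tp_fun_imp_tn_fun borel_measurable_continuous_onI)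
    qed (rule F_pos)
    obtain c where c: "c > 0" "(\<forall>x>0. F x = c) \<or> (\<forall>x>0. F x = c * x)"
      using constant_or_linear by blast
    from c(2) have "(\<forall>x\<ge>0. F x = c * x) \<or> (\<forall>x\<ge>0. F x = c * (if x > 0 then 1 else 0))"
    proof
      assume "\<forall>x>0. F x = c"
      then show ?thesis using True by auto
    next
      assume lin: "\<forall>x>0. F x = c * x"
      have "F x = c * x" if "x \<ge> 0" for x
        using lin True that by (cases "x = 0") auto
      then show ?thesis by blast
    qed
    with c(1) show ?thesis by blast
  qed
qed

lemma tn_preserver_if:
  assumes c: "c > 0" and
    F: "(\<forall>x\<ge>0. F x = c) \<or> (\<forall>x\<ge>0. F x = c * x) \<or> (\<forall>x\<ge>0. F x = c * (if x > 0 then 1 else 0))"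
  shows "tn_preserver F"
  unfolding tn_preserver_def
proof (intro allI impI)
  fix K assume K: "totally_nonneg K \<and> lebesgue_measurable_kernel K \<and> toeplitz K"
  then obtain f where f: "K = kernel f" by (auto simp: toeplitz_iff_kernel)
  have tn: "tn_fun f" using K by (simp add: f totally_nonneg_kernel)
  have nn: "f x \<ge> 0" for x by (rule tn_fun_nonneg[OF tn])
  have meas [measurable]: "K \<in> borel_measurable lebesgue" using K by (simp add: lebesgue_measurable_kernel_def)
  have Knn: "K p \<ge> 0" for p using nn by (simp add: f kernel_def case_prod_unfold)
  have "tn_fun (\<lambda>x. F (f x)) \<and> lebesgue_measurable_kernel (F \<circ> K)"
    using F
  proof (elim disjE)
    assume F: "\<forall>x\<ge>0. F x = c"
    then have "(\<lambda>x. F (f x)) = (\<lambda>x. c * (if x \<in> UNIV then 1 else 0))" "F \<circ> K = (\<lambda>p. c)"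
      using nn Knn by auto
    moreover have "tn_fun (\<lambda>x. c * (if x \<in> (UNIV :: real set) then 1 else 0))"
      by (intro tn_fun_smult tn_fun_indicator_up) (use c in auto)
    ultimately show ?thesis by (simp add: lebesgue_measurable_kernel_def)
  next
    assume F: "\<forall>x\<ge>0. F x = c * x"
    then have "(\<lambda>x. F (f x)) = (\<lambda>x. c * f x)" "F \<circ> K = (\<lambda>p. c * K p)"
      using nn Knn by auto
    moreover have "tn_fun (\<lambda>x. c * f x)" using tn c by (intro tn_fun_smult) auto
    ultimately show ?thesis by (simp add: lebesgue_measurable_kernel_def)
  next
    assume F: "\<forall>x\<ge>0. F x = c * (if x > 0 then 1 else 0)"
    then have "(\<lambda>x. F (f x)) = (\<lambda>x. c * (if f x > 0 then 1 else 0))"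
      "F \<circ> K = (\<lambda>p. c * (if K p > 0 then 1 else 0))"
      using nn Knn by (auto simp: fun_eq_iff)
    moreover have "tn_fun (\<lambda>x. c * (if f x > 0 then 1 else 0))"
      using c by (intro tn_fun_smult tn_fun_support_indicator tn) auto
    moreover have "(\<lambda>p. c * (if K p > 0 then 1 else 0)) \<in> borel_measurable lebesgue" by measurable
    ultimately show ?thesis by (simp only: lebesgue_measurable_kernel_def)
  qed
  then show "totally_nonneg (F \<circ> K) \<and> lebesgue_measurable_kernel (F \<circ> K) \<and> toeplitz (F \<circ> K)"
    by (simp add: f comp_kernel totally_nonneg_kernel toeplitz_kernel)
qed

lemma tp_preserver_classification:
  assumes F: "F \<in> {0<..} \<rightarrow> {0<..}"
    and preserved: "\<And>f. tp_fun f \<Longrightarrow> f \<in> borel_measurable borel \<Longrightarrow> tp_fun (\<lambda>x. F (f x))"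
  shows "\<exists>c>0. \<forall>x>0. F x = c * x"
proof -
  interpret tp_to_tn F
  proof
    show "tn_fun (\<lambda>x. F (f x))" if "tp_fun f" "continuous_on UNIV f" for f
      using that by (intro tp_fun_imp_tn_fun preserved borel_measurable_continuous_onI)
  qed (use F in auto)
  obtain c where c: "c > 0" "(\<forall>x>0. F x = c) \<or> (\<forall>x>0. F x = c * x)"
    using constant_or_linear by blast
  have "\<not> (\<forall>x>0. F x = c)"
  proof
    assume const: "\<forall>x>0. F x = c"
    let ?f = "\<lambda>x::real. exp (- 1 * x\<^sup>2)"
    have "?f \<in> borel_measurable borel"
      by (intro borel_measurable_continuous_onI continuous_intros)
    then have "tp_fun (\<lambda>x. F (?f x))" by (intro preserved[of ?f] tp_fun_gaussian) auto
    also have "(\<lambda>x. F (?f x)) = (\<lambda>_. c)" using const by auto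
    finally show False using not_tp_fun_const by blast
  qed
  with c show ?thesis by blast
qed

lemma linear_tp:
  assumes c: "c > 0" and F: "\<forall>x>0. F x = c * x" and K: "totally_pos K" "toeplitz K"
  shows "totally_pos (F \<circ> K) \<and> toeplitz (F \<circ> K) \<and> F \<circ> K = (\<lambda>p. c * K p)"
proof -
  obtain f where f: "K = kernel f" using K(2) by (auto simp: toeplitz_iff_kernel)
  have tp: "tp_fun f" using K(1) by (simp add: f totally_pos_kernel)
  have eq: "(\<lambda>x. F (f x)) = (\<lambda>x. c * f x)" using F tp_fun_pos[OF tp] by auto
  have "F \<circ> K = (\<lambda>p. c * K p)"
    using F tp_fun_pos[OF tp] by (auto simp: f kernel_def)
  moreover have "tp_fun (\<lambda>x. c * f x)" using tp c by (rule tp_fun_smult)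
  ultimately show ?thesis
    using toeplitz_kernel[of "\<lambda>x. c * f x"] totally_pos_kernel[of "\<lambda>x. c * f x"]
    by (simp add: f comp_kernel eq)
qed

theorem theorem1p5:
  "(\<forall>F :: real \<Rightarrow> real. F \<in> {0..} \<rightarrow> {0..} \<longrightarrow> (\<exists>x\<ge>0. F x \<noteq> 0) \<longrightarrow>
      ((\<forall>K. totally_nonneg K \<and> lebesgue_measurable_kernel K \<and> toeplitz K \<longrightarrow>
            totally_nonneg (F \<circ> K) \<and> lebesgue_measurable_kernel (F \<circ> K) \<and> toeplitz (F \<circ> K))
       \<longleftrightarrow>
       (\<exists>c>0. (\<forall>x\<ge>0. F x = c) \<or> (\<forall>x\<ge>0. F x = c * x) \<or>
              (\<forall>x\<ge>0. F x = c * (if x > 0 then 1 else 0)))))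
   \<and>
   (\<forall>F :: real \<Rightarrow> real. F \<in> {0<..} \<rightarrow> {0<..} \<longrightarrow>
      ((\<forall>K. totally_pos K \<and> toeplitz K \<longrightarrow> totally_pos (F \<circ> K) \<and> toeplitz (F \<circ> K))
       \<longleftrightarrow>
       (\<forall>K. totally_pos K \<and> lebesgue_measurable_kernel K \<and> toeplitz K \<longrightarrow>
            totally_pos (F \<circ> K) \<and> lebesgue_measurable_kernel (F \<circ> K) \<and> toeplitz (F \<circ> K)))
      \<and>
      ((\<forall>K. totally_pos K \<and> lebesgue_measurable_kernel K \<and> toeplitz K \<longrightarrow>
            totally_pos (F \<circ> K) \<and> lebesgue_measurable_kernel (F \<circ> K) \<and> toeplitz (F \<circ> K))
       \<longleftrightarrow>
       (\<exists>c>0. \<forall>x>0. F x = c * x)))"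
proof (intro conjI allI impI)
  fix F :: "real \<Rightarrow> real"
  assume F: "F \<in> {0..} \<rightarrow> {0..}" "\<exists>x\<ge>0. F x \<noteq> 0"
  show "(\<forall>K. totally_nonneg K \<and> lebesgue_measurable_kernel K \<and> toeplitz K \<longrightarrow>
            totally_nonneg (F \<circ> K) \<and> lebesgue_measurable_kernel (F \<circ> K) \<and> toeplitz (F \<circ> K))
       \<longleftrightarrow>
       (\<exists>c>0. (\<forall>x\<ge>0. F x = c) \<or> (\<forall>x\<ge>0. F x = c * x) \<or>
              (\<forall>x\<ge>0. F x = c * (if x > 0 then 1 else 0)))"
    unfolding tn_preserver_def[symmetric]
    using tn_preserver_classification[OF F] tn_preserver_if by blast
next
  fix F :: "real \<Rightarrow> real"
  assume F: "F \<in> {0<..} \<rightarrow> {0<..}"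
  let ?a = "\<forall>K. totally_pos K \<and> toeplitz K \<longrightarrow> totally_pos (F \<circ> K) \<and> toeplitz (F \<circ> K)"
  let ?b = "\<forall>K. totally_pos K \<and> lebesgue_measurable_kernel K \<and> toeplitz K \<longrightarrow>
            totally_pos (F \<circ> K) \<and> lebesgue_measurable_kernel (F \<circ> K) \<and> toeplitz (F \<circ> K)"
  let ?c = "\<exists>c>0. \<forall>x>0. F x = c * x"
  have tp: "tp_fun (\<lambda>x. F (f x))" if "totally_pos (F \<circ> kernel f)" for f
    using that by (simp only: comp_kernel totally_pos_kernel)
  \<comment> \<open>The conditions \<open>?a\<close> and \<open>?b\<close> are compared through
    \<open>?c\<close>: each implies it because the test functions are continuous, and it gives back
    both.\<close>
  have ac: ?c if ?a
    using that toeplitz_kernel by (intro tp_preserver_classification[OF F] tp) (auto simp: totally_pos_kernel)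
  have bc: ?c if ?b
    using that toeplitz_kernel measurable_kernel
    by (intro tp_preserver_classification[OF F] tp) (auto simp: totally_pos_kernel)
  have ca: ?a if ?c
    using that linear_tp by blast
  have cb: ?b if lin: ?c
  proof (intro allI impI)
    fix K assume K: "totally_pos K \<and> lebesgue_measurable_kernel K \<and> toeplitz K"
    obtain c where "c > 0" "\<forall>x>0. F x = c * x" using lin by blast
    with K linear_tp have "totally_pos (F \<circ> K) \<and> toeplitz (F \<circ> K) \<and> F \<circ> K = (\<lambda>p. c * K p)"
      by blast
    moreover have "(\<lambda>p. c * K p) \<in> borel_measurable lebesgue"
      using K unfolding lebesgue_measurable_kernel_def
      by (intro borel_measurable_times borel_measurable_const) simp
    ultimately show "totally_pos (F \<circ> K) \<and> lebesgue_measurable_kernel (F \<circ> K) \<and> toeplitz (F \<circ> K)"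
      unfolding lebesgue_measurable_kernel_def by auto
  qed
  from ac bc ca cb show "?a \<longleftrightarrow> ?b" "?b \<longleftrightarrow> ?c" by blast+
qed

end
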